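(* Let $(\ast)$ denote the following form of a real-valued function $F$ near the origin in $\mathbb{C}^2$: $$F=r(z_2,\bar z_2)|z_1|^2+s(z_1,z_2,\bar z_2)+\overline{s(z_1,z_2,\bar z_2)},\qquad s=t(z_2,\bar z_2)z_1^2+u(z_2,\bar z_2)z_1+v(z_2,\bar z_2),$$ where $r,t,u,v$ are smooth functions near $0\in\mathbb{C}$ such that, after possibly shrinking the neighborhood: (a) $\displaystyle r(z_2,\bar z_2)=\frac{2|\rho'(z_2)|}{1-|\rho(z_2)|^2}$ for some holomorphic function $\rho$ on a disk around $0$ with nowhere vanishing derivative and values in the open unit disk; (b) $\displaystyle t=\int\frac{r^2}{4}\,d\bar z_2$; (c) $u$ is a (complex-valued, smooth) solution of $\displaystyle u_{\bar 2}=\frac r2\,\bar u$ near $0$; (d) $\displaystyle \operatorname{Re} v=\int\left(\int\frac r8|u|^2\,d\bar z_2\right)dz_2$. (In (b) and (d) the integrals denote term-by-term integration of power series; $r$ and every solution $u$ in (c) are real-analytic.) Then: 1. Let $M$ be the germ at the origin of a rigid hypersurface $\operatorname{Re} z_3=F(z_1,\bar z_1,z_2,\bar z_2)$ in $\mathbb{C}^3$ of the class $\mathfrak{C}_{2,1}$, with $F_{1\bar 1}>0$ everywhere, such that $S_1=0$ and $S_{\bar 1}=0$, where $S:=\left(F_{1\bar 2}/F_{1\bar 1}\right)_1$, and such that $F_{1\bar 1}$ depends only on $z_2,\bar z_2$. Then $M$ is rigidly equivalent to the germ at the origin of a rigid hypersurface whose graphing function has the form $(\ast)$. 2. Conversely,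 the germ at the origin of any rigid hypersurface $\operatorname{Re} z_3=F$ with $F$ of the form $(\ast)$ is of the class $\mathfrak{C}_{2,1}$, and its graphing function $F$ satisfies $S_1=0$, $S_{\bar 1}=0$, and $F_{1\bar 1}$ depends only on $z_2,\bar z_2$ (with $F_{1\bar 1}>0$).
   Context: Notation: subscripts $1,\bar 1,2,\bar 2$ denote partial derivatives with respect to $z_1,\bar z_1,z_2,\bar z_2$, respectively. "Smooth" means $C^\infty$. All objects are considered as germs, so domains may be shrunk. Rigid hypersurface germ: the germ at the origin in $\mathbb{C}^3$ of a real hypersurface $\operatorname{Re} z_3=F(z_1,\bar z_1,z_2,\bar z_2)$, where $F$ (the graphing function) is a smooth real-valued function near $0\in\mathbb{C}^2$ with $F(0)=0$. Rigid equivalence: two germs of rigid hypersurfaces at $0\in\mathbb{C}^3$ are rigidly equivalent if one is carried to the other by a map $$(z_1,z_2,z_3)\mapsto\bigl(f_1(z_1,z_2),\,f_2(z_1,z_2),\,az_3+f_3(z_1,z_2)\bigr),\quad a\in\mathbb{R}^*,$$ nondegenerate at the origin, with $f_j$ holomorphic near $0$ and $f_j(0)=0$ for $j=1,2,3$. Class $\mathfrak{C}_{2,1}$: connected 5-dimensional CR-hypersurfaces that are 2-nondegenerate and uniformly Levi degenerate of rank 1 (the Levi form has rank exactly 1 at every point). For a rigid hypersurface $\operatorname{Re} z_3=F$ in $\mathbb{C}^3$ with $F_{1\bar 1}>0$, uniform Levi degeneracy of rank 1 is the condition $F_{1\bar 1}F_{2\bar 2}-|F_{1\bar 2}|^2=0$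 (complex homogeneous Monge–Ampère equation), and, given this, 2-nondegeneracy is expressed as $S\ne 0$ everywhere, where $S:=\left(F_{1\bar 2}/F_{1\bar 1}\right)_1$. Integral convention: for a real-analytic function $g(z_2,\bar z_2)=\sum a_{jk}z_2^j\bar z_2^k$ near $0$, $\int g\,d\bar z_2:=\sum \frac{a_{jk}}{k+1}z_2^j\bar z_2^{k+1}$ and $\int g\,dz_2:=\sum\frac{a_{jk}}{j+1}z_2^{j+1}\bar z_2^k$. *)

theory Defs
  imports "HOL-Analysis.Analysis"
begin

text \<open>
  Germs at the origin are represented by total functions (or sets) of which only the restriction to
  some neighbourhood of \<open>0\<close> matters: a pointwise property ``near \<open>0\<close>'' is written
  \<open>\<forall>\<^sub>F p in nhds 0. \<dots>\<close>.
\<close>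

section \<open>Smoothness and Wirtinger derivatives\<close>

text \<open>To be used on open sets \<open>S\<close>.\<close>

primrec Ck_on :: "nat \<Rightarrow> ('a::euclidean_space \<Rightarrow> 'b::real_normed_vector) \<Rightarrow> 'a set \<Rightarrow> bool" where
  "Ck_on 0 f S \<longleftrightarrow> continuous_on S f"
| "Ck_on (Suc k) f S \<longleftrightarrow>
     (\<forall>x\<in>S. f differentiable (at x)) \<and> (\<forall>v. Ck_on k (\<lambda>x. frechet_derivative f (at x) v) S)"

definition smooth_on :: "('a::euclidean_space \<Rightarrow> 'b::real_normed_vector) \<Rightarrow> 'a set \<Rightarrow> bool" where
  "smooth_on f S \<longleftrightarrow> (\<forall>k. Ck_on k f S)"

definition smooth_near_0 :: "('a::euclidean_space \<Rightarrow> 'b::real_normed_vector) \<Rightarrow> bool" where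
  "smooth_near_0 f \<longleftrightarrow> (\<exists>U. open U \<and> 0 \<in> U \<and> smooth_on f U)"

definition wbar :: "(complex \<Rightarrow> complex) \<Rightarrow> complex \<Rightarrow> complex" where
  "wbar f z = (frechet_derivative f (at z) 1 + \<i> * frechet_derivative f (at z) \<i>) / 2"

text \<open>\<open>pd j f\<close> and \<open>pdbar j f\<close> are the derivatives of \<open>f\<close> with respect to \<open>z\<^sub>j\<close> and to the conjugate
  of \<open>z\<^sub>j\<close>, i.e. \<open>(\<partial>\<^sub>x \<mp> \<i> \<partial>\<^sub>y) / 2\<close> in the \<open>j\<close>-th complex coordinate.\<close>

definition pd :: "'n::finite \<Rightarrow> (complex^'n \<Rightarrow> complex) \<Rightarrow> complex^'n \<Rightarrow> complex" where
  "pd j f p = (frechet_derivative f (at p) (axis j 1) - \<i> * frechet_derivative f (at p) (axis j \<i>)) / 2"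

definition pdbar :: "'n::finite \<Rightarrow> (complex^'n \<Rightarrow> complex) \<Rightarrow> complex^'n \<Rightarrow> complex" where
  "pdbar j f p = (frechet_derivative f (at p) (axis j 1) + \<i> * frechet_derivative f (at p) (axis j \<i>)) / 2"

text \<open>Holomorphy in several variables, as complex differentiability; to be used on open sets.\<close>

definition holomorphic_vec_on :: "(complex^'n::finite \<Rightarrow> complex) \<Rightarrow> (complex^'n) set \<Rightarrow> bool" where
  "holomorphic_vec_on f U \<longleftrightarrow>
     (\<forall>p\<in>U. \<exists>c. (f has_derivative (\<lambda>h. \<Sum>j\<in>UNIV. c j * h $ j)) (at p))"


section \<open>Real hypersurfaces in \<open>\<complex>\<^sup>3\<close>\<close>

text \<open>In this section \<open>d\<close> is a real-valued defining function, coerced to complex values.\<close>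

definition holo_tangent :: "(complex^3 \<Rightarrow> complex) \<Rightarrow> complex^3 \<Rightarrow> (complex^3) set" where
  "holo_tangent d p = {v. (\<Sum>j\<in>UNIV. pd j d p * v $ j) = 0}"

definition levi_form ::
  "(complex^3 \<Rightarrow> complex) \<Rightarrow> complex^3 \<Rightarrow> complex^3 \<Rightarrow> complex^3 \<Rightarrow> complex" where
  "levi_form d p v w = (\<Sum>j\<in>UNIV. \<Sum>k\<in>UNIV. pdbar k (pd j d) p * v $ j * cnj (w $ k))"

definition levi_kernel :: "(complex^3 \<Rightarrow> complex) \<Rightarrow> complex^3 \<Rightarrow> (complex^3) set" where
  "levi_kernel d p = {v \<in> holo_tangent d p. \<forall>w\<in>holo_tangent d p. levi_form d p v w = 0}"

definition levi_rank :: "(complex^3 \<Rightarrow> complex) \<Rightarrow> complex^3 \<Rightarrow> nat" where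
  "levi_rank d p = vec.dim (holo_tangent d p) - vec.dim (levi_kernel d p)"

text \<open>Where the derivative of \<open>d\<close> with respect to \<open>z\<^sub>3\<close> does not vanish, the fields \<open>CR_field d 1\<close>
  and \<open>CR_field d 2\<close> form a basis of the (0,1) vector fields tangent to the level sets of \<open>d\<close>.\<close>

definition CR_field :: "(complex^3 \<Rightarrow> complex) \<Rightarrow> 3 \<Rightarrow> (complex^3 \<Rightarrow> complex) \<Rightarrow> complex^3 \<Rightarrow> complex" where
  "CR_field d j f p = pdbar j f p - pdbar j d p / pdbar 3 d p * pdbar 3 f p"

primrec CR_iter ::
  "(complex^3 \<Rightarrow> complex) \<Rightarrow> 3 list \<Rightarrow> (complex^3 \<Rightarrow> complex) \<Rightarrow> complex^3 \<Rightarrow> complex" where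
  "CR_iter d [] f = f"
| "CR_iter d (j # js) f = CR_field d j (CR_iter d js f)"

text \<open>\<open>k\<close>-nondegeneracy in the sense of Baouendi, Ebenfelt and Rothschild: \<open>k\<close> is the least number
  such that the vectors obtained by applying at most \<open>k\<close> CR vector fields to the complex gradient of
  the defining function span \<open>\<complex>\<^sup>3\<close>.\<close>

definition CR_span :: "nat \<Rightarrow> (complex^3 \<Rightarrow> complex) \<Rightarrow> complex^3 \<Rightarrow> (complex^3) set" where
  "CR_span k d p =
     vec.span {\<chi> i. CR_iter d js (pd i d) p | js. set js \<subseteq> {1, 2} \<and> length js \<le> k}"

definition nondegenerate_at :: "nat \<Rightarrow> (complex^3 \<Rightarrow> complex) \<Rightarrow> complex^3 \<Rightarrow> bool" where
  "nondegenerate_at k d p \<longleftrightarrow> CR_span k d p = UNIV \<and> (\<forall>l<k. CR_span l d p \<noteq> UNIV)"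


section \<open>Rigid hypersurfaces\<close>

definition proj12 :: "complex^3 \<Rightarrow> complex^2" where
  "proj12 p = vector [p $ 1, p $ 2]"

definition rigid_hypersurface :: "(complex^2 \<Rightarrow> real) \<Rightarrow> (complex^3) set" where
  "rigid_hypersurface F = {p. Re (p $ 3) = F (proj12 p)}"

definition rigid_defining :: "(complex^2 \<Rightarrow> real) \<Rightarrow> complex^3 \<Rightarrow> complex" where
  "rigid_defining F p = of_real (F (proj12 p) - Re (p $ 3))"

definition graphing_germ :: "(complex^2 \<Rightarrow> real) \<Rightarrow> bool" where
  "graphing_germ F \<longleftrightarrow> smooth_near_0 F \<and> F 0 = 0"

text \<open>The germ at \<open>0\<close> of the hypersurface with graphing function \<open>F\<close> belongs to the class
  \<open>\<CC>\<^sub>2\<^sub>,\<^sub>1\<close>. For rigid hypersurfaces with \<open>F\<^bsub>1 1bar\<^esub> > 0\<close> the rank condition amounts to the complex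
  Monge--Ampere equation for \<open>F\<close>, and, given this, 2-nondegeneracy to \<open>S_fun F \<noteq> 0\<close> (see below).\<close>

definition class_C21 :: "(complex^2 \<Rightarrow> real) \<Rightarrow> bool" where
  "class_C21 F \<longleftrightarrow>
     (\<exists>U. open U \<and> 0 \<in> U \<and> smooth_on F U \<and>
        connected {p \<in> rigid_hypersurface F. proj12 p \<in> U} \<and>
        (\<forall>p\<in>rigid_hypersurface F. proj12 p \<in> U \<longrightarrow>
           levi_rank (rigid_defining F) p = 1 \<and> nondegenerate_at 2 (rigid_defining F) p))"

definition rigid_map ::
  "(complex^2 \<Rightarrow> complex) \<Rightarrow> (complex^2 \<Rightarrow> complex) \<Rightarrow> (complex^2 \<Rightarrow> complex) \<Rightarrow> real \<Rightarrow>
   complex^3 \<Rightarrow> complex^3" where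
  "rigid_map f1 f2 f3 a p =
     vector [f1 (proj12 p), f2 (proj12 p), of_real a * p $ 3 + f3 (proj12 p)]"

text \<open>Rigid equivalence of the germs at \<open>0\<close> of two subsets of \<open>\<complex>\<^sup>3\<close>.\<close>

definition rigidly_equivalent :: "(complex^3) set \<Rightarrow> (complex^3) set \<Rightarrow> bool" where
  "rigidly_equivalent M N \<longleftrightarrow>
     (\<exists>f1 f2 f3 a U W.
        open U \<and> 0 \<in> U \<and>
        holomorphic_vec_on f1 U \<and> holomorphic_vec_on f2 U \<and> holomorphic_vec_on f3 U \<and>
        f1 0 = 0 \<and> f2 0 = 0 \<and> f3 0 = 0 \<and> a \<noteq> 0 \<and>
        det (\<chi> i j. pd j (\<lambda>p. rigid_map f1 f2 f3 a p $ i) 0) \<noteq> 0 \<and>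
        open W \<and> 0 \<in> W \<and> proj12 ` W \<subseteq> U \<and>
        inj_on (rigid_map f1 f2 f3 a) W \<and> open (rigid_map f1 f2 f3 a ` W) \<and>
        rigid_map f1 f2 f3 a ` (M \<inter> W) = N \<inter> rigid_map f1 f2 f3 a ` W)"

definition F11 :: "(complex^2 \<Rightarrow> real) \<Rightarrow> complex^2 \<Rightarrow> complex" where
  "F11 F = pdbar 1 (pd 1 (\<lambda>p. of_real (F p)))"

definition F12 :: "(complex^2 \<Rightarrow> real) \<Rightarrow> complex^2 \<Rightarrow> complex" where
  "F12 F = pdbar 2 (pd 1 (\<lambda>p. of_real (F p)))"

definition S_fun :: "(complex^2 \<Rightarrow> real) \<Rightarrow> complex^2 \<Rightarrow> complex" where
  "S_fun F = pd 1 (\<lambda>p. F12 F p / F11 F p)"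

definition F11_positive :: "(complex^2 \<Rightarrow> real) \<Rightarrow> bool" where
  "F11_positive F \<longleftrightarrow> (\<forall>\<^sub>F p in nhds 0. F11 F p \<in> \<real> \<and> Re (F11 F p) > 0)"

definition S_conditions :: "(complex^2 \<Rightarrow> real) \<Rightarrow> bool" where
  "S_conditions F \<longleftrightarrow> (\<forall>\<^sub>F p in nhds 0. pd 1 (S_fun F) p = 0 \<and> pdbar 1 (S_fun F) p = 0)"

definition F11_only_z2 :: "(complex^2 \<Rightarrow> real) \<Rightarrow> bool" where
  "F11_only_z2 F \<longleftrightarrow> (\<exists>g :: complex \<Rightarrow> complex. \<forall>\<^sub>F p in nhds 0. F11 F p = g (p $ 2))"


section \<open>The normal form\<close>

text \<open>Term-by-term integration of a convergent power series in \<open>z\<close> and \<open>cnj z\<close>: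
  \<open>zbar_integral g G\<close> says that the germ of \<open>g\<close> at \<open>0\<close> has such an expansion (unique, if it exists)
  and that \<open>G\<close> is the integral of \<open>g\<close> with respect to the conjugate variable; similarly for
  \<open>z_integral\<close>. Over \<open>\<complex>\<close>, \<open>has_sum\<close> is absolute convergence.\<close>

definition zbar_integral :: "(complex \<Rightarrow> complex) \<Rightarrow> (complex \<Rightarrow> complex) \<Rightarrow> bool" where
  "zbar_integral g G \<longleftrightarrow>
     (\<exists>a :: nat \<Rightarrow> nat \<Rightarrow> complex. \<forall>\<^sub>F z in nhds 0.
        ((\<lambda>(j, k). a j k * z ^ j * cnj z ^ k) has_sum g z) UNIV \<and>
        ((\<lambda>(j, k). a j k / of_nat (k + 1) * z ^ j * cnj z ^ (k + 1)) has_sum G z) UNIV)"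

definition z_integral :: "(complex \<Rightarrow> complex) \<Rightarrow> (complex \<Rightarrow> complex) \<Rightarrow> bool" where
  "z_integral g G \<longleftrightarrow>
     (\<exists>a :: nat \<Rightarrow> nat \<Rightarrow> complex. \<forall>\<^sub>F z in nhds 0.
        ((\<lambda>(j, k). a j k * z ^ j * cnj z ^ k) has_sum g z) UNIV \<and>
        ((\<lambda>(j, k). a j k / of_nat (j + 1) * z ^ (j + 1) * cnj z ^ k) has_sum G z) UNIV)"

definition r_condition :: "(complex \<Rightarrow> real) \<Rightarrow> bool" where
  "r_condition r \<longleftrightarrow>
     (\<exists>\<rho> e. e > 0 \<and> \<rho> holomorphic_on ball 0 e \<and>
        (\<forall>z\<in>ball 0 e. deriv \<rho> z \<noteq> 0 \<and> cmod (\<rho> z) < 1 \<and>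
           r z = 2 * cmod (deriv \<rho> z) / (1 - (cmod (\<rho> z))\<^sup>2)))"

definition normal_form :: "(complex^2 \<Rightarrow> real) \<Rightarrow> bool" where
  "normal_form F \<longleftrightarrow>
     (\<exists>(r :: complex \<Rightarrow> real) (t :: complex \<Rightarrow> complex) (u :: complex \<Rightarrow> complex)
        (v :: complex \<Rightarrow> complex).
        smooth_near_0 r \<and> smooth_near_0 t \<and> smooth_near_0 u \<and> smooth_near_0 v \<and>
        (\<forall>\<^sub>F p in nhds 0.
           let z1 = p $ 1; z2 = p $ 2; s = t z2 * z1\<^sup>2 + u z2 * z1 + v z2
           in complex_of_real (F p) = of_real (r z2) * of_real ((cmod z1)\<^sup>2) + s + cnj s) \<and>
        r_condition r \<and>
        zbar_integral (\<lambda>z. of_real ((r z)\<^sup>2 / 4)) t \<and>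
        (\<forall>\<^sub>F z in nhds 0. wbar u z = of_real (r z / 2) * cnj (u z)) \<and>
        (\<exists>G. zbar_integral (\<lambda>z. of_real (r z / 8 * (cmod (u z))\<^sup>2)) G \<and>
             z_integral G (\<lambda>z. of_real (Re (v z)))))"

end

theory Submission
  imports Defs "HOL-Complex_Analysis.Conformal_Mappings"
begin

text \<open>
  For the second part, let \<open>F\<close> be in normal form. Then \<open>F\<^bsub>1 1bar\<^esub> = r\<close>, the derivative
  \<open>F\<^bsub>1 2bar\<^esub>\<close> is affine in \<open>z\<^sub>1\<close> and its conjugate, and \<open>S = r / 2\<close>. The Monge--Ampere equation is a
  polynomial identity in \<open>z\<^sub>1\<close> and its conjugate; its coefficients are the Liouville equation
  \<open>(log r)\<^bsub>2 2bar\<^esub> = r\<^sup>2 / 4\<close>, which the formula for \<open>r\<close> solves, and consequences of the conditions on \<open>t\<close>,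
  \<open>u\<close> and \<open>v\<close> (lemma \<open>normal_form_derivatives\<close>). What this says about the hypersurface itself is
  linear algebra: lemmas \<open>levi_rank_rigid\<close> and \<open>nondegenerate_rigid\<close>.

  The first part holds in a sharper form: every such hypersurface is rigidly equivalent to one and
  the same model, \<open>Re z\<^sub>3 = 2 (|z\<^sub>1|\<^sup>2 + Re (cnj z\<^sub>2 z\<^sub>1\<^sup>2)) / (1 - |z\<^sub>2|\<^sup>2)\<close>, which is the normal form with
  \<open>\<rho>(z) = z\<close> and \<open>u = v = 0\<close>. Put \<open>\<sigma> = 2 / F\<^bsub>1 1bar\<^esub>\<close>, \<open>k = \<sigma> cnj S\<close>, \<open>X = \<sigma>\<^sub>2 / k\<close> and
  \<open>\<Phi> = cnj (F\<^bsub>1 2bar\<^esub> / (2 S))\<close>. Differentiating the Monge--Ampere equation in \<open>z\<^sub>1\<close> once, and then once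
  more in \<open>z\<^sub>1\<close> or its conjugate, one finds that \<open>k\<close> is holomorphic, that \<open>\<sigma>\<close> satisfies a Liouville
  equation, and that \<open>\<Phi>\<^bsub>1bar\<^esub> = 1 / \<sigma>\<close> and \<open>\<Phi>\<^bsub>2bar\<^esub> = cnj (k \<Phi>) / \<sigma>\<close>. In particular \<open>F\<^sub>1 - 2 \<Phi>\<close> and
  \<open>F\<^sub>2 - k \<Phi>\<^sup>2\<close> are holomorphic, so \<open>\<Phi>\<close> determines \<open>F\<close> up to the real part of a holomorphic function.

  To find \<open>\<sigma>\<close> and \<open>\<Phi>\<close>, observe that \<open>m = X\<^sub>2 / \<sigma>\<close> and, on \<open>z\<^sub>1 = 0\<close>, \<open>n = (\<sigma> \<Phi>)\<^sub>2 / \<sigma>\<close> are holomorphic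
  functions of \<open>z\<^sub>2\<close>. The holomorphic linear system \<open>y' = k x\<close>, \<open>x' = m y\<close> has solutions
  \<open>(y\<^sub>1, x\<^sub>1)\<close>, \<open>(y\<^sub>2, x\<^sub>2)\<close> with \<open>\<sigma> = |y\<^sub>1|\<^sup>2 - |y\<^sub>2|\<^sup>2\<close>, and with the inhomogeneity \<open>n\<close> in the second equation
  a solution \<open>(b, c)\<close> with \<open>\<Phi> = c + (cnj \<zeta> - X \<zeta>) / \<sigma>\<close>, where \<open>\<zeta> = z\<^sub>1 + b\<close>: in each case both sides
  solve the same linear first-order system of partial differential equations with the same value
  at the origin (lemmas \<open>liouville_solution\<close> and \<open>shift_solution\<close>).

  The substitution \<open>z\<^sub>1 \<mapsto> \<zeta> / y\<^sub>1\<close>, \<open>z\<^sub>2 \<mapsto> y\<^sub>2 / y\<^sub>1\<close> turns the graphing function of the model into a function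
  \<open>G\<close> with \<open>G\<^sub>1 = 2 (\<Phi> - \<theta>)\<close> and \<open>G\<^sub>2 = k (\<Phi>\<^sup>2 - \<theta>\<^sup>2)\<close> for a holomorphic \<open>\<theta>\<close>. Hence \<open>F - G\<close> is
  pluriharmonic, thus the real part of a holomorphic function, by which \<open>z\<^sub>3\<close> has to be shifted.
\<close>

section \<open>Smooth functions\<close>

text \<open>
  The derivative is a choice operator, so that functions that agree near a point have the same one
  there even where they are not differentiable.
\<close>

lemma frechet_derivative_cong_open:
  assumes "open S" "x \<in> S" "\<And>y. y \<in> S \<Longrightarrow> f y = g y"
  shows "frechet_derivative f (at x) = frechet_derivative g (at x)"
proof -
  have "(f has_derivative D) (at x) \<longleftrightarrow> (g has_derivative D) (at x)" for D
    using has_derivative_transform_within_open[of f D x UNIV S g]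
      has_derivative_transform_within_open[of g D x UNIV S f] assms by auto
  then show ?thesis unfolding frechet_derivative_def by simp
qed

lemma frechet_derivative_eqI:
  "(f has_derivative D) (at x) \<Longrightarrow> frechet_derivative f (at x) v = D v"
  using frechet_derivative_at by metis

lemma has_frechet_derivative:
  "f differentiable (at x) \<Longrightarrow> (f has_derivative frechet_derivative f (at x)) (at x)"
  using frechet_derivative_works by blast

lemma Ck_on_cong:
  assumes "open S"
  shows "(\<And>x. x \<in> S \<Longrightarrow> f x = g x) \<Longrightarrow> Ck_on k f S \<longleftrightarrow> Ck_on k g S"
proof (induction k arbitrary: f g)
  case 0
  then show ?case by (simp cong: continuous_on_cong)
next
  case (Suc k)
  have d: "f differentiable (at x) \<longleftrightarrow> g differentiable (at x)" if "x \<in> S" for x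
    using has_derivative_transform_within_open[of f _ x UNIV S g]
      has_derivative_transform_within_open[of g _ x UNIV S f] assms Suc.prems that
    unfolding differentiable_def by metis
  have "Ck_on k (\<lambda>x. frechet_derivative f (at x) v) S = Ck_on k (\<lambda>x. frechet_derivative g (at x) v) S" for v
    by (rule Suc.IH) (use frechet_derivative_cong_open[OF assms, of _ f g] Suc.prems in auto)
  with d show ?case by simp
qed

lemma Ck_on_Suc_imp: "Ck_on (Suc k) f S \<Longrightarrow> Ck_on k f S"
proof (induction k arbitrary: f)
  case 0
  then show ?case by (auto intro!: continuous_at_imp_continuous_on dest: differentiable_imp_continuous_within)
next
  case (Suc k)
  then show ?case by (auto simp del: Ck_on.simps(2) simp: Ck_on.simps(2)[of "Suc k"] Ck_on.simps(2)[of k])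
qed

lemma Ck_on_subset: "Ck_on k f S \<Longrightarrow> T \<subseteq> S \<Longrightarrow> Ck_on k f T"
  by (induction k arbitrary: f) (auto intro: continuous_on_subset)

lemma Ck_on_const: "Ck_on k (\<lambda>x. c) S"
  by (induction k arbitrary: c) (auto simp: frechet_derivative_const)

lemma Ck_on_linear:
  assumes "bounded_linear L" shows "Ck_on k L S"
proof (cases k)
  case 0
  then show ?thesis using assms by (simp add: linear_continuous_on)
next
  case (Suc j)
  have "(L has_derivative L) (at x)" for x
    using assms by (rule bounded_linear_imp_has_derivative)
  then have "frechet_derivative L (at x) = L" "L differentiable (at x)" for x
    using frechet_derivative_at by (metis, metis differentiableI)
  then show ?thesis using Suc by (simp add: Ck_on_const)
qed

lemma Ck_on_add:
  assumes "open S"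
  shows "Ck_on k f S \<Longrightarrow> Ck_on k g S \<Longrightarrow> Ck_on k (\<lambda>x. f x + g x) S"
proof (induction k arbitrary: f g)
  case 0
  then show ?case by (auto intro: continuous_intros)
next
  case (Suc k)
  have "Ck_on k (\<lambda>x. frechet_derivative (\<lambda>x. f x + g x) (at x) v) S" for v
  proof -
    have "Ck_on k (\<lambda>x. frechet_derivative f (at x) v + frechet_derivative g (at x) v) S"
      using Suc by auto
    moreover have "frechet_derivative (\<lambda>x. f x + g x) (at x) v
        = frechet_derivative f (at x) v + frechet_derivative g (at x) v" if "x \<in> S" for x
      by (rule frechet_derivative_eqI) (use Suc.prems that in \<open>auto intro!: derivative_intros has_frechet_derivative\<close>)
    ultimately show ?thesis using Ck_on_cong[OF assms] by (metis (no_types, lifting))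
  qed
  then show ?case using Suc.prems by auto
qed

lemma Ck_on_bilinear:
  assumes "open S" "bounded_bilinear B"
  shows "Ck_on k f S \<Longrightarrow> Ck_on k g S \<Longrightarrow> Ck_on k (\<lambda>x. B (f x) (g x)) S"
proof (induction k arbitrary: f g)
  case 0
  then show ?case using assms(2) by (auto intro: bounded_bilinear.continuous_on)
next
  case (Suc k)
  have der: "((\<lambda>x. B (f x) (g x)) has_derivative
        (\<lambda>v. B (f x) (frechet_derivative g (at x) v) + B (frechet_derivative f (at x) v) (g x))) (at x)"
    if "x \<in> S" for x
    using Suc.prems that by (auto intro!: bounded_bilinear.FDERIV[OF assms(2)] has_frechet_derivative)
  have "Ck_on k (\<lambda>x. frechet_derivative (\<lambda>x. B (f x) (g x)) (at x) v) S" for v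
  proof -
    have "Ck_on k f S" "Ck_on k g S"
      using Suc.prems Ck_on_Suc_imp by blast+
    then have "Ck_on k (\<lambda>x. B (f x) (frechet_derivative g (at x) v) + B (frechet_derivative f (at x) v) (g x)) S"
      using Suc.prems by (intro Ck_on_add assms Suc.IH) auto
    moreover have "frechet_derivative (\<lambda>x. B (f x) (g x)) (at x) v
        = B (f x) (frechet_derivative g (at x) v) + B (frechet_derivative f (at x) v) (g x)" if "x \<in> S" for x
      using frechet_derivative_eqI[OF der[OF that]] .
    ultimately show ?thesis using Ck_on_cong[OF assms(1)] by (metis (no_types, lifting))
  qed
  then show ?case using der by (auto intro: differentiableI)
qed

lemma Ck_on_inverse:
  fixes f :: "'a::euclidean_space \<Rightarrow> 'b::{real_normed_field,banach}"
  assumes "open S" "\<And>x. x \<in> S \<Longrightarrow> f x \<noteq> 0"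
  shows "Ck_on k f S \<Longrightarrow> Ck_on k (\<lambda>x. inverse (f x)) S"
proof (induction k)
  case 0
  then show ?case using assms by (auto intro: continuous_intros)
next
  case (Suc k)
  have der: "((\<lambda>x. inverse (f x)) has_derivative
        (\<lambda>v. - (inverse (f x) * frechet_derivative f (at x) v * inverse (f x)))) (at x)"
    if "x \<in> S" for x
    using Suc.prems that assms(2) by (auto intro!: Deriv.has_derivative_inverse[OF _ has_frechet_derivative])
  have I: "Ck_on k (\<lambda>x. inverse (f x)) S" using Suc Ck_on_Suc_imp by blast
  have "Ck_on k (\<lambda>x. frechet_derivative (\<lambda>x. inverse (f x)) (at x) v) S" for v
  proof -
    have "Ck_on k (\<lambda>x. (-1) * ((inverse (f x) * frechet_derivative f (at x) v) * inverse (f x))) S"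
      using Suc.prems I
      by (intro Ck_on_bilinear[OF assms(1) bounded_bilinear_mult] Ck_on_const) auto
    moreover have "frechet_derivative (\<lambda>x. inverse (f x)) (at x) v
        = (-1) * ((inverse (f x) * frechet_derivative f (at x) v) * inverse (f x))" if "x \<in> S" for x
      using frechet_derivative_eqI[OF der[OF that]] by simp
    ultimately show ?thesis using Ck_on_cong[OF assms(1)] by (metis (no_types, lifting))
  qed
  then show ?case using der by (auto intro: differentiableI)
qed

lemma smooth_on_subset: "smooth_on f S \<Longrightarrow> T \<subseteq> S \<Longrightarrow> smooth_on f T"
  unfolding smooth_on_def using Ck_on_subset by blast

lemma smooth_on_differentiable: "smooth_on f S \<Longrightarrow> x \<in> S \<Longrightarrow> f differentiable (at x)"
  unfolding smooth_on_def using Ck_on.simps(2) by blast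

lemma smooth_on_frechet: "smooth_on f S \<Longrightarrow> smooth_on (\<lambda>x. frechet_derivative f (at x) v) S"
  unfolding smooth_on_def using Ck_on.simps(2) by blast

lemma smooth_on_continuous: "smooth_on f S \<Longrightarrow> continuous_on S f"
  unfolding smooth_on_def using Ck_on.simps(1) by blast

lemma smooth_on_const: "smooth_on (\<lambda>x. c) S"
  unfolding smooth_on_def using Ck_on_const by blast

lemma smooth_on_linear: "bounded_linear L \<Longrightarrow> smooth_on L S"
  unfolding smooth_on_def using Ck_on_linear by blast

lemma smooth_on_add:
  "open S \<Longrightarrow> smooth_on f S \<Longrightarrow> smooth_on g S \<Longrightarrow> smooth_on (\<lambda>x. f x + g x) S"
  unfolding smooth_on_def using Ck_on_add by blast

lemma smooth_on_mult:
  fixes f g :: "'a::euclidean_space \<Rightarrow> 'b::real_normed_algebra"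
  shows "open S \<Longrightarrow> smooth_on f S \<Longrightarrow> smooth_on g S \<Longrightarrow> smooth_on (\<lambda>x. f x * g x) S"
  unfolding smooth_on_def using Ck_on_bilinear[OF _ bounded_bilinear_mult] by blast

text \<open>
  The bilinear rule applied to \<open>(a, y) \<mapsto> a L y\<close> and the constant function \<open>a = 1\<close>.
\<close>

lemma smooth_on_post_linear:
  assumes "bounded_linear L" "open S" "smooth_on f S"
  shows "smooth_on (\<lambda>x. L (f x)) S"
proof -
  have "bounded_bilinear (\<lambda>(a::real) y. a *\<^sub>R L y)"
    using bounded_bilinear.comp[OF bounded_bilinear_scaleR bounded_linear_ident assms(1)] by simp
  from Ck_on_bilinear[OF assms(2) this, of _ "\<lambda>_. 1" f] assms(3) show ?thesis
    unfolding smooth_on_def by (simp add: Ck_on_const)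
qed

lemma smooth_on_uminus:
  "open S \<Longrightarrow> smooth_on f S \<Longrightarrow> smooth_on (\<lambda>x. - f x) S"
  using smooth_on_post_linear[of uminus S f] bounded_linear_minus[OF bounded_linear_ident] by simp

lemma smooth_on_diff:
  "open S \<Longrightarrow> smooth_on f S \<Longrightarrow> smooth_on g S \<Longrightarrow> smooth_on (\<lambda>x. f x - g x) S"
  using smooth_on_add[of S f "\<lambda>x. - g x"] smooth_on_uminus by auto

lemma smooth_on_inverse:
  fixes f :: "'a::euclidean_space \<Rightarrow> 'b::{real_normed_field,banach}"
  shows "open S \<Longrightarrow> smooth_on f S \<Longrightarrow> (\<And>x. x \<in> S \<Longrightarrow> f x \<noteq> 0) \<Longrightarrow> smooth_on (\<lambda>x. inverse (f x)) S"
  unfolding smooth_on_def using Ck_on_inverse by blast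

lemma smooth_on_divide:
  fixes f g :: "'a::euclidean_space \<Rightarrow> 'b::{real_normed_field,banach}"
  shows "open S \<Longrightarrow> smooth_on f S \<Longrightarrow> smooth_on g S \<Longrightarrow> (\<And>x. x \<in> S \<Longrightarrow> g x \<noteq> 0) \<Longrightarrow>
    smooth_on (\<lambda>x. f x / g x) S"
  unfolding divide_inverse by (intro smooth_on_mult smooth_on_inverse)

lemma smooth_on_power:
  fixes f :: "'a::euclidean_space \<Rightarrow> 'b::{real_normed_algebra_1}"
  shows "open S \<Longrightarrow> smooth_on f S \<Longrightarrow> smooth_on (\<lambda>x. f x ^ n) S"
  by (induction n) (auto intro: smooth_on_const smooth_on_mult)

lemma smooth_on_cnj: "open S \<Longrightarrow> smooth_on f S \<Longrightarrow> smooth_on (\<lambda>x. cnj (f x)) S"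
  using smooth_on_post_linear[OF bounded_linear_cnj] .

lemma smooth_on_of_real:
  "open S \<Longrightarrow> smooth_on f S \<Longrightarrow> smooth_on (\<lambda>x. of_real (f x) :: complex) S"
  using smooth_on_post_linear[OF bounded_linear_of_real] .

lemma smooth_on_Re: "open S \<Longrightarrow> smooth_on f S \<Longrightarrow> smooth_on (\<lambda>x. Re (f x)) S"
  using smooth_on_post_linear[OF bounded_linear_Re] .

lemma Ck_on_compose_linear:
  assumes "bounded_linear L" "open T" "\<And>x. x \<in> T \<Longrightarrow> L x \<in> S"
  shows "Ck_on k f S \<Longrightarrow> Ck_on k (\<lambda>x. f (L x)) T"
proof (induction k arbitrary: f)
  case 0
  then show ?case using assms
    using continuous_on_compose2[of S f T L] linear_continuous_on[of L T] by auto
next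
  case (Suc k)
  have der: "((\<lambda>x. f (L x)) has_derivative (\<lambda>v. frechet_derivative f (at (L x)) (L v))) (at x)"
    if "x \<in> T" for x
    using Suc.prems that assms(3)[OF that]
      has_derivative_compose[OF bounded_linear_imp_has_derivative[OF assms(1)], of f _ x]
    by (auto dest!: has_frechet_derivative)
  have "Ck_on k (\<lambda>x. frechet_derivative (\<lambda>x. f (L x)) (at x) v) T" for v
  proof -
    have "Ck_on k (\<lambda>x. frechet_derivative f (at (L x)) (L v)) T"
      by (rule Suc.IH) (use Suc.prems in auto)
    moreover have "frechet_derivative (\<lambda>x. f (L x)) (at x) v
        = frechet_derivative f (at (L x)) (L v)" if "x \<in> T" for x
      using frechet_derivative_eqI[OF der[OF that]] .
    ultimately show ?thesis using Ck_on_cong[OF assms(2)] by (metis (no_types, lifting))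
  qed
  then show ?case using der by (auto intro: differentiableI)
qed

lemma smooth_on_compose_linear:
  assumes "smooth_on f S" "bounded_linear L" "open T" "\<And>x. x \<in> T \<Longrightarrow> L x \<in> S"
  shows "smooth_on (\<lambda>x. f (L x)) T"
  using assms Ck_on_compose_linear unfolding smooth_on_def by blast

lemma holomorphic_imp_smooth_on:
  assumes "f holomorphic_on S" "open S"
  shows "smooth_on f S"
proof -
  have "Ck_on k f S" for k
    using assms(1)
  proof (induction k arbitrary: f)
    case 0
    then show ?case by (simp add: holomorphic_on_imp_continuous_on)
  next
    case (Suc k)
    have der: "(f has_derivative (*) (deriv f x)) (at x)" if "x \<in> S" for x
      using holomorphic_derivI[OF Suc.prems assms(2) that] by (simp add: has_field_derivative_def)
    have "Ck_on k (\<lambda>x. frechet_derivative f (at x) v) S" for v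
    proof -
      have "Ck_on k (\<lambda>x. deriv f x * v) S"
        by (rule Suc.IH) (intro holomorphic_intros holomorphic_deriv Suc.prems assms)
      moreover have "frechet_derivative f (at x) v = deriv f x * v" if "x \<in> S" for x
        using frechet_derivative_eqI[OF der[OF that]] .
      ultimately show ?thesis using Ck_on_cong[OF assms(2)] by (metis (no_types, lifting))
    qed
    then show ?case using der by (auto intro: differentiableI)
  qed
  then show ?thesis by (simp add: smooth_on_def)
qed

lemmas smooth_intros = smooth_on_const smooth_on_add smooth_on_mult smooth_on_uminus smooth_on_diff
  smooth_on_divide smooth_on_inverse smooth_on_power smooth_on_cnj smooth_on_of_real smooth_on_Re

section \<open>Symmetry of second derivatives\<close>

text \<open>
  The mean value inequality for \<open>\<tau> \<mapsto> f (x + \<tau> u + s v) - f (x + \<tau> u) - \<tau> s A v\<close> on \<open>[0, s]\<close>: by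
  differentiability of the directional derivative at \<open>x\<close>, the derivative of this function is \<open>o(s)\<close>.
\<close>

lemma second_difference_tendsto:
  fixes f :: "'a::real_normed_vector \<Rightarrow> 'b::real_normed_vector"
  assumes S: "open S" "x \<in> S"
    and f: "\<And>y. y \<in> S \<Longrightarrow> f differentiable (at y)"
    and A: "((\<lambda>y. frechet_derivative f (at y) u) has_derivative A) (at x)"
  shows "((\<lambda>s. (f (x + s *\<^sub>R u + s *\<^sub>R v) - f (x + s *\<^sub>R u) - f (x + s *\<^sub>R v) + f x) /\<^sub>R s\<^sup>2)
            \<longlongrightarrow> A v) (at_right 0)"
proof (rule tendstoI)
  fix e :: real assume e: "e > 0"
  define M where "M = 2 * norm u + norm v + 1"
  have M: "M > 0" unfolding M_def by (smt (verit) norm_ge_zero)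
  define e' where "e' = e / (2 * M)"
  have e': "e' > 0" using e M by (simp add: e'_def)
  let ?g = "\<lambda>y. frechet_derivative f (at y) u"
  interpret A: bounded_linear A using A by (rule has_derivative_bounded_linear)
  obtain d1 where d1: "d1 > 0" "\<And>y. norm (y - x) < d1 \<Longrightarrow> norm (?g y - ?g x - A (y - x)) \<le> e' * norm (y - x)"
    using A e' unfolding has_derivative_at_alt by metis
  obtain d2 where d2: "d2 > 0" "ball x d2 \<subseteq> S" using S open_contains_ball by blast
  define d where "d = min d1 d2 / M"
  have d: "d > 0" using d1 d2 M by (simp add: d_def)
  have main: "norm (f (x + s *\<^sub>R u + s *\<^sub>R v) - f (x + s *\<^sub>R u) - f (x + s *\<^sub>R v) + f x - s\<^sup>2 *\<^sub>R A v) \<le> e' * M * s\<^sup>2"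
    if s: "0 < s" "s < d" for s
  proof -
    have sM: "s * M < min d1 d2" using s M by (simp add: d_def field_simps)
    have n1: "norm (\<tau> *\<^sub>R u + s *\<^sub>R v) \<le> s * norm u + s * norm v" "norm (\<tau> *\<^sub>R u) \<le> s * norm u" if "\<tau> \<in> {0..s}" for \<tau>
    proof -
      show 1: "norm (\<tau> *\<^sub>R u) \<le> s * norm u" using that by (auto intro: mult_right_mono)
      show "norm (\<tau> *\<^sub>R u + s *\<^sub>R v) \<le> s * norm u + s * norm v"
        using norm_triangle_ineq[of "\<tau> *\<^sub>R u" "s *\<^sub>R v"] 1 s by simp
    qed
    have n2: "norm (\<tau> *\<^sub>R u + s *\<^sub>R v) < min d1 d2" "norm (\<tau> *\<^sub>R u) < min d1 d2" if "\<tau> \<in> {0..s}" for \<tau>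
    proof -
      have "s * norm u + s * norm v \<le> s * M" "s * norm u \<le> s * M"
        using s by (auto simp: M_def algebra_simps intro!: add_nonneg_nonneg)
      then show "norm (\<tau> *\<^sub>R u + s *\<^sub>R v) < min d1 d2" "norm (\<tau> *\<^sub>R u) < min d1 d2"
        using n1[OF that] sM by linarith+
    qed
    define \<phi> where "\<phi> \<tau> = f (x + \<tau> *\<^sub>R u + s *\<^sub>R v) - f (x + \<tau> *\<^sub>R u) - (\<tau> * s) *\<^sub>R A v" for \<tau>
    have der: "(\<phi> has_derivative (\<lambda>h. h *\<^sub>R (?g (x + \<tau> *\<^sub>R u + s *\<^sub>R v) - ?g (x + \<tau> *\<^sub>R u) - s *\<^sub>R A v))) (at \<tau> within {0..s})"
      if \<tau>: "\<tau> \<in> {0..s}" for \<tau>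
    proof -
      have inS: "x + \<tau> *\<^sub>R u + s *\<^sub>R v \<in> S" "x + \<tau> *\<^sub>R u \<in> S"
        using n2[OF \<tau>] d2(2) by (auto simp: subset_iff dist_norm norm_minus_commute algebra_simps)
      have L: "frechet_derivative f (at y) (h *\<^sub>R u) = h *\<^sub>R ?g y" if "y \<in> S" for y h
        using linear_frechet_derivative[OF f[OF that]] by (simp add: linear_scale)
      have a: "((\<lambda>\<tau>. x + \<tau> *\<^sub>R u + s *\<^sub>R v) has_derivative (\<lambda>h. h *\<^sub>R u)) (at \<tau> within {0..s})"
        "((\<lambda>\<tau>. x + \<tau> *\<^sub>R u) has_derivative (\<lambda>h. h *\<^sub>R u)) (at \<tau> within {0..s})"
        by (auto intro!: derivative_eq_intros)
      show ?thesis unfolding \<phi>_def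
        by (rule derivative_eq_intros
            has_derivative_compose[OF a(1) has_frechet_derivative[OF f[OF inS(1)]]]
            has_derivative_compose[OF a(2) has_frechet_derivative[OF f[OF inS(2)]]] refl)+
          (simp add: L[OF inS(1)] L[OF inS(2)] fun_eq_iff, simp add: algebra_simps)
    qed
    have bd: "onorm (\<lambda>h. h *\<^sub>R (?g (x + \<tau> *\<^sub>R u + s *\<^sub>R v) - ?g (x + \<tau> *\<^sub>R u) - s *\<^sub>R A v)) \<le> e' * (s * M)"
      if \<tau>: "\<tau> \<in> {0..s}" for \<tau>
    proof (rule onorm_le)
      fix h :: real
      have "?g (x + \<tau> *\<^sub>R u + s *\<^sub>R v) - ?g (x + \<tau> *\<^sub>R u) - s *\<^sub>R A v =
          (?g (x + \<tau> *\<^sub>R u + s *\<^sub>R v) - ?g x - A (\<tau> *\<^sub>R u + s *\<^sub>R v)) - (?g (x + \<tau> *\<^sub>R u) - ?g x - A (\<tau> *\<^sub>R u))"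
        by (simp add: A.add A.scaleR)
      also have "norm \<dots> \<le> e' * norm (\<tau> *\<^sub>R u + s *\<^sub>R v) + e' * norm (\<tau> *\<^sub>R u)"
      proof (rule order.trans[OF norm_triangle_ineq4], rule add_mono)
        show "norm (?g (x + \<tau> *\<^sub>R u + s *\<^sub>R v) - ?g x - A (\<tau> *\<^sub>R u + s *\<^sub>R v)) \<le> e' * norm (\<tau> *\<^sub>R u + s *\<^sub>R v)"
          using d1(2)[of "x + \<tau> *\<^sub>R u + s *\<^sub>R v"] n2(1)[OF \<tau>] by (simp add: add.assoc)
        show "norm (?g (x + \<tau> *\<^sub>R u) - ?g x - A (\<tau> *\<^sub>R u)) \<le> e' * norm (\<tau> *\<^sub>R u)"
          using d1(2)[of "x + \<tau> *\<^sub>R u"] n2(2)[OF \<tau>] by simp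
      qed
      also have "\<dots> \<le> e' * (s * norm u + s * norm v) + e' * (s * norm u)"
        using n1[OF \<tau>] e' by (intro add_mono mult_left_mono) auto
      also have "\<dots> \<le> e' * (s * M)" using e' s by (simp add: M_def algebra_simps)
      finally have "norm (?g (x + \<tau> *\<^sub>R u + s *\<^sub>R v) - ?g (x + \<tau> *\<^sub>R u) - s *\<^sub>R A v) \<le> e' * (s * M)" .
      then show "norm (h *\<^sub>R (?g (x + \<tau> *\<^sub>R u + s *\<^sub>R v) - ?g (x + \<tau> *\<^sub>R u) - s *\<^sub>R A v)) \<le> e' * (s * M) * norm h"
        by (simp add: mult.commute mult_left_mono)
    qed
    have "norm (\<phi> s - \<phi> 0) \<le> e' * (s * M) * norm (s - 0)"
      by (rule differentiable_bound[OF _ der bd]) (use s in auto)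
    then show ?thesis using s by (simp add: \<phi>_def algebra_simps power2_eq_square)
  qed
  have "dist ((f (x + s *\<^sub>R u + s *\<^sub>R v) - f (x + s *\<^sub>R u) - f (x + s *\<^sub>R v) + f x) /\<^sub>R s\<^sup>2) (A v) < e"
    if s: "0 < s" "s < d" for s
  proof -
    have "(f (x + s *\<^sub>R u + s *\<^sub>R v) - f (x + s *\<^sub>R u) - f (x + s *\<^sub>R v) + f x) /\<^sub>R s\<^sup>2 - A v
      = (f (x + s *\<^sub>R u + s *\<^sub>R v) - f (x + s *\<^sub>R u) - f (x + s *\<^sub>R v) + f x - s\<^sup>2 *\<^sub>R A v) /\<^sub>R s\<^sup>2"
      using s by (simp add: scaleR_diff_right)
    then have "dist ((f (x + s *\<^sub>R u + s *\<^sub>R v) - f (x + s *\<^sub>R u) - f (x + s *\<^sub>R v) + f x) /\<^sub>R s\<^sup>2) (A v)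
        = norm (f (x + s *\<^sub>R u + s *\<^sub>R v) - f (x + s *\<^sub>R u) - f (x + s *\<^sub>R v) + f x - s\<^sup>2 *\<^sub>R A v) / s\<^sup>2"
      by (simp add: dist_norm divide_inverse mult.commute)
    also have "\<dots> \<le> e' * M" using main[OF s] s by (simp add: divide_le_eq)
    also have "\<dots> < e" using e M by (simp add: e'_def)
    finally show ?thesis .
  qed
  then show "\<forall>\<^sub>F s in at_right 0. dist ((f (x + s *\<^sub>R u + s *\<^sub>R v) - f (x + s *\<^sub>R u) - f (x + s *\<^sub>R v) + f x) /\<^sub>R s\<^sup>2) (A v) < e"
    using d by (auto simp: eventually_at_right_field intro!: exI[of _ d])
qed

text \<open>
  The second difference is symmetric in the two directions.
\<close>

lemma frechet_derivative_commute:
  fixes f :: "'a::real_normed_vector \<Rightarrow> 'b::real_normed_vector"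
  assumes S: "open S" "x \<in> S"
    and f: "\<And>y. y \<in> S \<Longrightarrow> f differentiable (at y)"
    and u: "(\<lambda>y. frechet_derivative f (at y) u) differentiable (at x)"
    and v: "(\<lambda>y. frechet_derivative f (at y) v) differentiable (at x)"
  shows "frechet_derivative (\<lambda>y. frechet_derivative f (at y) u) (at x) v
       = frechet_derivative (\<lambda>y. frechet_derivative f (at y) v) (at x) u"
proof (rule tendsto_unique[OF _ second_difference_tendsto[OF S f has_frechet_derivative[OF u]]])
  have "((\<lambda>s. (f (x + s *\<^sub>R v + s *\<^sub>R u) - f (x + s *\<^sub>R v) - f (x + s *\<^sub>R u) + f x) /\<^sub>R s\<^sup>2)
            \<longlongrightarrow> frechet_derivative (\<lambda>y. frechet_derivative f (at y) v) (at x) u) (at_right 0)"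
    by (rule second_difference_tendsto[OF S f has_frechet_derivative[OF v]])
  then show "((\<lambda>s. (f (x + s *\<^sub>R u + s *\<^sub>R v) - f (x + s *\<^sub>R u) - f (x + s *\<^sub>R v) + f x) /\<^sub>R s\<^sup>2)
            \<longlongrightarrow> frechet_derivative (\<lambda>y. frechet_derivative f (at y) v) (at x) u) (at_right 0)"
    by (simp add: algebra_simps)
qed auto

section \<open>Wirtinger calculus\<close>

lemma real_linear_complex:
  fixes L :: "complex \<Rightarrow> complex"
  assumes "linear L"
  shows "L h = (L 1 - \<i> * L \<i>) / 2 * h + (L 1 + \<i> * L \<i>) / 2 * cnj h"
proof -
  have h: "h = Re h *\<^sub>R 1 + Im h *\<^sub>R \<i>" by (simp add: complex_eq_iff)
  have "L h = Re h *\<^sub>R L 1 + Im h *\<^sub>R L \<i>"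
    using linear_add[OF assms, of "Re h *\<^sub>R 1" "Im h *\<^sub>R \<i>"] linear_scale[OF assms] h by metis
  then have "L h = of_real (Re h) * L 1 + of_real (Im h) * L \<i>"
    by (simp add: scaleR_conv_of_real)
  also have "\<dots> = (L 1 - \<i> * L \<i>) / 2 * h + (L 1 + \<i> * L \<i>) / 2 * cnj h"
    by (simp add: complex_eq_iff field_simps)
  finally show ?thesis .
qed

lemma vec_eq_sum_axis: "(h :: complex^'n) = (\<Sum>j\<in>UNIV. axis j (h $ j))"
  by (simp add: vec_eq_iff axis_def)

lemma linear_axis: "linear (axis j :: complex \<Rightarrow> complex^'n)"
  by (rule linearI) (auto simp: axis_def vec_eq_iff)

lemma bounded_linear_axis: "bounded_linear (axis j :: complex \<Rightarrow> complex^'n)"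
  using linear_axis linear_conv_bounded_linear by blast

lemma has_derivative_wirtinger:
  fixes f :: "complex^'n \<Rightarrow> complex"
  assumes "f differentiable (at p)"
  shows "(f has_derivative (\<lambda>h. \<Sum>j\<in>UNIV. pd j f p * h $ j + pdbar j f p * cnj (h $ j))) (at p)"
proof -
  let ?D = "frechet_derivative f (at p)"
  have D: "(f has_derivative ?D) (at p)" using has_frechet_derivative[OF assms] .
  then have lin: "linear ?D" by (rule has_derivative_linear)
  have "?D h = (\<Sum>j\<in>UNIV. pd j f p * h $ j + pdbar j f p * cnj (h $ j))" for h
  proof -
    have "?D h = (\<Sum>j\<in>UNIV. ?D (axis j (h $ j)))"
      by (subst vec_eq_sum_axis[of h]) (rule linear_sum[OF lin])
    also have "\<dots> = (\<Sum>j\<in>UNIV. pd j f p * h $ j + pdbar j f p * cnj (h $ j))"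
      unfolding pd_def pdbar_def
      by (intro sum.cong refl real_linear_complex[OF linear_compose[OF linear_axis lin], unfolded o_def])
    finally show ?thesis .
  qed
  with D show ?thesis by (metis (no_types, lifting) ext)
qed

lemma pd_eqI:
  "(f has_derivative D) (at p) \<Longrightarrow> pd j f p = (D (axis j 1) - \<i> * D (axis j \<i>)) / 2"
  by (simp add: pd_def frechet_derivative_eqI)

lemma pdbar_eqI:
  "(f has_derivative D) (at p) \<Longrightarrow> pdbar j f p = (D (axis j 1) + \<i> * D (axis j \<i>)) / 2"
  by (simp add: pdbar_def frechet_derivative_eqI)

lemma pd_cong: "open S \<Longrightarrow> p \<in> S \<Longrightarrow> (\<And>q. q \<in> S \<Longrightarrow> f q = g q) \<Longrightarrow> pd j f p = pd j g p"
  and pdbar_cong: "open S \<Longrightarrow> p \<in> S \<Longrightarrow> (\<And>q. q \<in> S \<Longrightarrow> f q = g q) \<Longrightarrow> pdbar j f p = pdbar j g p"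
  unfolding pd_def pdbar_def using frechet_derivative_cong_open[of S p f g] by auto

lemma pd_const [simp]: "pd j (\<lambda>p. c) p = 0" and pdbar_const [simp]: "pdbar j (\<lambda>p. c) p = 0"
  by (auto simp: pd_def pdbar_def frechet_derivative_const)

context
  fixes f g :: "complex^'n \<Rightarrow> complex" and p
  assumes f: "f differentiable (at p)" and g: "g differentiable (at p)"
begin

lemmas f_der = has_frechet_derivative[OF f] and g_der = has_frechet_derivative[OF g]

lemma pd_add: "pd j (\<lambda>p. f p + g p) p = pd j f p + pd j g p"
  and pdbar_add: "pdbar j (\<lambda>p. f p + g p) p = pdbar j f p + pdbar j g p"
  unfolding pd_eqI[OF has_derivative_add[OF f_der g_der]] pdbar_eqI[OF has_derivative_add[OF f_der g_der]]
  by (simp_all add: pd_def pdbar_def field_simps)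

lemma pd_diff: "pd j (\<lambda>p. f p - g p) p = pd j f p - pd j g p"
  and pdbar_diff: "pdbar j (\<lambda>p. f p - g p) p = pdbar j f p - pdbar j g p"
  unfolding pd_eqI[OF has_derivative_diff[OF f_der g_der]] pdbar_eqI[OF has_derivative_diff[OF f_der g_der]]
  by (simp_all add: pd_def pdbar_def field_simps)

lemma pd_mult: "pd j (\<lambda>p. f p * g p) p = f p * pd j g p + pd j f p * g p"
  and pdbar_mult: "pdbar j (\<lambda>p. f p * g p) p = f p * pdbar j g p + pdbar j f p * g p"
  unfolding pd_eqI[OF has_derivative_mult[OF f_der g_der]] pdbar_eqI[OF has_derivative_mult[OF f_der g_der]]
  by (simp_all add: pd_def pdbar_def field_simps)

lemma pd_divide: "g p \<noteq> 0 \<Longrightarrow> pd j (\<lambda>p. f p / g p) p = (pd j f p * g p - f p * pd j g p) / (g p)\<^sup>2"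
  and pdbar_divide: "g p \<noteq> 0 \<Longrightarrow> pdbar j (\<lambda>p. f p / g p) p = (pdbar j f p * g p - f p * pdbar j g p) / (g p)\<^sup>2"
  unfolding pd_eqI[OF has_derivative_divide'[OF f_der g_der]] pdbar_eqI[OF has_derivative_divide'[OF f_der g_der]]
  by (simp_all add: pd_def pdbar_def field_simps power2_eq_square)

end

context
  fixes f :: "complex^'n \<Rightarrow> complex" and p
  assumes f: "f differentiable (at p)"
begin

lemmas f_der' = has_frechet_derivative[OF f]

lemma pd_cnj: "pd j (\<lambda>p. cnj (f p)) p = cnj (pdbar j f p)"
  and pdbar_cnj: "pdbar j (\<lambda>p. cnj (f p)) p = cnj (pd j f p)"
  unfolding pd_eqI[OF has_derivative_cnj[OF f_der']] pdbar_eqI[OF has_derivative_cnj[OF f_der']]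
  by (simp_all add: pd_def pdbar_def)

lemma pd_uminus: "pd j (\<lambda>p. - f p) p = - pd j f p"
  and pdbar_uminus: "pdbar j (\<lambda>p. - f p) p = - pdbar j f p"
  unfolding pd_eqI[OF has_derivative_minus[OF f_der']] pdbar_eqI[OF has_derivative_minus[OF f_der']]
  by (simp_all add: pd_def pdbar_def field_simps)

lemma pd_power2: "pd j (\<lambda>p. (f p)\<^sup>2) p = 2 * f p * pd j f p"
  and pdbar_power2: "pdbar j (\<lambda>p. (f p)\<^sup>2) p = 2 * f p * pdbar j f p"
  unfolding power2_eq_square
    pd_eqI[OF has_derivative_mult[OF f_der' f_der']] pdbar_eqI[OF has_derivative_mult[OF f_der' f_der']]
  by (simp_all add: pd_def pdbar_def field_simps)

end

lemma smooth_on_pd: "open S \<Longrightarrow> smooth_on f S \<Longrightarrow> smooth_on (pd j f) S"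
  and smooth_on_pdbar: "open S \<Longrightarrow> smooth_on f S \<Longrightarrow> smooth_on (pdbar j f) S"
  unfolding pd_def[abs_def] pdbar_def[abs_def]
  by (intro smooth_intros smooth_on_frechet; simp)+

lemma wirtinger_commute:
  fixes f :: "complex^'n \<Rightarrow> complex"
  assumes S: "open S" "p \<in> S" and f: "smooth_on f S"
  shows "pd i (pd j f) p = pd j (pd i f) p"
    and "pdbar i (pd j f) p = pd j (pdbar i f) p"
    and "pdbar i (pdbar j f) p = pdbar j (pdbar i f) p"
proof -
  let ?D = "\<lambda>v q. frechet_derivative f (at q) v"
  have d: "?D v differentiable (at p)" for v
    using smooth_on_differentiable[OF smooth_on_frechet[OF f] S(2)] .
  have com: "frechet_derivative (?D u) (at p) v = frechet_derivative (?D v) (at p) u" for u v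
    by (rule frechet_derivative_commute[OF S]) (use d smooth_on_differentiable[OF f] in auto)
  note com4 = com[of "axis j 1" "axis i 1"] com[of "axis j 1" "axis i \<i>"]
    com[of "axis j \<i>" "axis i 1"] com[of "axis j \<i>" "axis i \<i>"]
  have m: "frechet_derivative (\<lambda>q. (?D a q + c * ?D b q) / 2) (at p) v =
      (frechet_derivative (?D a) (at p) v + c * frechet_derivative (?D b) (at p) v) / 2" for a b c v
    by (rule frechet_derivative_eqI) (auto intro!: derivative_eq_intros has_frechet_derivative d)
  have m': "frechet_derivative (\<lambda>q. (?D a q - c * ?D b q) / 2) (at p) v =
      (frechet_derivative (?D a) (at p) v - c * frechet_derivative (?D b) (at p) v) / 2" for a b c v
    by (rule frechet_derivative_eqI) (auto intro!: derivative_eq_intros has_frechet_derivative d)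
  have pd1: "pd j f = (\<lambda>q. (?D (axis j 1) q - \<i> * ?D (axis j \<i>) q) / 2)" for j
    by (simp add: pd_def fun_eq_iff)
  have pd2: "pdbar j f = (\<lambda>q. (?D (axis j 1) q + \<i> * ?D (axis j \<i>) q) / 2)" for j
    by (simp add: pdbar_def fun_eq_iff)
  show "pd i (pd j f) p = pd j (pd i f) p"
    unfolding pd1 unfolding pd_def m' unfolding com4 by (simp add: algebra_simps diff_divide_distrib add_divide_distrib)
  show "pdbar i (pd j f) p = pd j (pdbar i f) p"
    unfolding pd1 pd2 unfolding pd_def pdbar_def m' m unfolding com4 by (simp add: algebra_simps diff_divide_distrib add_divide_distrib)
  show "pdbar i (pdbar j f) p = pdbar j (pdbar i f) p"
    unfolding pd2 unfolding pdbar_def m unfolding com4 by (simp add: algebra_simps diff_divide_distrib add_divide_distrib)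
qed

lemma holomorphic_vec_onI:
  assumes "\<And>p. p \<in> S \<Longrightarrow> f differentiable (at p)" "\<And>p j. p \<in> S \<Longrightarrow> pdbar j f p = 0"
  shows "holomorphic_vec_on f S"
  unfolding holomorphic_vec_on_def
proof
  fix p assume p: "p \<in> S"
  have "(f has_derivative (\<lambda>h. \<Sum>j\<in>UNIV. pd j f p * h $ j)) (at p)"
    using has_derivative_wirtinger[OF assms(1)[OF p]] assms(2)[OF p] by simp
  then show "\<exists>c. (f has_derivative (\<lambda>h. \<Sum>j\<in>UNIV. c j * h $ j)) (at p)"
    by (rule exI[of _ "\<lambda>j. pd j f p"])
qed

text \<open>The counterpart of \<^const>\<open>wbar\<close>, the derivative with respect to \<open>z\<close>.\<close>

definition wz :: "(complex \<Rightarrow> complex) \<Rightarrow> complex \<Rightarrow> complex" where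
  "wz f z = (frechet_derivative f (at z) 1 - \<i> * frechet_derivative f (at z) \<i>) / 2"

lemma has_derivative_wz_wbar:
  assumes "f differentiable (at z)"
  shows "(f has_derivative (\<lambda>h. wz f z * h + wbar f z * cnj h)) (at z)"
proof -
  have D: "(f has_derivative frechet_derivative f (at z)) (at z)"
    using has_frechet_derivative[OF assms] .
  have "frechet_derivative f (at z) = (\<lambda>h. wz f z * h + wbar f z * cnj h)"
    unfolding wz_def wbar_def by (rule ext) (rule real_linear_complex[OF has_derivative_linear[OF D]])
  with D show ?thesis by simp
qed

lemma wz_eqI: "(f has_derivative (\<lambda>h. a * h + b * cnj h)) (at z) \<Longrightarrow> wz f z = a"
  and wbar_eqI: "(f has_derivative (\<lambda>h. a * h + b * cnj h)) (at z) \<Longrightarrow> wbar f z = b"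
  by (auto simp: wz_def wbar_def frechet_derivative_eqI algebra_simps)

lemma holomorphic_onI_wbar:
  assumes "open S" "\<And>z. z \<in> S \<Longrightarrow> f differentiable (at z)" "\<And>z. z \<in> S \<Longrightarrow> wbar f z = 0"
  shows "f holomorphic_on S"
proof (rule holomorphic_onI)
  fix z assume "z \<in> S"
  then have "(f has_field_derivative wz f z) (at z)"
    using has_derivative_wz_wbar[of f z] assms by (simp add: has_field_derivative_def)
  then show "f field_differentiable at z within S"
    using field_differentiable_at_within field_differentiable_def by blast
qed

lemma has_derivative_coordinate:
  fixes p :: "complex^'n"
  assumes "(g has_derivative (\<lambda>h. a * h + b * cnj h)) (at (p $ j))"
  shows "((\<lambda>p. g (p $ j)) has_derivative (\<lambda>h. a * h $ j + b * cnj (h $ j))) (at p)"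
  using has_derivative_compose[OF bounded_linear_imp_has_derivative[OF bounded_linear_vec_nth] assms] .

lemma pd_coordinate:
  fixes p :: "complex^'n"
  assumes "g differentiable (at (p $ j))"
  shows "pd i (\<lambda>p. g (p $ j)) p = (if i = j then wz g (p $ j) else 0)"
    and "pdbar i (\<lambda>p. g (p $ j)) p = (if i = j then wbar g (p $ j) else 0)"
  using pd_eqI[OF has_derivative_coordinate[OF has_derivative_wz_wbar[OF assms]], of i]
   pdbar_eqI[OF has_derivative_coordinate[OF has_derivative_wz_wbar[OF assms]], of i]
  by (cases "i = j"; simp add: axis_def algebra_simps)+

lemma pd_coordinate_holomorphic:
  fixes p :: "complex^'n"
  assumes "(g has_field_derivative g') (at (p $ j))"
  shows "pd i (\<lambda>p. g (p $ j)) p = (if i = j then g' else 0)"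
    and "pdbar i (\<lambda>p. g (p $ j)) p = 0"
    and "(\<lambda>p. g (p $ j)) differentiable (at p)"
proof -
  have g: "(g has_derivative (\<lambda>h. g' * h + 0 * cnj h)) (at (p $ j))"
    using assms unfolding has_field_derivative_def by simp
  note w = wz_eqI[OF g] wbar_eqI[OF g]
  have d: "g differentiable (at (p $ j))" using g by (rule differentiableI)
  show "pd i (\<lambda>p. g (p $ j)) p = (if i = j then g' else 0)"
    and "pdbar i (\<lambda>p. g (p $ j)) p = 0"
    unfolding pd_coordinate[OF d] w by simp_all
  show "(\<lambda>p. g (p $ j)) differentiable (at p)"
    using has_derivative_coordinate[OF g] by (rule differentiableI)
qed

lemma pd_nth: "pd i (\<lambda>p. p $ j) p = (if i = j then 1 else 0)" "pdbar i (\<lambda>p. p $ j) p = 0"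
  using pd_coordinate_holomorphic(1)[OF DERIV_ident, of i j p]
    pd_coordinate_holomorphic(2)[OF DERIV_ident, of i j p] .

section \<open>Bidiscs\<close>

definition bidisc :: "real \<Rightarrow> (complex^2) set" where
  "bidisc e = {p. cmod (p $ 1) < e \<and> cmod (p $ 2) < e}"

lemma open_bidisc: "open (bidisc e)"
  unfolding bidisc_def by (intro open_Collect_conj open_Collect_less continuous_intros)

lemma convex_bidisc: "convex (bidisc e)"
proof -
  have "bidisc e = (\<lambda>p. p $ 1) -` ball 0 e \<inter> (\<lambda>p. p $ 2) -` ball 0 e"
    by (auto simp: bidisc_def)
  then show ?thesis
    by (auto intro!: convex_Int convex_linear_vimage bounded_linear.linear bounded_linear_vec_nth)
qed

lemma zero_in_bidisc: "e > 0 \<Longrightarrow> 0 \<in> bidisc e"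
  by (simp add: bidisc_def)

lemma bidisc_mono: "d \<le> e \<Longrightarrow> bidisc d \<subseteq> bidisc e"
  by (auto simp: bidisc_def)

lemma eventually_nhds_0_bidisc:
  "(\<forall>\<^sub>F p in nhds 0. P p) \<longleftrightarrow> (\<exists>e>0. \<forall>p\<in>bidisc e. P p)"
proof
  assume "\<forall>\<^sub>F p in nhds 0. P p"
  then obtain d where d: "d > 0" "\<And>p. dist p 0 < d \<Longrightarrow> P p" unfolding eventually_nhds_metric by blast
  have "P p" if "p \<in> bidisc (d / 2)" for p
  proof -
    have "norm p \<le> cmod (p $ 1) + cmod (p $ 2)"
      unfolding norm_vec_def using L2_set_le_sum[of UNIV "\<lambda>i. norm (p $ i)"] by (simp add: sum_2)
    then show ?thesis using that d(2)[of p] by (simp add: bidisc_def)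
  qed
  then show "\<exists>e>0. \<forall>p\<in>bidisc e. P p" using d(1) by (intro exI[of _ "d / 2"]) auto
next
  assume "\<exists>e>0. \<forall>p\<in>bidisc e. P p"
  then show "\<forall>\<^sub>F p in nhds 0. P p"
    using open_bidisc zero_in_bidisc unfolding eventually_nhds by blast
qed

lemma axis_split: "(p :: complex^2) = axis 1 (p $ 1) + axis 2 (p $ 2)"
  by (simp add: vec_eq_iff forall_2 axis_def)

lemma axis_nth_2 [simp]: "(axis 2 z :: complex^2) $ 1 = 0" "(axis 2 z :: complex^2) $ 2 = z"
  by (simp_all add: axis_def)

lemma axis_in_bidisc: "cmod z < e \<Longrightarrow> axis 2 z \<in> bidisc e"
  using norm_ge_zero[of z] by (auto simp: bidisc_def simp del: norm_ge_zero)

lemma nth_in_ball: "p \<in> bidisc e \<Longrightarrow> p $ j \<in> ball 0 e"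
  using exhaust_2[of j] by (auto simp: bidisc_def)

lemma smooth_on_coordinate:
  "smooth_on g (ball 0 e) \<Longrightarrow> smooth_on (\<lambda>p. g (p $ j)) (bidisc e)"
  by (rule smooth_on_compose_linear[OF _ bounded_linear_vec_nth open_bidisc]) (auto intro: nth_in_ball)

lemma smooth_on_nth: "smooth_on (\<lambda>p :: complex^'n. p $ j) S"
  by (rule smooth_on_linear) (rule bounded_linear_vec_nth)

text \<open>
  This turns a condition on derivatives into a reduction to the slice \<open>z\<^sub>1 = 0\<close>, where the theory of
  one complex variable applies.
\<close>

lemma constant_along_first:
  fixes \<phi> :: "complex^2 \<Rightarrow> complex"
  assumes d: "\<And>p. p \<in> bidisc e \<Longrightarrow> \<phi> differentiable (at p)"
    and z: "\<And>p. p \<in> bidisc e \<Longrightarrow> pd 1 \<phi> p = 0" "\<And>p. p \<in> bidisc e \<Longrightarrow> pdbar 1 \<phi> p = 0"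
    and p: "p \<in> bidisc e"
  shows "\<phi> p = \<phi> (axis 2 (p $ 2))"
proof -
  define g where "g z = \<phi> (axis 1 z + axis 2 (p $ 2))" for z
  have "(g has_derivative (\<lambda>h. 0)) (at z within ball 0 e)" if "z \<in> ball 0 e" for z
  proof -
    let ?q = "axis 1 z + axis 2 (p $ 2) :: complex^2"
    have q: "?q \<in> bidisc e" using that p by (auto simp: bidisc_def axis_def)
    have l: "((\<lambda>z. axis 1 z + axis 2 (p $ 2) :: complex^2) has_derivative (\<lambda>h. axis 1 h)) (at z)"
      by (auto intro!: derivative_eq_intros bounded_linear_imp_has_derivative bounded_linear_axis)
    have "(\<phi> has_derivative (\<lambda>h. pd 2 \<phi> ?q * h $ 2 + pdbar 2 \<phi> ?q * cnj (h $ 2))) (at ?q)"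
      using has_derivative_wirtinger[OF d[OF q]] z[OF q] by (simp add: sum_2)
    from has_derivative_compose[OF l this] have "(g has_derivative (\<lambda>h. 0)) (at z)"
      by (simp add: g_def[abs_def] axis_def)
    then show ?thesis by (rule has_derivative_at_withinI)
  qed
  then obtain c where c: "\<And>z. z \<in> ball 0 e \<Longrightarrow> g z = c"
    using has_derivative_zero_constant[OF convex_ball, of 0 e g] by blast
  have "e > 0" using p norm_ge_zero[of "p $ 1"] unfolding bidisc_def by (auto simp del: norm_ge_zero)
  then have "g (p $ 1) = g 0" using c[of "p $ 1"] c[of 0] nth_in_ball[OF p, of 1] by auto
  moreover have "axis 1 0 + axis 2 (p $ 2) = (axis 2 (p $ 2) :: complex^2)" by (simp add: vec_eq_iff axis_def)
  ultimately show ?thesis unfolding g_def by (simp only: axis_split[symmetric])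
qed

lemma has_derivative_slice:
  fixes \<phi> :: "complex^2 \<Rightarrow> complex"
  assumes "\<phi> differentiable (at (axis 2 z))"
  shows "((\<lambda>z. \<phi> (axis 2 z)) has_derivative
           (\<lambda>h. pd 2 \<phi> (axis 2 z) * h + pdbar 2 \<phi> (axis 2 z) * cnj h)) (at z)"
  using has_derivative_compose[OF bounded_linear_imp_has_derivative[OF bounded_linear_axis]
      has_derivative_wirtinger[OF assms]]
  by (simp add: sum_2)

section \<open>Pluriharmonic functions\<close>

text \<open>
  The function \<open>f\<close> is the integral of \<open>2 \<partial>H\<close> along the segment from \<open>0\<close>. The coefficients of \<open>\<partial>H\<close> are
  holomorphic, and so is the integrand in the endpoint; therefore \<open>f\<close> is holomorphic by
  differentiation under the integral sign. Its real part is \<open>H\<close> by the fundamental theorem of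
  calculus, because \<open>dH\<close> is the real part of \<open>2 \<partial>H\<close>.
\<close>

lemma pluriharmonic_imp_Re_holomorphic:
  fixes H :: "complex^'n \<Rightarrow> real"
  assumes S: "open S" "convex S" "0 \<in> S" and H: "smooth_on H S"
    and ph: "\<And>p j k. p \<in> S \<Longrightarrow> pdbar k (pd j (\<lambda>p. complex_of_real (H p))) p = 0"
  obtains f where "holomorphic_vec_on f S" "f 0 = of_real (H 0)" "\<And>p. p \<in> S \<Longrightarrow> Re (f p) = H p"
proof -
  define A where "A j = pd j (\<lambda>p. complex_of_real (H p))" for j
  have Hc: "smooth_on (\<lambda>p. complex_of_real (H p)) S" by (intro smooth_intros S H)
  have A: "smooth_on (A j) S" for j unfolding A_def by (intro smooth_on_pd S Hc)
  have Ad: "(A j has_derivative (\<lambda>h. \<Sum>i\<in>UNIV. pd i (A j) p * h $ i)) (at p)" if "p \<in> S" for j p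
    using has_derivative_wirtinger[OF smooth_on_differentiable[OF A that], of j] ph[OF that] by (simp add: A_def)
  have tS: "t *\<^sub>R p \<in> S" if "p \<in> S" "t \<in> {0..1}" for t p
    using S that convexD_alt[of S 0 p t] by auto
  have contA: "continuous_on (S \<times> {0..1}) (\<lambda>(p, t). A j (t *\<^sub>R p))" for j
    unfolding case_prod_beta
    by (rule continuous_on_compose2[OF smooth_on_continuous[OF A]]) (auto intro!: continuous_intros tS)
  have contA': "continuous_on (S \<times> {0..1}) (\<lambda>(p, t). pd i (A j) (t *\<^sub>R p))" for i j
    unfolding case_prod_beta
    by (rule continuous_on_compose2[OF smooth_on_continuous[OF smooth_on_pd[OF S(1) A]]])
      (auto intro!: continuous_intros tS)
  define a where "a p t = 2 * (\<Sum>j\<in>UNIV. A j (t *\<^sub>R p) * p $ j)" for p t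
  define K where "K p t i = 2 * ((\<Sum>j\<in>UNIV. of_real t * pd i (A j) (t *\<^sub>R p) * p $ j) + A i (t *\<^sub>R p))" for p t i
  define P where "P i = Blinfun (\<lambda>h :: complex^'n. h $ i)" for i
  have P: "blinfun_apply (P i) h = h $ i" for i h
    unfolding P_def by (simp add: bounded_linear_Blinfun_apply bounded_linear_vec_nth)
  define a' where "a' p t = (\<Sum>i\<in>UNIV. blinfun_mult_right (K p t i) o\<^sub>L P i)" for p t
  have a'_apply: "blinfun_apply (a' p t) h = (\<Sum>i\<in>UNIV. K p t i * h $ i)" for p t h
    by (simp add: a'_def blinfun.sum_left P)
  have contK: "continuous_on (S \<times> {0..1}) (\<lambda>(p, t). K p t i)" for i
    using contA contA' unfolding K_def case_prod_beta by (intro continuous_intros) auto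
  have conta: "continuous_on (S \<times> {0..1}) (\<lambda>(p, t). a p t)"
    using contA unfolding a_def case_prod_beta by (intro continuous_intros) auto
  have conta': "continuous_on (S \<times> {0..1}) (\<lambda>(p, t). a' p t)"
    using contK unfolding a'_def case_prod_beta by (intro continuous_intros) auto
  have slice: "continuous_on {0..1} (g p)" if "continuous_on (S \<times> {0..1}) (\<lambda>(p, t). g p t)" "p \<in> S"
    for g :: "complex^'n \<Rightarrow> real \<Rightarrow> 'z::topological_space" and p
  proof -
    have "continuous_on {0..1} (\<lambda>t. (p, t))" by (intro continuous_intros)
    moreover have "(\<lambda>t. (p, t)) ` {0..1} \<subseteq> S \<times> {0..1}" using that(2) by auto
    ultimately show ?thesis using continuous_on_compose2[OF that(1), of "{0..1}" "\<lambda>t. (p, t)"] by simp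
  qed
  have der_a: "((\<lambda>p. a p t) has_derivative blinfun_apply (a' p t)) (at p)" if p: "p \<in> S" "t \<in> {0..1}" for p t
  proof -
    have tr: "(t *\<^sub>R h) $ i = of_real t * h $ i" for h :: "complex^'n" and i
      by (metis vector_scaleR_component scaleR_conv_of_real)
    have 1: "((\<lambda>p. A j (t *\<^sub>R p)) has_derivative (\<lambda>h. \<Sum>i\<in>UNIV. pd i (A j) (t *\<^sub>R p) * (t *\<^sub>R h) $ i)) (at p)" for j
      by (rule has_derivative_compose[of "\<lambda>p. t *\<^sub>R p" "\<lambda>h. t *\<^sub>R h" p UNIV "A j", OF _ Ad[OF tS[OF p]]])
        (auto intro!: derivative_eq_intros)
    have "((\<lambda>p. a p t) has_derivative (\<lambda>h. 2 * (\<Sum>j\<in>UNIV. A j (t *\<^sub>R p) * h $ j +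
        (\<Sum>i\<in>UNIV. pd i (A j) (t *\<^sub>R p) * (t *\<^sub>R h) $ i) * p $ j))) (at p)"
      unfolding a_def
      by (intro has_derivative_mult_right has_derivative_sum has_derivative_mult 1
          bounded_linear_imp_has_derivative bounded_linear_vec_nth)
    moreover have "2 * (\<Sum>j\<in>UNIV. A j (t *\<^sub>R p) * h $ j +
        (\<Sum>i\<in>UNIV. pd i (A j) (t *\<^sub>R p) * (t *\<^sub>R h) $ i) * p $ j) = blinfun_apply (a' p t) h" for h
    proof -
      have "(\<Sum>j\<in>UNIV. (\<Sum>i\<in>UNIV. pd i (A j) (t *\<^sub>R p) * (t *\<^sub>R h) $ i) * p $ j)
          = (\<Sum>i\<in>UNIV. (\<Sum>j\<in>UNIV. of_real t * pd i (A j) (t *\<^sub>R p) * p $ j) * h $ i)"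
        unfolding sum_distrib_right
        by (subst sum.swap, intro sum.cong refl) (simp add: tr scaleR_conv_of_real[where 'a = complex] mult_ac)
      moreover have "(\<Sum>i\<in>UNIV. 2 * (s i + A i (t *\<^sub>R p)) * h $ i)
          = 2 * ((\<Sum>i\<in>UNIV. A i (t *\<^sub>R p) * h $ i) + (\<Sum>i\<in>UNIV. s i * h $ i))" for s
        unfolding sum.distrib[symmetric] sum_distrib_left by (intro sum.cong refl) (simp add: algebra_simps)
      ultimately show ?thesis
        unfolding a'_apply K_def sum.distrib by simp
    qed
    ultimately show ?thesis by simp
  qed
  define f where "f p = of_real (H 0) + integral (cbox 0 1) (a p)" for p
  have int_a: "a p integrable_on {0..1}" if "p \<in> S" for p
    by (rule integrable_continuous_interval) (rule slice[OF conta that])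
  have "holomorphic_vec_on f S"
    unfolding holomorphic_vec_on_def
  proof
    fix p assume p: "p \<in> S"
    have "((\<lambda>p. integral (cbox 0 1) (a p)) has_derivative blinfun_apply (integral (cbox 0 1) (a' p))) (at p within S)"
      by (rule leibniz_rule[where fx = a'])
        (use der_a int_a conta' p S in \<open>auto simp: has_derivative_at_withinI\<close>)
    then have "((\<lambda>p. integral (cbox 0 1) (a p)) has_derivative blinfun_apply (integral (cbox 0 1) (a' p))) (at p)"
      using at_within_open[OF p S(1)] by simp
    then have "(f has_derivative blinfun_apply (integral (cbox 0 1) (a' p))) (at p)"
      unfolding f_def by (auto intro!: derivative_eq_intros)
    moreover have "blinfun_apply (integral (cbox 0 1) (a' p)) h = (\<Sum>i\<in>UNIV. integral {0..1} (\<lambda>t. K p t i) * h $ i)" for h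
    proof -
      have K: "(\<lambda>t. K p t i) integrable_on {0..1}" for i
        by (rule integrable_continuous_interval) (rule slice[OF contK p])
      have "blinfun_apply (integral (cbox 0 1) (a' p)) h = integral {0..1} (\<lambda>t. \<Sum>i\<in>UNIV. K p t i * h $ i)"
        by (subst blinfun_apply_integral)
          (auto simp: a'_apply intro: integrable_continuous_interval slice[OF conta' p])
      also have "\<dots> = (\<Sum>i\<in>UNIV. integral {0..1} (\<lambda>t. K p t i * h $ i))"
        by (rule integral_sum) (auto intro: integrable_on_mult_left K)
      also have "\<dots> = (\<Sum>i\<in>UNIV. integral {0..1} (\<lambda>t. K p t i) * h $ i)"
        by simp
      finally show ?thesis .
    qed
    ultimately show "\<exists>c. (f has_derivative (\<lambda>h. \<Sum>j\<in>UNIV. c j * h $ j)) (at p)"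
      by (intro exI[of _ "\<lambda>i. integral {0..1} (\<lambda>t. K p t i)"]) (metis (no_types, lifting) ext)
  qed
  moreover have "a 0 = (\<lambda>t. 0)" by (simp add: a_def fun_eq_iff)
  then have "f 0 = of_real (H 0)" by (simp add: f_def)
  moreover have "Re (f p) = H p" if p: "p \<in> S" for p
  proof -
    have v: "((\<lambda>t. H (t *\<^sub>R p)) has_vector_derivative Re (a p t)) (at t within {0..1})" if t: "t \<in> {0..1}" for t
    proof -
      have "((\<lambda>q. complex_of_real (H q)) has_derivative
          (\<lambda>h. \<Sum>j\<in>UNIV. A j (t *\<^sub>R p) * h $ j + cnj (A j (t *\<^sub>R p)) * cnj (h $ j))) (at (t *\<^sub>R p))"
      proof -
        have Hd: "(\<lambda>p. complex_of_real (H p)) differentiable (at (t *\<^sub>R p))"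
          using smooth_on_differentiable[OF Hc tS[OF p t]] .
        have "pdbar j (\<lambda>p. complex_of_real (H p)) (t *\<^sub>R p) = cnj (A j (t *\<^sub>R p))" for j
          using pdbar_cnj[OF Hd] by (simp add: A_def)
        with has_derivative_wirtinger[OF Hd] show ?thesis by (simp add: A_def)
      qed
      moreover have "((\<lambda>t. t *\<^sub>R p) has_derivative (\<lambda>h. h *\<^sub>R p)) (at t within {0..1})"
        by (auto intro!: derivative_eq_intros)
      ultimately
      have "((\<lambda>t. H (t *\<^sub>R p)) has_derivative (\<lambda>h. Re (\<Sum>j\<in>UNIV. A j (t *\<^sub>R p) * (h *\<^sub>R p) $ j
            + cnj (A j (t *\<^sub>R p)) * cnj ((h *\<^sub>R p) $ j)))) (at t within {0..1})"
        using has_derivative_Re[OF has_derivative_compose[of "\<lambda>t. t *\<^sub>R p" "\<lambda>h. h *\<^sub>R p" t "{0..1}"]]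
        by fastforce
      moreover have "Re (\<Sum>j\<in>UNIV. A j (t *\<^sub>R p) * (h *\<^sub>R p) $ j
            + cnj (A j (t *\<^sub>R p)) * cnj ((h *\<^sub>R p) $ j)) = h *\<^sub>R Re (a p t)" for h
        unfolding a_def by (simp add: sum_distrib_left algebra_simps)
      ultimately show ?thesis unfolding has_vector_derivative_def by simp
    qed
    have "((\<lambda>t. Re (a p t)) has_integral (H (1 *\<^sub>R p) - H (0 *\<^sub>R p))) {0..1}"
      by (rule fundamental_theorem_of_calculus[OF _ v]) auto
    moreover have "((\<lambda>t. Re (a p t)) has_integral Re (integral {0..1} (a p))) {0..1}"
      by (rule has_integral_Re[OF integrable_integral[OF int_a[OF p]]])
    ultimately have "Re (integral {0..1} (a p)) = H (1 *\<^sub>R p) - H (0 *\<^sub>R p)"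
      by (rule has_integral_unique[THEN sym])
    then have "Re (integral {0..1} (a p)) = H p - H 0" by simp
    then show ?thesis by (simp add: f_def)
  qed
  ultimately show ?thesis using that by blast
qed

section \<open>Linear differential equations\<close>

text \<open>
  Gronwall's argument: along a ray the function \<open>t \<mapsto> |f (t x)|\<^sup>2 exp (- 2 K |x| t)\<close> decreases.
\<close>

lemma derivative_bound_imp_zero:
  fixes f :: "'a::real_normed_vector \<Rightarrow> 'b::real_inner"
  assumes d: "\<And>x. x \<in> ball 0 R \<Longrightarrow> (f has_derivative f' x) (at x)"
    and bd: "\<And>x h. x \<in> ball 0 R \<Longrightarrow> norm (f' x h) \<le> K * norm (f x) * norm h"
    and f0: "f 0 = 0" and x: "x \<in> ball 0 R"
  shows "f x = 0"
proof -
  define L where "L = K * norm x"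
  define \<phi> where "\<phi> t = (f (t *\<^sub>R x) \<bullet> f (t *\<^sub>R x)) * exp (- 2 * L * t)" for t :: real
  have "\<phi> 0 \<ge> \<phi> 1"
  proof (rule DERIV_nonpos_imp_nonincreasing[of 0 1 \<phi>])
    fix t :: real assume t: "0 \<le> t" "t \<le> 1"
    have "norm (t *\<^sub>R x) \<le> norm x" using t by (simp add: mult_left_le_one_le)
    then have b: "t *\<^sub>R x \<in> ball 0 R" using x by simp
    let ?g = "f' (t *\<^sub>R x) x"
    have lin: "linear (f' (t *\<^sub>R x))" using d[OF b] by (rule has_derivative_linear)
    have 1: "((\<lambda>t. f (t *\<^sub>R x)) has_derivative (\<lambda>h. f' (t *\<^sub>R x) (h *\<^sub>R x))) (at t)"
      by (rule has_derivative_compose[of "\<lambda>t. t *\<^sub>R x" "\<lambda>h. h *\<^sub>R x" t UNIV f, OF _ d[OF b]])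
        (auto intro!: derivative_eq_intros)
    have "(\<phi> has_derivative (\<lambda>h. h * (exp (- 2 * L * t) * (2 * (f (t *\<^sub>R x) \<bullet> ?g) - 2 * L * (f (t *\<^sub>R x) \<bullet> f (t *\<^sub>R x)))))) (at t)"
      unfolding \<phi>_def
      by (rule derivative_eq_intros 1 refl)+
        (simp add: linear_scale[OF lin] inner_commute algebra_simps)
    then have "DERIV \<phi> t :> exp (- 2 * L * t) * (2 * (f (t *\<^sub>R x) \<bullet> ?g) - 2 * L * (f (t *\<^sub>R x) \<bullet> f (t *\<^sub>R x)))"
      by (simp add: has_field_derivative_def mult_commute_abs)
    moreover have "f (t *\<^sub>R x) \<bullet> ?g \<le> norm (f (t *\<^sub>R x)) * (K * norm (f (t *\<^sub>R x)) * norm x)"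
      using bd[OF b, of x] norm_cauchy_schwarz[of "f (t *\<^sub>R x)" ?g]
      by (meson mult_left_mono norm_ge_zero order.trans)
    then have "2 * (f (t *\<^sub>R x) \<bullet> ?g) - 2 * L * (f (t *\<^sub>R x) \<bullet> f (t *\<^sub>R x)) \<le> 0"
      by (simp add: L_def dot_square_norm power2_eq_square algebra_simps)
    ultimately show "\<exists>y. DERIV \<phi> t :> y \<and> y \<le> 0"
      by (metis exp_ge_zero mult_nonneg_nonpos)
  qed auto
  then have "(f x \<bullet> f x) * exp (- 2 * L) \<le> 0" by (simp add: \<phi>_def f0)
  then have "f x \<bullet> f x \<le> 0" using exp_gt_zero[of "- 2 * L"] by (simp add: mult_le_0_iff del: inner_gt_zero_iff exp_gt_zero)
  then have "(norm (f x))\<^sup>2 \<le> 0" by (simp add: dot_square_norm)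
  then show ?thesis by simp
qed

text \<open>Taylor coefficients of the solution of \<open>y' = k x\<close>, \<open>x' = m y + n\<close> in terms of those of
  \<open>k\<close>, \<open>m\<close>, \<open>n\<close>.\<close>

fun ode_coeff :: "(nat \<Rightarrow> complex) \<Rightarrow> (nat \<Rightarrow> complex) \<Rightarrow> (nat \<Rightarrow> complex) \<Rightarrow> complex \<Rightarrow> complex
    \<Rightarrow> nat \<Rightarrow> complex \<times> complex" where
  "ode_coeff a b c y0 x0 0 = (y0, x0)"
| "ode_coeff a b c y0 x0 (Suc i) =
     ((\<Sum>j\<le>i. a j * snd (ode_coeff a b c y0 x0 (i - j))) / of_nat (Suc i),
      ((\<Sum>j\<le>i. b j * fst (ode_coeff a b c y0 x0 (i - j))) + c i) / of_nat (Suc i))"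

text \<open>
  The sum that determines a coefficient of index \<open>l + 1\<close> has \<open>l + 1\<close> terms of size at most
  \<open>M C K\<^sup>l\<close>, and division by \<open>l + 1\<close> compensates their number. The condition \<open>2 M \<le> K\<close> leaves room for the
  inhomogeneous term.
\<close>

lemma ode_coeff_bound:
  assumes a: "\<And>j. cmod (a j) \<le> M * K ^ j" and b: "\<And>j. cmod (b j) \<le> M * K ^ j"
    and c: "\<And>j. cmod (c j) \<le> M * K ^ j"
    and C: "1 \<le> C" "cmod y0 \<le> C" "cmod x0 \<le> C" and K: "0 \<le> M" "2 * M \<le> K"
  shows "cmod (fst (ode_coeff a b c y0 x0 i)) \<le> C * K ^ i \<and> cmod (snd (ode_coeff a b c y0 x0 i)) \<le> C * K ^ i"
proof (induction i rule: less_induct)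
  case (less i)
  show ?case
  proof (cases i)
    case 0
    then show ?thesis using C by simp
  next
    case (Suc l)
    have K0: "K \<ge> 0" using K by simp
    let ?Y = "\<lambda>i. fst (ode_coeff a b c y0 x0 i)" and ?X = "\<lambda>i. snd (ode_coeff a b c y0 x0 i)"
    have sum: "cmod (\<Sum>j\<le>l. f j * g (l - j)) \<le> of_nat (Suc l) * (M * C * K ^ l)"
      if f: "\<And>j. cmod (f j) \<le> M * K ^ j" and g: "\<And>j. j \<le> l \<Longrightarrow> cmod (g j) \<le> C * K ^ j" for f g
    proof -
      have "cmod (f j * g (l - j)) \<le> M * C * K ^ l" if "j \<le> l" for j
      proof -
        have "cmod (f j * g (l - j)) \<le> (M * K ^ j) * (C * K ^ (l - j))"
          unfolding norm_mult using f g[of "l - j"] K K0 by (intro mult_mono) auto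
        also have "\<dots> = M * C * K ^ (j + (l - j))" by (simp only: power_add) (simp add: mult_ac)
        finally show ?thesis using that by simp
      qed
      then show ?thesis using sum_norm_le[of "{..l}" "\<lambda>j. f j * g (l - j)" "\<lambda>_. M * C * K ^ l"] by simp
    qed
    have Y: "cmod (\<Sum>j\<le>l. a j * ?X (l - j)) \<le> of_nat (Suc l) * (M * C * K ^ l)"
      by (rule sum[OF a]) (use less Suc in auto)
    have X: "cmod (\<Sum>j\<le>l. b j * ?Y (l - j)) \<le> of_nat (Suc l) * (M * C * K ^ l)"
      by (rule sum[OF b]) (use less Suc in auto)
    have MK: "M * C * K ^ l + M * K ^ l \<le> C * K ^ Suc l"
    proof -
      have "M * K ^ l \<le> M * C * K ^ l" using C K K0 by (intro mult_right_mono) (auto simp: mult_le_cancel_left1)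
      then have "M * C * K ^ l + M * K ^ l \<le> M * C * K ^ l + M * C * K ^ l" by (rule add_left_mono)
      also have "\<dots> = (2 * M) * (C * K ^ l)" by (simp add: mult.assoc)
      also have "\<dots> \<le> K * (C * K ^ l)" using K K0 C by (intro mult_right_mono) auto
      finally show ?thesis by (simp add: mult_ac)
    qed
    have MK0: "0 \<le> M * K ^ l" using K K0 by simp
    have "cmod (?Y i) = cmod (\<Sum>j\<le>l. a j * ?X (l - j)) / of_nat (Suc l)"
      by (simp add: Suc norm_divide del: of_nat_Suc)
    also have "\<dots> \<le> M * C * K ^ l" using Y by (simp add: divide_le_eq mult.commute del: of_nat_Suc)
    also have "\<dots> \<le> C * K ^ i" using MK MK0 Suc by simp
    finally have 1: "cmod (?Y i) \<le> C * K ^ i" .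
    have "cmod (?X i) = cmod ((\<Sum>j\<le>l. b j * ?Y (l - j)) + c l) / of_nat (Suc l)"
      by (simp add: Suc norm_divide del: of_nat_Suc)
    also have "\<dots> \<le> (of_nat (Suc l) * (M * C * K ^ l) + M * K ^ l) / of_nat (Suc l)"
      using X c[of l] by (intro divide_right_mono order.trans[OF norm_triangle_ineq] add_mono) auto
    also have "\<dots> = M * C * K ^ l + M * K ^ l / of_nat (Suc l)"
      by (simp add: add_divide_distrib del: of_nat_Suc)
    also have "M * K ^ l / of_nat (Suc l) \<le> M * K ^ l" using MK0
      by (simp add: divide_le_eq mult_le_cancel_left1 del: of_nat_Suc)
    also have "M * C * K ^ l + M * K ^ l \<le> C * K ^ i" using MK Suc by simp
    finally have 2: "cmod (?X i) \<le> C * K ^ i" by simp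
    show ?thesis using 1 2 by blast
  qed
qed

lemma taylor_coeff_bound:
  assumes "f holomorphic_on ball 0 e" "e > 0"
  obtains M a where "\<And>j. cmod (a j) \<le> M * (2 / e) ^ j" "\<And>z. z \<in> ball 0 e \<Longrightarrow> (\<lambda>j. a j * z ^ j) sums f z"
proof -
  define a where "a j = (deriv ^^ j) f 0 / fact j" for j
  have s: "(\<lambda>j. a j * z ^ j) sums f z" if "z \<in> ball 0 e" for z
    using holomorphic_power_series[OF assms(1) that] by (simp add: a_def)
  have "(\<lambda>j. a j * of_real (e / 2) ^ j) \<longlonglongrightarrow> 0"
    using s[of "of_real (e / 2)"] assms(2) by (intro summable_LIMSEQ_zero sums_summable) auto
  then have "Bseq (\<lambda>j. a j * of_real (e / 2) ^ j)" by (intro convergent_imp_Bseq convergentI)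
  then obtain M where M: "\<And>j. cmod (a j * of_real (e / 2) ^ j) \<le> M" unfolding Bseq_def by blast
  have "cmod (a j) \<le> M * (2 / e) ^ j" for j
    using M[of j] assms(2) by (simp add: norm_mult norm_power norm_divide field_simps)
  with s show ?thesis using that by blast
qed

lemma linear_ode_solution:
  assumes e: "e > 0"
    and hol: "k holomorphic_on ball 0 e" "m holomorphic_on ball 0 e" "n holomorphic_on ball 0 e"
  obtains d y x where "0 < d" "d \<le> e" "y 0 = y0" "x 0 = x0"
    "\<And>z. z \<in> ball 0 d \<Longrightarrow> (y has_field_derivative k z * x z) (at z)"
    "\<And>z. z \<in> ball 0 d \<Longrightarrow> (x has_field_derivative m z * y z + n z) (at z)"
proof -
  obtain Ma a where a: "\<And>j. cmod (a j) \<le> Ma * (2 / e) ^ j" "\<And>z. z \<in> ball 0 e \<Longrightarrow> (\<lambda>j. a j * z ^ j) sums k z"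
    using taylor_coeff_bound[OF hol(1) e] by metis
  obtain Mb b where b: "\<And>j. cmod (b j) \<le> Mb * (2 / e) ^ j" "\<And>z. z \<in> ball 0 e \<Longrightarrow> (\<lambda>j. b j * z ^ j) sums m z"
    using taylor_coeff_bound[OF hol(2) e] by metis
  obtain Mc c where c: "\<And>j. cmod (c j) \<le> Mc * (2 / e) ^ j" "\<And>z. z \<in> ball 0 e \<Longrightarrow> (\<lambda>j. c j * z ^ j) sums n z"
    using taylor_coeff_bound[OF hol(3) e] by metis
  define M where "M = max 1 (max Ma (max Mb Mc))"
  define K where "K = max (2 / e) (2 * M)"
  define C where "C = max 1 (max (cmod y0) (cmod x0))"
  have M1: "1 \<le> M" by (simp add: M_def)
  have Kpos: "K > 0" using e by (simp add: K_def less_max_iff_disj)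
  have bdK: "cmod (g j) \<le> M * K ^ j" if "\<And>j. cmod (g j) \<le> M' * (2 / e) ^ j" "M' \<le> M" for g M' j
  proof -
    have "cmod (g j) \<le> M' * (2 / e) ^ j" using that by blast
    also have "\<dots> \<le> M * K ^ j"
      using that(2) e M1 by (intro mult_mono power_mono) (auto simp: K_def)
    finally show ?thesis .
  qed
  have abd: "cmod (a j) \<le> M * K ^ j" and bbd: "cmod (b j) \<le> M * K ^ j" and cbd: "cmod (c j) \<le> M * K ^ j" for j
    by (rule bdK[OF a(1)], simp add: M_def, rule bdK[OF b(1)], simp add: M_def, rule bdK[OF c(1)], simp add: M_def)
  define Y where "Y i = fst (ode_coeff a b c y0 x0 i)" for i
  define X where "X i = snd (ode_coeff a b c y0 x0 i)" for i
  have XY: "cmod (Y i) \<le> C * K ^ i" "cmod (X i) \<le> C * K ^ i" for i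
    using ode_coeff_bound[of a M K b c C y0 x0 i, OF abd bbd cbd] M1 unfolding Y_def X_def
    by (auto simp: C_def K_def)
  have sm: "summable (\<lambda>j. cmod (g j * z ^ j))" if "\<And>j. cmod (g j) \<le> B * K ^ j" "cmod z < 1 / K"
    for g :: "nat \<Rightarrow> complex" and B z
  proof (rule summable_comparison_test')
    have "norm (K * cmod z) < 1" using that(2) Kpos by (simp add: field_simps)
    then show "summable (\<lambda>j. B * (K * cmod z) ^ j)" by (intro summable_mult summable_geometric)
    show "norm (cmod (g j * z ^ j)) \<le> B * (K * cmod z) ^ j" if "j \<ge> 0" for j
      using \<open>\<And>j. cmod (g j) \<le> B * K ^ j\<close>[of j]
      by (simp add: norm_mult norm_power power_mult_distrib mult.assoc[symmetric] mult_right_mono)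
  qed
  define y where "y z = (\<Sum>i. Y i * z ^ i)" for z
  define x where "x z = (\<Sum>i. X i * z ^ i)" for z
  define d where "d = min e (1 / K)"
  have dY: "diffs Y i = (\<Sum>j\<le>i. a j * X (i - j))" for i
    by (simp add: diffs_def Y_def X_def del: of_nat_Suc)
  have dX: "diffs X i = (\<Sum>j\<le>i. b j * Y (i - j)) + c i" for i
    by (simp add: diffs_def Y_def X_def del: of_nat_Suc)
  have cauchy: "(\<lambda>i. (\<Sum>j\<le>i. g j * w (i - j)) * z ^ i) sums ((\<Sum>j. g j * z ^ j) * (\<Sum>j. w j * z ^ j))"
    if "\<And>j. cmod (g j) \<le> M * K ^ j" "\<And>j. cmod (w j) \<le> C * K ^ j" "cmod z < 1 / K" for g w :: "nat \<Rightarrow> complex" and z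
  proof -
    have "(\<Sum>j\<le>i. (g j * z ^ j) * (w (i - j) * z ^ (i - j))) = (\<Sum>j\<le>i. g j * w (i - j)) * z ^ i" for i
      unfolding sum_distrib_right
    proof (rule sum.cong[OF refl])
      fix j assume "j \<in> {..i}"
      then have "z ^ i = z ^ j * z ^ (i - j)" by (simp flip: power_add)
      then show "g j * z ^ j * (w (i - j) * z ^ (i - j)) = g j * w (i - j) * z ^ i" by simp
    qed
    with Cauchy_product_sums[OF sm[of g, OF that(1,3)] sm[of w, OF that(2,3)]] show ?thesis by simp
  qed
  show ?thesis
  proof (rule that[of d y x])
    show "0 < d" "d \<le> e" using e Kpos by (auto simp: d_def)
    show "y 0 = y0" "x 0 = x0" unfolding y_def x_def by (subst powser_zero, simp add: Y_def X_def)+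
    fix z :: complex assume "z \<in> ball 0 d"
    then have z: "z \<in> ball 0 e" "cmod z < 1 / K" by (auto simp: d_def)
    have "(y has_field_derivative (\<Sum>i. diffs Y i * z ^ i)) (at z)"
      unfolding y_def by (rule termdiffs_strong'[OF _ z(2)]) (rule summable_norm_cancel[OF sm[OF XY(1)]])
    moreover have "(\<Sum>i. diffs Y i * z ^ i) = k z * x z"
      using sums_unique[OF cauchy[of a X, OF abd XY(2) z(2)]] sums_unique[OF a(2)[OF z(1)]]
      by (simp add: dY x_def)
    ultimately show "(y has_field_derivative k z * x z) (at z)" by simp
    have "(x has_field_derivative (\<Sum>i. diffs X i * z ^ i)) (at z)"
      unfolding x_def by (rule termdiffs_strong'[OF _ z(2)]) (rule summable_norm_cancel[OF sm[OF XY(2)]])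
    moreover have "(\<Sum>i. diffs X i * z ^ i) = m z * y z + n z"
      using sums_unique[OF sums_add[OF cauchy[of b Y, OF bbd XY(1) z(2)] c(2)[OF z(1)]]]
        sums_unique[OF b(2)[OF z(1)]]
      by (simp add: dX y_def distrib_right)
    ultimately show "(x has_field_derivative m z * y z + n z) (at z)" by simp
  qed
qed

section \<open>CR geometry of rigid hypersurfaces\<close>

lemma proj12_nth [simp]: "proj12 p $ 1 = p $ 1" "proj12 p $ 2 = p $ 2"
  by (simp_all add: proj12_def)

lemma proj12_axis [simp]:
  "proj12 (axis 1 c) = axis 1 c" "proj12 (axis 2 c) = axis 2 c" "proj12 (axis 3 c) = 0"
  by (simp_all add: vec_eq_iff forall_2 axis_def)

lemma bounded_linear_proj12: "bounded_linear proj12"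
proof -
  have "linear proj12" by (rule linearI) (simp_all add: vec_eq_iff forall_2)
  then show ?thesis using linear_conv_bounded_linear by blast
qed

lemma open_vimage_proj12: "open U \<Longrightarrow> open (proj12 -` U)"
  by (rule open_vimage) (auto intro: linear_continuous_on bounded_linear_proj12)

lemma pd_proj12:
  assumes "\<phi> differentiable (at (proj12 p))"
  shows "pd 1 (\<lambda>p. \<phi> (proj12 p)) p = pd 1 \<phi> (proj12 p)"
    "pd 2 (\<lambda>p. \<phi> (proj12 p)) p = pd 2 \<phi> (proj12 p)"
    "pd 3 (\<lambda>p. \<phi> (proj12 p)) p = 0"
    "pdbar 1 (\<lambda>p. \<phi> (proj12 p)) p = pdbar 1 \<phi> (proj12 p)"
    "pdbar 2 (\<lambda>p. \<phi> (proj12 p)) p = pdbar 2 \<phi> (proj12 p)"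
    "pdbar 3 (\<lambda>p. \<phi> (proj12 p)) p = 0"
    "(\<lambda>p. \<phi> (proj12 p)) differentiable (at p)"
proof -
  have d: "((\<lambda>p. \<phi> (proj12 p)) has_derivative (\<lambda>h. frechet_derivative \<phi> (at (proj12 p)) (proj12 h))) (at p)"
    using has_derivative_compose[OF bounded_linear_imp_has_derivative[OF bounded_linear_proj12] has_frechet_derivative[OF assms]] .
  have z: "frechet_derivative \<phi> (at (proj12 p)) 0 = 0"
    using linear_frechet_derivative[OF assms] by (rule linear_0)
  show "pd 1 (\<lambda>p. \<phi> (proj12 p)) p = pd 1 \<phi> (proj12 p)"
    "pd 2 (\<lambda>p. \<phi> (proj12 p)) p = pd 2 \<phi> (proj12 p)"
    "pd 3 (\<lambda>p. \<phi> (proj12 p)) p = 0"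
    "pdbar 1 (\<lambda>p. \<phi> (proj12 p)) p = pdbar 1 \<phi> (proj12 p)"
    "pdbar 2 (\<lambda>p. \<phi> (proj12 p)) p = pdbar 2 \<phi> (proj12 p)"
    "pdbar 3 (\<lambda>p. \<phi> (proj12 p)) p = 0"
    unfolding pd_eqI[OF d] pdbar_eqI[OF d] by (simp_all add: pd_def pdbar_def z)
  show "(\<lambda>p. \<phi> (proj12 p)) differentiable (at p)" using d by (rule differentiableI)
qed

definition cplx :: "(complex^2 \<Rightarrow> real) \<Rightarrow> complex^2 \<Rightarrow> complex" where
  "cplx F = (\<lambda>p. of_real (F p))"

definition F22 :: "(complex^2 \<Rightarrow> real) \<Rightarrow> complex^2 \<Rightarrow> complex" where
  "F22 F = pdbar 2 (pd 2 (cplx F))"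

definition monge_ampere_at :: "(complex^2 \<Rightarrow> real) \<Rightarrow> complex^2 \<Rightarrow> bool" where
  "monge_ampere_at F q \<longleftrightarrow> F11 F q * F22 F q = F12 F q * cnj (F12 F q)"

lemma F11_F12_cplx: "F11 F = pdbar 1 (pd 1 (cplx F))" "F12 F = pdbar 2 (pd 1 (cplx F))"
  by (simp_all add: F11_def F12_def cplx_def)

lemma smooth_on_cplx: "open U \<Longrightarrow> smooth_on F U \<Longrightarrow> smooth_on (cplx F) U"
  unfolding cplx_def by (rule smooth_on_of_real)

lemma cnj_pd_cplx:
  assumes "cplx F differentiable (at q)"
  shows "cnj (pd j (cplx F) q) = pdbar j (cplx F) q"
  using pdbar_cnj[OF assms, of j] by (simp add: cplx_def)

lemma cnj_second_cplx:
  assumes "open U" "q \<in> U" "smooth_on F U"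
  shows "cnj (pdbar k (pd j (cplx F)) q) = pdbar j (pd k (cplx F)) q"
proof -
  have s: "smooth_on (cplx F) U" using assms by (intro smooth_on_cplx)
  have "cnj (pdbar k (pd j (cplx F)) q) = pd k (\<lambda>q. cnj (pd j (cplx F) q)) q"
    using pd_cnj[OF smooth_on_differentiable[OF smooth_on_pd[OF assms(1) s] assms(2)]] by simp
  also have "\<dots> = pd k (pdbar j (cplx F)) q"
    by (rule pd_cong[OF assms(1,2)]) (rule cnj_pd_cplx[OF smooth_on_differentiable[OF s]])
  also have "\<dots> = pdbar j (pd k (cplx F)) q"
    using wirtinger_commute(2)[OF assms(1,2) s] by simp
  finally show ?thesis .
qed

definition rigid_grad :: "(complex^2 \<Rightarrow> real) \<Rightarrow> 3 \<Rightarrow> complex^2 \<Rightarrow> complex" where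
  "rigid_grad F i = (if i = 1 then pd 1 (cplx F) else if i = 2 then pd 2 (cplx F) else (\<lambda>q. - 1 / 2))"

text \<open>
  The iterated CR fields on functions of the first two coordinates: the correction term in
  \<^const>\<open>CR_field\<close> contains the derivative in the third coordinate and drops out.
\<close>

primrec bar_iter :: "3 list \<Rightarrow> (complex^2 \<Rightarrow> complex) \<Rightarrow> complex^2 \<Rightarrow> complex" where
  "bar_iter [] \<phi> = \<phi>"
| "bar_iter (j # js) \<phi> = pdbar (if j = 1 then 1 else 2) (bar_iter js \<phi>)"

context
  fixes F :: "complex^2 \<Rightarrow> real" and U :: "(complex^2) set"
  assumes U: "open U" and F: "smooth_on F U"
begin

lemma smooth_cplx: "smooth_on (cplx F) U"
  using U F by (rule smooth_on_cplx)

lemma smooth_grad: "smooth_on (rigid_grad F i) U"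
  unfolding rigid_grad_def using smooth_on_pd[OF U smooth_cplx] by (simp add: smooth_on_const)

lemma rigid_defining_pd:
  assumes "proj12 p \<in> U"
  shows "pd i (rigid_defining F) p = rigid_grad F i (proj12 p)"
    and "pdbar i (rigid_defining F) p = cnj (rigid_grad F i (proj12 p))"
proof -
  have rd: "rigid_defining F = (\<lambda>p. cplx F (proj12 p) - of_real (Re (p $ 3)))"
    by (simp add: rigid_defining_def cplx_def fun_eq_iff)
  have c: "cplx F differentiable (at (proj12 p))"
    using smooth_on_differentiable[OF smooth_cplx assms] .
  have e: "((\<lambda>p :: complex^3. complex_of_real (Re (p $ 3))) has_derivative (\<lambda>h. of_real (Re (h $ 3)))) (at p)"
    by (intro has_derivative_of_real has_derivative_Re bounded_linear_imp_has_derivative bounded_linear_vec_nth)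
  note a = pd_diff[OF pd_proj12(7)[OF c] differentiableI[OF e]] pdbar_diff[OF pd_proj12(7)[OF c] differentiableI[OF e]]
  have 1: "pd i (rigid_defining F) p = rigid_grad F i (proj12 p)" for i
    unfolding rd a pd_eqI[OF e] using exhaust_3[of i]
    by (auto simp: pd_proj12[OF c] rigid_grad_def axis_def)
  show "pd i (rigid_defining F) p = rigid_grad F i (proj12 p)" by (rule 1)
  have "rigid_defining F differentiable (at p)"
    unfolding rd using pd_proj12(7)[OF c] differentiableI[OF e] by (rule differentiable_diff)
  moreover have "(\<lambda>p. cnj (rigid_defining F p)) = rigid_defining F"
    by (simp add: rigid_defining_def fun_eq_iff)
  ultimately show "pdbar i (rigid_defining F) p = cnj (rigid_grad F i (proj12 p))"
    using pdbar_cnj[of "rigid_defining F" p i] by (simp add: 1)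
qed

lemma holo_tangent_rigid:
  assumes "proj12 p \<in> U"
  shows "holo_tangent (rigid_defining F) p =
    {v. v $ 3 = 2 * (pd 1 (cplx F) (proj12 p) * v $ 1 + pd 2 (cplx F) (proj12 p) * v $ 2)}"
  unfolding holo_tangent_def rigid_defining_pd[OF assms]
  by (auto simp: sum_3 rigid_grad_def algebra_simps)

lemma levi_form_rigid:
  assumes p: "proj12 p \<in> U"
  defines "q \<equiv> proj12 p"
  shows "levi_form (rigid_defining F) p v w =
    (F11 F q * v $ 1 + cnj (F12 F q) * v $ 2) * cnj (w $ 1) + (F12 F q * v $ 1 + F22 F q * v $ 2) * cnj (w $ 2)"
proof -
  have c: "pdbar k (pd j (rigid_defining F)) p = pdbar k (\<lambda>p. rigid_grad F j (proj12 p)) p" for j k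
    by (rule pdbar_cong[OF open_vimage_proj12[OF U]]) (use p rigid_defining_pd in auto)
  have g: "rigid_grad F j differentiable (at (proj12 p))" for j
    using smooth_on_differentiable[OF smooth_grad p] .
  have "pdbar 1 (pd 2 (cplx F)) q = cnj (F12 F q)"
    unfolding F11_F12_cplx using cnj_second_cplx[OF U p F, of 2 1] by (simp add: q_def)
  then show ?thesis
    unfolding levi_form_def c sum_3 pd_proj12[OF g]
    by (simp add: rigid_grad_def F11_F12_cplx F22_def q_def algebra_simps)
qed

lemma dim_span_pair:
  fixes a b :: "complex^3"
  assumes "a $ 1 = 1" "a $ 2 = 0" "b $ 1 = 0" "b $ 2 = 1"
  shows "vec.dim (vec.span {a, b}) = 2"
proof -
  have "b \<noteq> 0" using assms(4) by auto
  moreover have "a \<notin> vec.span {b}"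
  proof
    assume "a \<in> vec.span {b}"
    then obtain k where "a = k *s b" unfolding vec.span_singleton by auto
    then have "a $ 1 = k * b $ 1" by simp
    then show False using assms by simp
  qed
  moreover have "a \<noteq> b" using assms by auto
  ultimately have "vec.independent {a, b}"
    by (simp add: vec.independent_insert vec.span_empty)
  then show ?thesis using vec.dim_span_eq_card_independent \<open>a \<noteq> b\<close> by fastforce
qed

text \<open>
  The complex tangent space projects isomorphically to the first two coordinates, where the Levi form
  is the complex Hessian of \<open>F\<close>. As the entry \<open>F\<^bsub>1 1bar\<^esub>\<close> does not vanish, this Hessian has rank \<open>1\<close> or
  \<open>2\<close>, and its determinant decides.
\<close>

lemma levi_rank_rigid:
  assumes p: "proj12 p \<in> U" and nz: "F11 F (proj12 p) \<noteq> 0"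
  shows "levi_rank (rigid_defining F) p = 1 \<longleftrightarrow> monge_ampere_at F (proj12 p)"
proof -
  define q where "q = proj12 p"
  define A where "A = pd 1 (cplx F) q"
  define B where "B = pd 2 (cplx F) q"
  define T where "T = {v :: complex^3. v $ 3 = 2 * (A * v $ 1 + B * v $ 2)}"
  have T: "holo_tangent (rigid_defining F) p = T"
    unfolding holo_tangent_rigid[OF p] T_def A_def B_def q_def ..
  let ?a = "vector [1, 0, 2 * A] :: complex^3" and ?b = "vector [0, 1, 2 * B] :: complex^3"
  have "T = vec.span {?a, ?b}"
  proof (intro set_eqI iffI)
    fix v assume "v \<in> T"
    then have "v = v $ 1 *s ?a + v $ 2 *s ?b" by (simp add: T_def vec_eq_iff forall_3 algebra_simps)
    then show "v \<in> vec.span {?a, ?b}"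
      by (metis insertI1 insertI2 vec.span_add vec.span_base vec.span_scale)
  next
    fix v assume "v \<in> vec.span {?a, ?b}"
    then obtain k l where "v = l *s ?b + k *s ?a"
      unfolding vec.span_insert vec.span_singleton by (auto simp: diff_eq_eq)
    then show "v \<in> T" by (simp add: T_def algebra_simps)
  qed
  then have dT: "vec.dim T = 2" using dim_span_pair[of ?a ?b] by simp
  define f11 where "f11 = F11 F q"
  define f12 where "f12 = F12 F q"
  define f22 where "f22 = F22 F q"
  have nz': "f11 \<noteq> 0" using nz by (simp add: f11_def q_def)
  have K: "levi_kernel (rigid_defining F) p =
      {v \<in> T. f11 * v $ 1 + cnj f12 * v $ 2 = 0 \<and> f12 * v $ 1 + f22 * v $ 2 = 0}" (is "_ = ?K")
  proof (intro set_eqI iffI)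
    fix v assume v: "v \<in> levi_kernel (rigid_defining F) p"
    have "?a \<in> T" "?b \<in> T" by (auto simp: T_def)
    then have "levi_form (rigid_defining F) p v ?a = 0" "levi_form (rigid_defining F) p v ?b = 0"
      using v by (auto simp: levi_kernel_def T)
    then show "v \<in> ?K" using v
      by (simp add: levi_form_rigid[OF p] levi_kernel_def T f11_def f12_def f22_def q_def)
  next
    fix v assume "v \<in> ?K"
    then show "v \<in> levi_kernel (rigid_defining F) p"
      by (simp add: levi_form_rigid[OF p] levi_kernel_def T f11_def f12_def f22_def q_def)
  qed
  show ?thesis
  proof
    assume r: "levi_rank (rigid_defining F) p = 1"
    show "monge_ampere_at F (proj12 p)"
    proof (rule ccontr)
      assume "\<not> monge_ampere_at F (proj12 p)"
      then have ne: "f11 * f22 - f12 * cnj f12 \<noteq> 0"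
        by (simp add: monge_ampere_at_def f11_def f12_def f22_def q_def)
      have "?K \<subseteq> {0}"
      proof
        fix v assume v: "v \<in> ?K"
        have "(f11 * f22 - f12 * cnj f12) * v $ 2
            = f11 * (f12 * v $ 1 + f22 * v $ 2) - f12 * (f11 * v $ 1 + cnj f12 * v $ 2)"
          by (simp add: algebra_simps)
        also have "\<dots> = 0" using v by simp
        finally have v2: "v $ 2 = 0" using ne by simp
        then have v1: "v $ 1 = 0" using v nz' by simp
        show "v \<in> {0}" using v v1 v2 by (simp add: T_def vec_eq_iff forall_3)
      qed
      then have "vec.dim ?K = 0" using vec.dim_eq_0 by blast
      then have "levi_rank (rigid_defining F) p = 2"
        unfolding levi_rank_def T K dT by (simp only:)
      then show False using r by simp
    qed
  next
    assume "monge_ampere_at F (proj12 p)"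
    then have ma: "f11 * f22 = f12 * cnj f12"
      by (simp add: monge_ampere_at_def f11_def f12_def f22_def q_def)
    define c where "c = - cnj f12 / f11"
    let ?k = "vector [c, 1, 2 * (A * c + B)] :: complex^3"
    have "?K = vec.span {?k}"
    proof (intro set_eqI iffI)
      fix v assume v: "v \<in> ?K"
      then have "f11 * v $ 1 = - cnj f12 * v $ 2" by (simp add: eq_neg_iff_add_eq_0)
      then have "v $ 1 = c * v $ 2" using nz' by (simp add: c_def field_simps)
      then have "v = v $ 2 *s ?k" using v by (simp add: T_def vec_eq_iff forall_3 algebra_simps)
      then show "v \<in> vec.span {?k}" by (metis insertI1 vec.span_base vec.span_scale)
    next
      fix v assume "v \<in> vec.span {?k}"
      then obtain l where l: "v = l *s ?k" unfolding vec.span_singleton by auto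
      have "f12 * c + f22 = 0" using ma nz' by (simp add: c_def field_simps)
      then have "f12 * (l * c) + f22 * l = 0" by (metis distrib_right mult.assoc mult.commute mult_zero_left)
      then show "v \<in> ?K" using nz' unfolding l by (simp add: T_def c_def algebra_simps)
    qed
    moreover have "?k \<noteq> 0" by (metis vector_3(2) zero_index zero_neq_one)
    ultimately have "vec.dim ?K = 1"
      using vec.dim_span_eq_card_independent[of "{?k}"] by (simp add: vec.independent_insert)
    then show "levi_rank (rigid_defining F) p = 1" by (simp add: levi_rank_def T K dT)
  qed
qed

lemma smooth_bar_iter: "smooth_on \<phi> U \<Longrightarrow> smooth_on (bar_iter js \<phi>) U"
  by (induction js) (auto intro: smooth_on_pdbar U)

lemma CR_iter_rigid:
  assumes "set js \<subseteq> {1, 2}" "proj12 p \<in> U"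
  shows "CR_iter (rigid_defining F) js (pd i (rigid_defining F)) p = bar_iter js (rigid_grad F i) (proj12 p)"
  using assms
proof (induction js arbitrary: p)
  case Nil
  then show ?case by (simp add: rigid_defining_pd)
next
  case (Cons j js)
  let ?g = "CR_iter (rigid_defining F) js (pd i (rigid_defining F))"
  let ?h = "bar_iter js (rigid_grad F i)"
  have c: "pdbar k ?g p = pdbar k (\<lambda>p. ?h (proj12 p)) p" for k
    by (rule pdbar_cong[OF open_vimage_proj12[OF U]]) (use Cons in auto)
  have d: "?h differentiable (at (proj12 p))"
    using smooth_on_differentiable[OF smooth_bar_iter[OF smooth_grad] Cons.prems(2)] .
  have "j = 1 \<or> j = 2" using Cons.prems by auto
  then show ?case
    by (auto simp: CR_field_def c pd_proj12[OF d])
qed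

text \<open>
  By the Monge--Ampere equation, \<open>\<partial>F\<^sub>2 = \<psi> \<partial>F\<^sub>1\<close> in the conjugate variables, where
  \<open>\<psi> = cnj F\<^bsub>1 2bar\<^esub> / F\<^bsub>1 1bar\<^esub>\<close>. So the vectors with at most one CR derivative lie in the plane spanned by the
  gradient and \<open>(1, \<psi>, 0)\<close>. A second derivative leaves this plane by a multiple of \<open>(0, \<psi>\<^bsub>k bar\<^esub>, 0)\<close>, and
  \<open>\<psi>\<^bsub>1bar\<^esub>\<close> is the conjugate of \<open>S\<close>.
\<close>

lemma nondegenerate_rigid:
  assumes ma: "\<And>q. q \<in> U \<Longrightarrow> monge_ampere_at F q"
    and nz: "\<And>q. q \<in> U \<Longrightarrow> F11 F q \<noteq> 0"
    and p: "proj12 p \<in> U"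
  shows "nondegenerate_at 2 (rigid_defining F) p \<longleftrightarrow> S_fun F (proj12 p) \<noteq> 0"
proof -
  define q where "q = proj12 p"
  have q: "q \<in> U" using p by (simp add: q_def)
  let ?f1 = "pd 1 (cplx F)" and ?f2 = "pd 2 (cplx F)"
  define \<psi> where "\<psi> q = cnj (F12 F q) / F11 F q" for q
  have f1: "smooth_on ?f1 U" and f2: "smooth_on ?f2 U"
    by (auto intro: smooth_on_pd U smooth_cplx)
  have sF11: "smooth_on (F11 F) U" and sF12: "smooth_on (F12 F) U"
    unfolding F11_F12_cplx by (auto intro: smooth_on_pdbar U f1)
  have s\<psi>: "smooth_on \<psi> U" unfolding \<psi>_def[abs_def]
    by (intro smooth_intros U sF12 sF11 nz)
  have real: "cnj (F11 F q) = F11 F q" if "q \<in> U" for q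
    unfolding F11_F12_cplx using cnj_second_cplx[OF U that F] .
  have rel: "pdbar k ?f2 q = \<psi> q * pdbar k ?f1 q" if "q \<in> U" for k q
  proof -
    have "pdbar 1 ?f2 q = cnj (F12 F q)"
      unfolding F11_F12_cplx using cnj_second_cplx[OF U that F, of 2 1] by simp
    then show ?thesis
      using exhaust_2[of k] ma[OF that] nz[OF that]
      by (auto simp: \<psi>_def monge_ampere_at_def F22_def F11_F12_cplx field_simps)
  qed
  have rel2: "pdbar j (pdbar k ?f2) q = \<psi> q * pdbar j (pdbar k ?f1) q + pdbar j \<psi> q * pdbar k ?f1 q" for j k
  proof -
    have "pdbar j (pdbar k ?f2) q = pdbar j (\<lambda>q. \<psi> q * pdbar k ?f1 q) q"
      by (rule pdbar_cong[OF U q]) (rule rel)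
    then show ?thesis
      using pdbar_mult[OF smooth_on_differentiable[OF s\<psi> q]
          smooth_on_differentiable[OF smooth_on_pdbar[OF U f1] q]] by simp
  qed
  have \<psi>1: "pdbar 1 \<psi> q = cnj (S_fun F q)"
  proof -
    have "pdbar 1 \<psi> q = pdbar 1 (\<lambda>q. cnj (F12 F q / F11 F q)) q"
      by (rule pdbar_cong[OF U q]) (simp add: \<psi>_def real)
    also have "\<dots> = cnj (pd 1 (\<lambda>q. F12 F q / F11 F q) q)"
      by (rule pdbar_cnj) (rule smooth_on_differentiable[OF _ q], intro smooth_intros U sF12 sF11 nz)
    finally show ?thesis by (simp add: S_fun_def)
  qed
  \<comment> \<open>mixed third derivatives of \<open>F\<close> commute\<close>
  have \<psi>2: "pdbar 2 \<psi> q * F11 F q = pdbar 1 \<psi> q * F12 F q"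
    using rel2[of 2 1] rel2[of 1 2] wirtinger_commute(3)[OF U q f2, of 1 2] wirtinger_commute(3)[OF U q f1, of 1 2]
    by (simp add: F11_F12_cplx)
  define X where "X js = (\<chi> i. CR_iter (rigid_defining F) js (pd i (rigid_defining F)) p)" for js
  have X: "X js $ i = bar_iter js (rigid_grad F i) q" if "set js \<subseteq> {1, 2}" for js i
    using CR_iter_rigid[OF that p] by (simp add: X_def q_def)
  have span: "CR_span k (rigid_defining F) p = vec.span {X js | js. set js \<subseteq> {1, 2} \<and> length js \<le> k}" for k
    by (simp add: CR_span_def X_def)
  \<comment> \<open>a linear form whose kernel is the plane spanned by the gradient and \<open>(1, \<psi>, 0)\<close>\<close>
  define l where "l v = v $ 2 - \<psi> q * v $ 1 + 2 * (?f2 q - \<psi> q * ?f1 q) * v $ 3" for v :: "complex^3"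
  define N where "N = {v. l v = 0}"
  have "l (x + y) = l x + l y" "l (c *s x) = c * l x" "l 0 = 0" for x y c
    by (simp_all add: l_def algebra_simps)
  then have "vec.subspace N" by (simp add: vec.subspace_def N_def)
  have "axis 2 1 \<notin> N" by (simp add: N_def l_def axis_def)
  then have N: "N \<noteq> UNIV" by blast
  have not_UNIV: "CR_span k (rigid_defining F) p \<noteq> UNIV"
    if "\<And>js. set js \<subseteq> {1, 2} \<Longrightarrow> length js \<le> k \<Longrightarrow> X js \<in> N" for k
  proof -
    have "CR_span k (rigid_defining F) p \<subseteq> N"
      unfolding span by (rule vec.span_minimal) (use that \<open>vec.subspace N\<close> in auto)
    with N show ?thesis by blast
  qed
  have const: "pdbar k (\<lambda>q. c) = (\<lambda>q. 0)" for k :: 2 and c by (simp add: fun_eq_iff)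
  have X0: "X [] \<in> N" by (simp add: N_def l_def X rigid_grad_def algebra_simps)
  have X1: "X [j] \<in> N" if "j \<in> {1, 2}" for j
    using that by (auto simp: N_def l_def X rigid_grad_def rel[OF q])
  have X2: "X [j, k] \<in> N" if "j \<in> {1, 2}" "k \<in> {1, 2}" "S_fun F q = 0" for j k
  proof -
    have "pdbar 1 \<psi> q = 0" "pdbar 2 \<psi> q = 0" using \<psi>1 \<psi>2 that(3) nz[OF q] by auto
    then show ?thesis
      using that by (auto simp: N_def l_def X rigid_grad_def rel2 const)
  qed
  have small: "X js \<in> N" if "set js \<subseteq> {1, 2}" "length js \<le> 1" for js
    using that X0 X1 by (cases js) auto
  show ?thesis
  proof
    assume nd: "nondegenerate_at 2 (rigid_defining F) p"
    show "S_fun F (proj12 p) \<noteq> 0"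
    proof
      assume "S_fun F (proj12 p) = 0"
      then have S0: "S_fun F q = 0" by (simp add: q_def)
      have "CR_span 2 (rigid_defining F) p \<noteq> UNIV"
      proof (rule not_UNIV)
        fix js :: "3 list" assume js: "set js \<subseteq> {1, 2}" "length js \<le> 2"
        show "X js \<in> N"
        proof (cases "length js \<le> 1")
          case True
          then show ?thesis using small js by blast
        next
          case False
          then obtain j k where "js = [j, k]" using js(2)
            by (cases js; cases "tl js") auto
          then show ?thesis using X2 js S0 by auto
        qed
      qed
      then show False using nd by (simp add: nondegenerate_at_def)
    qed
  next
    assume "S_fun F (proj12 p) \<noteq> 0"
    then have S: "cnj (S_fun F q) \<noteq> 0" by (simp add: q_def)
    have "CR_span k (rigid_defining F) p \<noteq> UNIV" if "k < 2" for k
      by (rule not_UNIV) (use small that in auto)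
    moreover have "v \<in> CR_span 2 (rigid_defining F) p" for v
    proof -
      define \<alpha> where "\<alpha> = - 2 * v $ 3"
      \<comment> \<open>the coefficients that solve \<open>v = \<alpha> X[] + \<beta> X[1] + \<gamma> X[1, 1]\<close>\<close>
      define \<gamma> where "\<gamma> = (v $ 2 - \<psi> q * v $ 1 - \<alpha> * (?f2 q - \<psi> q * ?f1 q)) / (cnj (S_fun F q) * F11 F q)"
      define \<beta> where "\<beta> = (v $ 1 - \<alpha> * ?f1 q - \<gamma> * pdbar 1 (pdbar 1 ?f1) q) / F11 F q"
      have \<beta>: "\<beta> * F11 F q = v $ 1 - \<alpha> * ?f1 q - \<gamma> * pdbar 1 (pdbar 1 ?f1) q"
        using nz[OF q] by (simp add: \<beta>_def)
      have \<gamma>: "\<gamma> * (cnj (S_fun F q) * F11 F q) = v $ 2 - \<psi> q * v $ 1 - \<alpha> * (?f2 q - \<psi> q * ?f1 q)"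
        using nz[OF q] S by (simp add: \<gamma>_def)
      have "v $ 1 = \<alpha> * ?f1 q + \<beta> * F11 F q + \<gamma> * pdbar 1 (pdbar 1 ?f1) q"
        unfolding \<beta> by simp
      moreover have "v $ 2 = \<alpha> * ?f2 q + \<psi> q * (\<beta> * F11 F q) + \<gamma> * (\<psi> q * pdbar 1 (pdbar 1 ?f1) q)
          + \<gamma> * (cnj (S_fun F q) * F11 F q)"
        unfolding \<beta> \<gamma> by (simp add: algebra_simps)
      moreover have "pdbar 1 (pd 1 (cplx F)) q = F11 F q" by (simp add: F11_F12_cplx)
      moreover have "bar_iter [] \<phi> q = \<phi> q" for \<phi> by simp
      ultimately have "v = \<alpha> *s X [] + \<beta> *s X [1] + \<gamma> *s X [1, 1]"
        by (simp add: vec_eq_iff forall_3 X rigid_grad_def rel[OF q] rel2 const \<psi>1 \<alpha>_def algebra_simps)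
      moreover have "X [] \<in> CR_span 2 (rigid_defining F) p" "X [1] \<in> CR_span 2 (rigid_defining F) p"
        "X [1, 1] \<in> CR_span 2 (rigid_defining F) p"
        unfolding span by (rule vec.span_base, force)+
      ultimately show ?thesis unfolding CR_span_def
        by (metis (no_types, lifting) vec.span_add vec.span_scale)
    qed
    ultimately show "nondegenerate_at 2 (rigid_defining F) p"
      by (auto simp: nondegenerate_at_def)
  qed
qed

end

section \<open>Term-by-term integration\<close>

lemma has_sum_prod_decode:
  fixes f :: "nat \<times> nat \<Rightarrow> 'a::topological_comm_monoid_add"
  shows "((\<lambda>n. f (prod_decode n)) has_sum s) UNIV \<longleftrightarrow> (f has_sum s) UNIV"
  using has_sum_reindex_bij_betw[OF bij_prod_decode] .

text \<open>
  On a disc of a smaller radius the series of derivatives is dominated by a multiple of the series of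
  coefficients at a point of convergence.
\<close>

lemma has_derivative_double_series:
  fixes b :: "nat \<Rightarrow> nat \<Rightarrow> complex"
  assumes d: "d > 0"
    and G: "\<And>z. z \<in> ball 0 d \<Longrightarrow> ((\<lambda>(j, k). b j k * z ^ j * cnj z ^ k) has_sum G z) UNIV"
  obtains e where "e > 0" "e \<le> d"
    "\<And>z w. z \<in> ball 0 e \<Longrightarrow>
       ((\<lambda>(j, k). b j k * z ^ j * (of_nat k * cnj z ^ (k - 1))) has_sum w) UNIV \<Longrightarrow>
       \<exists>A. (G has_derivative (\<lambda>h. A * h + w * cnj h)) (at z)"
proof -
  define R where "R = d / 2"
  define \<rho> where "\<rho> = R / 2"
  have R: "R > 0" "R < d" "\<rho> > 0" "\<rho> < d" "\<rho> = R / 2" using d by (auto simp: R_def \<rho>_def)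
  define J where "J n = fst (prod_decode n)" for n
  define K where "K n = snd (prod_decode n)" for n
  define c where "c n = b (J n) (K n)" for n
  define f where "f n z = c n * z ^ J n * cnj z ^ K n" for n z
  have fG: "((\<lambda>n. f n z) has_sum G z) UNIV" if "z \<in> ball 0 d" for z
    using G[OF that] has_sum_prod_decode[of "\<lambda>(j, k). b j k * z ^ j * cnj z ^ k" "G z"]
    by (simp add: f_def c_def J_def K_def case_prod_beta)
  have "(\<lambda>n. f n (of_real R)) summable_on UNIV"
    by (rule has_sum_imp_summable[OF fG]) (use R in auto)
  then have "(\<lambda>n. cmod (f n (of_real R))) summable_on UNIV"
    by (rule summable_on_iff_abs_summable_on_complex[THEN iffD1])
  then have "summable (\<lambda>n. cmod (f n (of_real R)))"
    using summable_on_imp_summable by blast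
  then have sR: "summable (\<lambda>n. cmod (c n) * R ^ (J n + K n))"
    using R by (simp add: f_def norm_mult norm_power power_add mult.assoc)
  define M where "M n = (2 / R) * (cmod (c n) * R ^ (J n + K n))" for n
  have M: "summable M" unfolding M_def using sR by (rule summable_mult)
  define p where "p n z = c n * (of_nat (J n) * z ^ (J n - 1)) * cnj z ^ K n" for n z
  define q where "q n z = c n * z ^ J n * (of_nat (K n) * cnj z ^ (K n - 1))" for n z
  \<comment> \<open>halving the radius absorbs the factor \<open>i\<close> that differentiation produces\<close>
  have key: "of_nat i * \<rho> ^ (i - 1) * \<rho> ^ l \<le> (2 / R) * R ^ (i + l)" for i l :: nat
  proof (cases i)
    case 0
    then show ?thesis using R by simp
  next
    case (Suc i')
    have "real i \<le> 2 ^ i" using of_nat_less_two_power[of i] by (simp add: less_imp_le)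
    then have "of_nat i * \<rho> ^ (i - 1) * \<rho> ^ l \<le> 2 ^ i * \<rho> ^ (i - 1) * R ^ l"
      using R by (intro mult_mono power_mono) auto
    also have "\<dots> = (2 / R) * R ^ (i + l)"
    proof -
      have "R ^ i' = 2 ^ i' * \<rho> ^ i'" 
      proof -
        have "R = 2 * \<rho>" using R(5) by simp
        then show ?thesis by (simp only: power_mult_distrib)
      qed
      then have "2 ^ i * \<rho> ^ (i - 1) * R ^ l = 2 * R ^ i' * R ^ l" by (simp add: Suc)
      also have "\<dots> = (2 / R) * R ^ (i + l)" using R by (simp add: Suc power_add)
      finally show ?thesis .
    qed
    finally show ?thesis .
  qed
  have zpow: "cmod z ^ i \<le> \<rho> ^ i" if "z \<in> ball 0 \<rho>" for z i
    using that by (intro power_mono) auto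
  have pM: "cmod (p n z) \<le> M n" and qM: "cmod (q n z) \<le> M n" if "z \<in> ball 0 \<rho>" for n z
  proof -
    have "cmod (p n z) = cmod (c n) * (of_nat (J n) * cmod z ^ (J n - 1) * cmod z ^ K n)"
      by (simp add: p_def norm_mult norm_power)
    also have "\<dots> \<le> cmod (c n) * (of_nat (J n) * \<rho> ^ (J n - 1) * \<rho> ^ K n)"
      using R by (intro mult_left_mono mult_mono zpow that) auto
    also have "\<dots> \<le> cmod (c n) * ((2 / R) * R ^ (J n + K n))"
      by (intro mult_left_mono key) auto
    finally show "cmod (p n z) \<le> M n" by (simp add: M_def mult_ac)
    have "cmod (q n z) = cmod (c n) * (of_nat (K n) * cmod z ^ (K n - 1) * cmod z ^ J n)"
      by (simp add: q_def norm_mult norm_power)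
    also have "\<dots> \<le> cmod (c n) * (of_nat (K n) * \<rho> ^ (K n - 1) * \<rho> ^ J n)"
      using R by (intro mult_left_mono mult_mono zpow that) auto
    also have "\<dots> \<le> cmod (c n) * ((2 / R) * R ^ (K n + J n))"
      by (intro mult_left_mono key) auto
    finally show "cmod (q n z) \<le> M n" by (simp add: M_def mult_ac add.commute)
  qed
  have up: "uniform_limit (ball 0 \<rho>) (\<lambda>n z. \<Sum>i<n. p i z) (\<lambda>z. \<Sum>i. p i z) sequentially"
    by (rule Weierstrass_m_test[OF pM M])
  have uq: "uniform_limit (ball 0 \<rho>) (\<lambda>n z. \<Sum>i<n. q i z) (\<lambda>z. \<Sum>i. q i z) sequentially"
    by (rule Weierstrass_m_test[OF qM M])
  define D where "D z h = (\<Sum>i. p i z) * h + (\<Sum>i. q i z) * cnj h" for z h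
  have der_f: "(f n has_derivative (\<lambda>h. p n z * h + q n z * cnj h)) (at z within ball 0 \<rho>)" for n z
  proof -
    have "((\<lambda>z. z ^ i) has_derivative (\<lambda>h. of_nat i * z ^ (i - 1) * h)) (at z within ball 0 \<rho>)" for i
      using has_derivative_power[OF has_derivative_ident, where n = i] by (simp add: mult_ac)
    moreover have "((\<lambda>z. cnj z ^ i) has_derivative (\<lambda>h. of_nat i * cnj z ^ (i - 1) * cnj h)) (at z within ball 0 \<rho>)" for i
      using has_derivative_cnj[OF has_derivative_power[OF has_derivative_ident, where n = i]]
      by (simp add: mult_ac)
    ultimately show ?thesis
      unfolding f_def p_def q_def
      by (auto intro!: derivative_eq_intros simp: algebra_simps)
  qed
  have lim: "\<forall>\<^sub>F n in sequentially. \<forall>z\<in>ball 0 \<rho>. \<forall>h.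
      cmod ((\<Sum>i<n. p i z * h + q i z * cnj h) - D z h) \<le> e * cmod h" if "e > 0" for e
  proof -
    have "\<forall>\<^sub>F n in sequentially. \<forall>z\<in>ball 0 \<rho>. dist (\<Sum>i<n. p i z) (\<Sum>i. p i z) < e / 2"
      "\<forall>\<^sub>F n in sequentially. \<forall>z\<in>ball 0 \<rho>. dist (\<Sum>i<n. q i z) (\<Sum>i. q i z) < e / 2"
      using up uq that unfolding uniform_limit_iff by (meson half_gt_zero)+
    then show ?thesis
    proof eventually_elim
      case (elim n)
      show ?case
      proof (intro ballI allI)
        fix z h assume z: "z \<in> ball (0::complex) \<rho>"
        have "(\<Sum>i<n. p i z * h + q i z * cnj h) - D z h
            = ((\<Sum>i<n. p i z) - (\<Sum>i. p i z)) * h + ((\<Sum>i<n. q i z) - (\<Sum>i. q i z)) * cnj h"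
          by (simp add: D_def sum.distrib sum_distrib_right[symmetric], simp add: algebra_simps)
        also have "cmod \<dots> \<le> e / 2 * cmod h + e / 2 * cmod h"
        proof (rule order.trans[OF norm_triangle_ineq], rule add_mono)
          have "cmod ((\<Sum>i<n. p i z) - (\<Sum>i. p i z)) \<le> e / 2" "cmod ((\<Sum>i<n. q i z) - (\<Sum>i. q i z)) \<le> e / 2"
            using elim z unfolding dist_norm by (blast intro: less_imp_le)+
          then show "cmod (((\<Sum>i<n. p i z) - (\<Sum>i. p i z)) * h) \<le> e / 2 * cmod h"
            "cmod (((\<Sum>i<n. q i z) - (\<Sum>i. q i z)) * cnj h) \<le> e / 2 * cmod h"
            unfolding norm_mult complex_mod_cnj by (metis mult_right_mono norm_ge_zero)+
        qed
        finally show "cmod ((\<Sum>i<n. p i z * h + q i z * cnj h) - D z h) \<le> e * cmod h" by simp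
      qed
    qed
  qed
  have "0 \<in> ball (0::complex) \<rho>" "(0::complex) \<in> ball 0 d" using R d by auto
  then obtain g where g: "\<And>z. z \<in> ball 0 \<rho> \<Longrightarrow> (\<lambda>n. f n z) sums g z"
      "\<And>z. z \<in> ball 0 \<rho> \<Longrightarrow> (g has_derivative D z) (at z within ball 0 \<rho>)"
    using has_derivative_series[OF convex_ball der_f lim, of 0 "G 0"] fG[of 0] has_sum_imp_sums by blast
  have gG: "g z = G z" if "z \<in> ball 0 \<rho>" for z
    using g(1)[OF that] has_sum_imp_sums[OF fG[of z]] that R sums_unique2 by fastforce
  have "\<exists>A. (G has_derivative (\<lambda>h. A * h + w * cnj h)) (at z)"
    if z: "z \<in> ball 0 \<rho>" and w: "((\<lambda>(j, k). b j k * z ^ j * (of_nat k * cnj z ^ (k - 1))) has_sum w) UNIV" for z w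
  proof -
    have "((\<lambda>n. q n z) has_sum w) UNIV"
      using w has_sum_prod_decode[of "\<lambda>(j, k). b j k * z ^ j * (of_nat k * cnj z ^ (k - 1))" w]
      by (simp add: q_def c_def J_def K_def case_prod_beta)
    then have "(\<Sum>n. q n z) = w" using has_sum_imp_sums sums_unique by blast
    then have "D z = (\<lambda>h. (\<Sum>i. p i z) * h + w * cnj h)" by (simp add: D_def fun_eq_iff)
    moreover have "(g has_derivative D z) (at z)"
      using g(2)[OF z] at_within_open[OF z open_ball] by simp
    then have "(G has_derivative D z) (at z)"
      by (rule has_derivative_transform_within_open[OF _ open_ball z gG])
    ultimately show ?thesis by auto
  qed
  with R show ?thesis by (intro that[of \<rho>]) auto
qed

lemma eventually_nhds_0_ball:
  "(\<forall>\<^sub>F z in nhds (0::'a::real_normed_vector). P z) \<longleftrightarrow> (\<exists>e>0. \<forall>z\<in>ball 0 e. P z)"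
  by (simp add: eventually_nhds_metric Ball_def dist_commute)

lemma zbar_integral_derivative:
  assumes "zbar_integral g G"
  shows "\<forall>\<^sub>F z in nhds 0. G differentiable (at z) \<and> wbar G z = g z"
proof -
  obtain a d where d: "d > 0"
    and g: "\<And>z. z \<in> ball 0 d \<Longrightarrow> ((\<lambda>(j, k). a j k * z ^ j * cnj z ^ k) has_sum g z) UNIV"
    and G: "\<And>z. z \<in> ball 0 d \<Longrightarrow> ((\<lambda>(j, k). a j k / of_nat (k + 1) * z ^ j * cnj z ^ (k + 1)) has_sum G z) UNIV"
    using assms unfolding zbar_integral_def eventually_nhds_0_ball by blast
  \<comment> \<open>the coefficients of the integral, whose terms start at \<open>k = 1\<close>\<close>
  define b where "b j k = (if k = 0 then 0 else a j (k - 1) / of_nat k)" for j k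
  let ?s = "\<lambda>(j, k). (j, Suc k)"
  have inj: "inj ?s" by (auto simp: inj_on_def)
  have ran: "x \<in> range ?s" if "snd x \<noteq> 0" for x :: "nat \<times> nat"
    using that by (cases x; cases "snd x") (auto intro!: image_eqI[of _ _ "(fst x, snd x - 1)"])
  have shift: "(f has_sum s) UNIV" if "((f \<circ> ?s) has_sum s) UNIV" "\<And>j. f (j, 0) = 0"
    for f :: "nat \<times> nat \<Rightarrow> complex" and s
  proof -
    have "(f has_sum s) (range ?s)" using that(1) has_sum_reindex[OF inj] by blast
    moreover have "f x = 0" if "x \<notin> range ?s" for x
      using ran[of x] that \<open>\<And>j. f (j, 0) = 0\<close> by (cases x) auto
    ultimately show ?thesis
      using has_sum_cong_neutral[of UNIV "range ?s" f f s] by auto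
  qed
  have bG: "((\<lambda>(j, k). b j k * z ^ j * cnj z ^ k) has_sum G z) UNIV" if "z \<in> ball 0 d" for z
  proof (rule shift)
    have "(\<lambda>(j, k). b j k * z ^ j * cnj z ^ k) \<circ> ?s = (\<lambda>(j, k). a j k / of_nat (k + 1) * z ^ j * cnj z ^ (k + 1))"
      by (auto simp: b_def fun_eq_iff)
    then show "((\<lambda>(j, k). b j k * z ^ j * cnj z ^ k) \<circ> ?s has_sum G z) UNIV"
      using G[OF that] by simp
  qed (auto simp: b_def)
  have bg: "((\<lambda>(j, k). b j k * z ^ j * (of_nat k * cnj z ^ (k - 1))) has_sum g z) UNIV" if "z \<in> ball 0 d" for z
  proof (rule shift)
    have "(\<lambda>(j, k). b j k * z ^ j * (of_nat k * cnj z ^ (k - 1))) \<circ> ?s = (\<lambda>(j, k). a j k * z ^ j * cnj z ^ k)"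
      by (auto simp: b_def fun_eq_iff field_simps simp del: of_nat_Suc)
    then show "((\<lambda>(j, k). b j k * z ^ j * (of_nat k * cnj z ^ (k - 1))) \<circ> ?s has_sum g z) UNIV"
      using g[OF that] by simp
  qed auto
  obtain e where e: "e > 0" "e \<le> d"
    and e': "\<And>z w. z \<in> ball 0 e \<Longrightarrow>
       ((\<lambda>(j, k). b j k * z ^ j * (of_nat k * cnj z ^ (k - 1))) has_sum w) UNIV \<Longrightarrow>
       \<exists>A. (G has_derivative (\<lambda>h. A * h + w * cnj h)) (at z)"
    using has_derivative_double_series[OF d bG] by blast
  have A: "\<exists>A. (G has_derivative (\<lambda>h. A * h + g z * cnj h)) (at z)" if "z \<in> ball 0 e" for z
    by (rule e'[OF that bg]) (use that e(2) in auto)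
  have "G differentiable (at z) \<and> wbar G z = g z" if "z \<in> ball 0 e" for z
    using A[OF that] by (elim exE) (auto dest: wbar_eqI intro: differentiableI)
  with e(1) show ?thesis unfolding eventually_nhds_0_ball by blast
qed

text \<open>
  Conjugation exchanges the two kinds of integrals.
\<close>

lemma z_integral_derivative:
  assumes "z_integral g G"
  shows "\<forall>\<^sub>F z in nhds 0. G differentiable (at z) \<and> wz G z = g z"
proof -
  have "zbar_integral (\<lambda>z. cnj (g z)) (\<lambda>z. cnj (G z))"
  proof -
    have *: "((\<lambda>(j, k). cnj (f k j)) has_sum cnj s) UNIV"
      if "((\<lambda>(j, k). f j k) has_sum s) UNIV" for f :: "nat \<Rightarrow> nat \<Rightarrow> complex" and s
    proof -
      have "((\<lambda>(j, k). f k j) has_sum s) UNIV"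
        using that has_sum_reindex_bij_betw[OF bij_swap, of "\<lambda>(j, k). f j k" s]
        by (simp add: case_prod_unfold prod.swap_def)
      then have "((\<lambda>x. cnj ((\<lambda>(j, k). f k j) x)) has_sum cnj s) UNIV"
        by (rule has_sum_cnj_iff[THEN iffD2])
      then show ?thesis by (simp add: case_prod_unfold)
    qed
    obtain a where a: "\<forall>\<^sub>F z in nhds 0.
        ((\<lambda>(j, k). a j k * z ^ j * cnj z ^ k) has_sum g z) UNIV \<and>
        ((\<lambda>(j, k). a j k / of_nat (j + 1) * z ^ (j + 1) * cnj z ^ k) has_sum G z) UNIV"
      using assms unfolding z_integral_def by (rule exE)
    show ?thesis
      unfolding zbar_integral_def
    proof (rule exI[of _ "\<lambda>j k. cnj (a k j)"], rule eventually_mono[OF a], elim conjE, rule conjI)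
      fix z
      assume "((\<lambda>(j, k). a j k * z ^ j * cnj z ^ k) has_sum g z) UNIV"
      from *[OF this] show "((\<lambda>(j, k). cnj (a k j) * z ^ j * cnj z ^ k) has_sum cnj (g z)) UNIV"
        by (simp add: mult_ac)
      assume "((\<lambda>(j, k). a j k / of_nat (j + 1) * z ^ (j + 1) * cnj z ^ k) has_sum G z) UNIV"
      from *[OF this] show "((\<lambda>(j, k). cnj (a k j) / of_nat (k + 1) * z ^ j * cnj z ^ (k + 1)) has_sum cnj (G z)) UNIV"
        by (simp add: mult_ac)
    qed
  qed
  from zbar_integral_derivative[OF this] show ?thesis
  proof eventually_elim
    case (elim z)
    from has_derivative_cnj[OF has_derivative_wz_wbar[of "\<lambda>z. cnj (G z)" z]] elim
    have "(G has_derivative (\<lambda>h. g z * h + cnj (wz (\<lambda>z. cnj (G z)) z) * cnj h)) (at z)"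
      by (simp add: add.commute)
    then show ?case by (auto dest: wz_eqI intro: differentiableI)
  qed
qed

section \<open>Computing with Wirtinger derivatives\<close>

lemma differentiable_cnj: "f differentiable (at p) \<Longrightarrow> (\<lambda>p. cnj (f p)) differentiable (at p)"
  unfolding differentiable_def using has_derivative_cnj by blast

lemma differentiable_nth: "(\<lambda>p :: complex^'n. p $ j) differentiable (at p)"
  by (rule differentiableI) (rule bounded_linear_imp_has_derivative[OF bounded_linear_vec_nth])

lemmas wirtinger_simps = pd_add pdbar_add pd_diff pdbar_diff pd_mult pdbar_mult pd_divide pdbar_divide
  pd_cnj pdbar_cnj pd_uminus pdbar_uminus pd_power2 pdbar_power2 pd_nth
  differentiable_cnj differentiable_nth

section \<open>The normal form has the required properties\<close>

text \<open>
  The equation for \<open>R\<^sup>2\<close> avoids the absolute value in \<open>R = 2 |\<rho>'| / (1 - |\<rho>|\<^sup>2)\<close>. It gives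
  \<open>R\<^sub>2 = R L\<close> with \<open>L = \<rho>'' / (2 \<rho>') + \<rho>' cnj \<rho> / (1 - |\<rho>|\<^sup>2)\<close>, and the first summand of \<open>L\<close> is holomorphic,
  so that \<open>L\<^bsub>2bar\<^esub> = |\<rho>'|\<^sup>2 / (1 - |\<rho>|\<^sup>2)\<^sup>2 = R\<^sup>2 / 4\<close>.
\<close>

lemma liouville_of_holomorphic:
  fixes R :: "complex^2 \<Rightarrow> complex" and \<rho> :: "complex \<Rightarrow> complex"
  assumes R: "smooth_on R (bidisc e)" and Rnz: "\<And>p. p \<in> bidisc e \<Longrightarrow> R p \<noteq> 0"
    and \<rho>: "\<rho> holomorphic_on ball 0 e"
    and d\<rho>: "\<And>z. z \<in> ball 0 e \<Longrightarrow> deriv \<rho> z \<noteq> 0" and disc: "\<And>z. z \<in> ball 0 e \<Longrightarrow> cmod (\<rho> z) < 1"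
    and eq: "\<And>p. p \<in> bidisc e \<Longrightarrow>
      (R p)\<^sup>2 * (1 - \<rho> (p $ 2) * cnj (\<rho> (p $ 2)))\<^sup>2 = 4 * deriv \<rho> (p $ 2) * cnj (deriv \<rho> (p $ 2))"
    and real: "\<And>p. p \<in> bidisc e \<Longrightarrow> cnj (R p) = R p"
    and p: "p \<in> bidisc e"
  shows "R p * pdbar 2 (pd 2 R) p = pd 2 R p * pdbar 2 R p + R p ^ 4 / 4"
proof -
  let ?\<Delta> = "bidisc e"
  have D: "open ?\<Delta>" by (rule open_bidisc)
  define \<alpha> where "\<alpha> = (\<lambda>p :: complex^2. deriv \<rho> (p $ 2))"
  define \<alpha>' where "\<alpha>' = (\<lambda>p :: complex^2. deriv (deriv \<rho>) (p $ 2))"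
  define \<alpha>'' where "\<alpha>'' = (\<lambda>p :: complex^2. deriv (deriv (deriv \<rho>)) (p $ 2))"
  define \<beta> where "\<beta> = (\<lambda>p :: complex^2. \<rho> (p $ 2))"
  define N where "N = (\<lambda>p. 1 - \<beta> p * cnj (\<beta> p))"
  have hol: "deriv \<rho> holomorphic_on ball 0 e" "deriv (deriv \<rho>) holomorphic_on ball 0 e"
    using \<rho> by (auto intro!: holomorphic_deriv)
  have b: "pd 2 \<beta> q = \<alpha> q" "pdbar 2 \<beta> q = 0" "\<beta> differentiable (at q)" if "q \<in> ?\<Delta>" for q
    using pd_coordinate_holomorphic[OF holomorphic_derivI[OF \<rho> open_ball nth_in_ball[OF that, of 2]]]
    by (auto simp: \<beta>_def \<alpha>_def)
  have a: "pd 2 \<alpha> q = \<alpha>' q" "pdbar 2 \<alpha> q = 0" "\<alpha> differentiable (at q)" if "q \<in> ?\<Delta>" for q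
    using pd_coordinate_holomorphic[OF holomorphic_derivI[OF hol(1) open_ball nth_in_ball[OF that, of 2]]]
    by (auto simp: \<alpha>'_def \<alpha>_def)
  have a': "pdbar 2 \<alpha>' q = 0" "\<alpha>' differentiable (at q)" if "q \<in> ?\<Delta>" for q
    using pd_coordinate_holomorphic[OF holomorphic_derivI[OF hol(2) open_ball nth_in_ball[OF that, of 2]]]
    by (auto simp: \<alpha>'_def)
  have \<alpha>nz: "\<alpha> q \<noteq> 0" and Nnz: "N q \<noteq> 0" if "q \<in> ?\<Delta>" for q
  proof -
    show "\<alpha> q \<noteq> 0" using d\<rho>[OF nth_in_ball[OF that, of 2]] by (simp add: \<alpha>_def)
    have "cmod (\<beta> q) < 1" using disc[OF nth_in_ball[OF that, of 2]] by (simp add: \<beta>_def)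
    then have "(cmod (\<beta> q))\<^sup>2 < 1" by (simp add: power_less_one_iff abs_square_less_1)
    moreover have "N q = of_real (1 - (cmod (\<beta> q))\<^sup>2)" by (simp only: N_def of_real_diff of_real_1 complex_norm_square)
    ultimately show "N q \<noteq> 0" by (metis of_real_eq_0_iff less_irrefl right_minus_eq)
  qed
  have Nd: "N differentiable (at q)" "pd 2 N q = - \<alpha> q * cnj (\<beta> q)" "pdbar 2 N q = - \<beta> q * cnj (\<alpha> q)"
    if "q \<in> ?\<Delta>" for q
    unfolding N_def using b[OF that] by (simp_all add: wirtinger_simps)
  have Rd: "R differentiable (at q)" if "q \<in> ?\<Delta>" for q
    using smooth_on_differentiable[OF R that] .
  define L where "L q = \<alpha>' q / (2 * \<alpha> q) + \<alpha> q * cnj (\<beta> q) / N q" for q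
  \<comment> \<open>the logarithmic derivative of \<open>R\<close>\<close>
  have R2: "pd 2 R q = R q * L q" if q: "q \<in> ?\<Delta>" for q
  proof -
    have "pd 2 (\<lambda>q. (R q)\<^sup>2 * (N q)\<^sup>2) q = pd 2 (\<lambda>q. 4 * \<alpha> q * cnj (\<alpha> q)) q"
      by (rule pd_cong[OF D q]) (simp add: eq N_def \<alpha>_def \<beta>_def)
    then have "(R q)\<^sup>2 * (2 * N q * pd 2 N q) + 2 * R q * pd 2 R q * (N q)\<^sup>2 = 4 * \<alpha>' q * cnj (\<alpha> q)"
      using Rd[OF q] Nd[OF q] a[OF q] by (simp add: wirtinger_simps)
    moreover have "4 * \<alpha>' q * cnj (\<alpha> q) = \<alpha>' q / \<alpha> q * ((R q)\<^sup>2 * (N q)\<^sup>2)"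
      using eq[OF q] \<alpha>nz[OF q] by (simp add: N_def \<alpha>_def \<beta>_def)
    ultimately have "2 * R q * (N q)\<^sup>2 * pd 2 R q = 2 * R q * (N q)\<^sup>2 * (R q * L q)"
      unfolding L_def Nd(2)[OF q] using Nnz[OF q] \<alpha>nz[OF q]
      by (simp add: field_simps power2_eq_square)
    then show ?thesis using Rnz[OF q] Nnz[OF q] by simp
  qed
  have Ld: "L differentiable (at p)"
    unfolding L_def using a'[OF p] a[OF p] b[OF p] Nd[OF p] Nnz[OF p] \<alpha>nz[OF p]
    by (intro derivative_intros differentiable_divide differentiable_cnj) auto
  have "pdbar 2 L p = \<alpha> p * (cnj (\<alpha> p) * N p + cnj (\<beta> p) * \<beta> p * cnj (\<alpha> p)) / (N p)\<^sup>2"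
    unfolding L_def using a'[OF p] a[OF p] b[OF p] Nd[OF p] Nnz[OF p] \<alpha>nz[OF p]
    by (simp add: wirtinger_simps differentiable_divide) (simp add: algebra_simps)
  also have "\<dots> = \<alpha> p * cnj (\<alpha> p) / (N p)\<^sup>2" by (simp add: N_def algebra_simps)
  also have "\<dots> = (R p)\<^sup>2 / 4" using eq[OF p] Nnz[OF p] by (simp add: N_def \<alpha>_def \<beta>_def field_simps)
  finally have L2: "pdbar 2 L p = (R p)\<^sup>2 / 4" .
  have "pdbar 2 (pd 2 R) p = pdbar 2 (\<lambda>q. R q * L q) p"
    by (rule pdbar_cong[OF D p R2])
  also have "\<dots> = R p * ((R p)\<^sup>2 / 4) + pdbar 2 R p * L p"
    using Rd[OF p] Ld by (simp add: wirtinger_simps L2)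
  finally show ?thesis using R2[OF p] by (simp add: algebra_simps power2_eq_square power4_eq_xxxx)
qed

text \<open>
  The normal form, with functions of \<open>z\<^sub>2\<close> regarded as functions on \<open>\<complex>\<^sup>2\<close>; here \<open>V\<close> and \<open>W\<close> stand for
  \<open>u\<close> and the real part of \<open>v\<close>. The mixed second derivatives of \<open>T\<close> and \<open>V\<close> come from differentiating the
  equations for \<open>T\<^bsub>2bar\<^esub>\<close> and \<open>V\<^bsub>2bar\<^esub>\<close> in \<open>z\<^sub>2\<close>.
\<close>

lemma normal_form_derivatives:
  fixes R T V W :: "complex^2 \<Rightarrow> complex" and F :: "complex^2 \<Rightarrow> real"
  assumes sm: "smooth_on R (bidisc e)" "smooth_on T (bidisc e)" "smooth_on V (bidisc e)" "smooth_on W (bidisc e)"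
    and z1: "\<And>p. p \<in> bidisc e \<Longrightarrow> pd 1 R p = 0 \<and> pdbar 1 R p = 0"
      "\<And>p. p \<in> bidisc e \<Longrightarrow> pd 1 T p = 0 \<and> pdbar 1 T p = 0"
      "\<And>p. p \<in> bidisc e \<Longrightarrow> pd 1 V p = 0 \<and> pdbar 1 V p = 0"
      "\<And>p. p \<in> bidisc e \<Longrightarrow> pd 1 W p = 0 \<and> pdbar 1 W p = 0"
    and real: "\<And>p. p \<in> bidisc e \<Longrightarrow> cnj (R p) = R p" and Rnz: "\<And>p. p \<in> bidisc e \<Longrightarrow> R p \<noteq> 0"
    and T2: "\<And>p. p \<in> bidisc e \<Longrightarrow> pdbar 2 T p = (R p)\<^sup>2 / 4"
    and V2: "\<And>p. p \<in> bidisc e \<Longrightarrow> pdbar 2 V p = R p / 2 * cnj (V p)"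
    and W2: "\<And>p. p \<in> bidisc e \<Longrightarrow> pdbar 2 (pd 2 W) p = R p / 8 * (V p * cnj (V p))"
    and L: "\<And>p. p \<in> bidisc e \<Longrightarrow> R p * pdbar 2 (pd 2 R) p = pd 2 R p * pdbar 2 R p + R p ^ 4 / 4"
    and F: "\<And>p. p \<in> bidisc e \<Longrightarrow> cplx F p = R p * (p $ 1 * cnj (p $ 1)) + (T p * (p $ 1)\<^sup>2 + cnj (T p) * (cnj (p $ 1))\<^sup>2)
       + (V p * p $ 1 + cnj (V p) * cnj (p $ 1)) + 2 * W p"
    and p: "p \<in> bidisc e"
  shows "F11 F p = R p" "S_fun F p = R p / 2" "monge_ampere_at F p"
proof -
  let ?\<Delta> = "bidisc e"
  have D: "open ?\<Delta>" by (rule open_bidisc)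
  note sm2 = smooth_on_pd[OF D sm(1)] smooth_on_pd[OF D sm(2)] smooth_on_pd[OF D sm(3)] smooth_on_pd[OF D sm(4)]
    smooth_on_pdbar[OF D sm(1)] smooth_on_pdbar[OF D sm(2)] smooth_on_pdbar[OF D sm(3)]
  note d = sm[THEN smooth_on_differentiable] sm2[THEN smooth_on_differentiable]
  have pd1: "pd 1 (cplx F) q = R q * cnj (q $ 1) + 2 * T q * q $ 1 + V q" if q: "q \<in> ?\<Delta>" for q
  proof -
    have "pd 1 (cplx F) q = pd 1 (\<lambda>p. R p * (p $ 1 * cnj (p $ 1)) + (T p * (p $ 1)\<^sup>2 + cnj (T p) * (cnj (p $ 1))\<^sup>2)
       + (V p * p $ 1 + cnj (V p) * cnj (p $ 1)) + 2 * W p) q"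
      by (rule pd_cong[OF D q F])
    then show ?thesis using z1[OF q] d[OF q] by (simp add: wirtinger_simps)
  qed
  have pd2: "pd 2 (cplx F) q = pd 2 R q * (q $ 1 * cnj (q $ 1)) + (pd 2 T q * (q $ 1)\<^sup>2 + (R q)\<^sup>2 / 4 * (cnj (q $ 1))\<^sup>2)
       + (pd 2 V q * q $ 1 + R q / 2 * V q * cnj (q $ 1)) + 2 * pd 2 W q" if q: "q \<in> ?\<Delta>" for q
  proof -
    have "pd 2 (cplx F) q = pd 2 (\<lambda>p. R p * (p $ 1 * cnj (p $ 1)) + (T p * (p $ 1)\<^sup>2 + cnj (T p) * (cnj (p $ 1))\<^sup>2)
       + (V p * p $ 1 + cnj (V p) * cnj (p $ 1)) + 2 * W p) q"
      by (rule pd_cong[OF D q F])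
    then show ?thesis using d[OF q] real[OF q] by (simp add: wirtinger_simps T2[OF q] V2[OF q])
  qed
  have F11: "F11 F q = R q" if q: "q \<in> ?\<Delta>" for q
  proof -
    have "F11 F q = pdbar 1 (\<lambda>q. R q * cnj (q $ 1) + 2 * T q * q $ 1 + V q) q"
      unfolding F11_F12_cplx by (rule pdbar_cong[OF D q pd1])
    then show ?thesis using z1[OF q] d[OF q] by (simp add: wirtinger_simps)
  qed
  have F12: "F12 F q = pdbar 2 R q * cnj (q $ 1) + (R q)\<^sup>2 / 2 * q $ 1 + R q / 2 * cnj (V q)" if q: "q \<in> ?\<Delta>" for q
  proof -
    have "F12 F q = pdbar 2 (\<lambda>q. R q * cnj (q $ 1) + 2 * T q * q $ 1 + V q) q"
      unfolding F11_F12_cplx by (rule pdbar_cong[OF D q pd1])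
    then show ?thesis using d[OF q] by (simp add: wirtinger_simps T2[OF q] V2[OF q])
  qed
  show "F11 F p = R p" by (rule F11[OF p])
  show "S_fun F p = R p / 2"
  proof -
    have "S_fun F p = pd 1 (\<lambda>q. (pdbar 2 R q * cnj (q $ 1) + (R q)\<^sup>2 / 2 * q $ 1 + R q / 2 * cnj (V q)) / R q) p"
      unfolding S_fun_def by (rule pd_cong[OF D p]) (simp add: F11 F12)
    moreover have "pd 1 (pdbar 2 R) p = 0"
    proof -
      have "pd 1 (pdbar 2 R) p = pdbar 2 (pd 1 R) p" using wirtinger_commute(2)[OF D p sm(1)] by simp
      also have "\<dots> = pdbar 2 (\<lambda>_. 0) p" by (rule pdbar_cong[OF D p]) (simp add: z1)
      finally show ?thesis by simp
    qed
    ultimately show ?thesis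
      using z1[OF p] d[OF p] Rnz[OF p] by (simp add: wirtinger_simps power2_eq_square)
  qed
  have T22: "pdbar 2 (pd 2 T) p = R p * pd 2 R p / 2"
  proof -
    have "pdbar 2 (pd 2 T) p = pd 2 (\<lambda>q. (R q)\<^sup>2 / 4) p"
      unfolding wirtinger_commute(2)[OF D p sm(2)] by (rule pd_cong[OF D p T2])
    then show ?thesis using d[OF p] by (simp add: wirtinger_simps)
  qed
  have V22: "pdbar 2 (pd 2 V) p = pd 2 R p / 2 * cnj (V p) + (R p)\<^sup>2 / 4 * V p"
  proof -
    have "pdbar 2 (pd 2 V) p = pd 2 (\<lambda>q. R q / 2 * cnj (V q)) p"
      unfolding wirtinger_commute(2)[OF D p sm(3)] by (rule pd_cong[OF D p V2])
    then show ?thesis using d[OF p] real[OF p] by (simp add: wirtinger_simps V2[OF p] power2_eq_square) (simp add: field_simps)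
  qed
  have F22: "F22 F p = pdbar 2 (pd 2 R) p * (p $ 1 * cnj (p $ 1)) + (R p * pd 2 R p / 2 * (p $ 1)\<^sup>2 + R p * pdbar 2 R p / 2 * (cnj (p $ 1))\<^sup>2)
       + ((pd 2 R p / 2 * cnj (V p) + (R p)\<^sup>2 / 4 * V p) * p $ 1
          + (pdbar 2 R p / 2 * V p + (R p)\<^sup>2 / 4 * cnj (V p)) * cnj (p $ 1)) + R p / 4 * (V p * cnj (V p))"
  proof -
    have "F22 F p = pdbar 2 (\<lambda>q. pd 2 R q * (q $ 1 * cnj (q $ 1)) + (pd 2 T q * (q $ 1)\<^sup>2 + (R q)\<^sup>2 / 4 * (cnj (q $ 1))\<^sup>2)
       + (pd 2 V q * q $ 1 + R q / 2 * V q * cnj (q $ 1)) + 2 * pd 2 W q) p"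
      unfolding F22_def by (rule pdbar_cong[OF D p pd2])
    then show ?thesis using d[OF p]
      by (simp add: wirtinger_simps T22 V22 V2[OF p] W2[OF p]) (simp add: field_simps power2_eq_square)
  qed
  have cR: "cnj (pdbar 2 R p) = pd 2 R p"
  proof -
    have "cnj (pdbar 2 R p) = pd 2 (\<lambda>p. cnj (R p)) p" using d[OF p] by (simp add: pd_cnj)
    also have "\<dots> = pd 2 R p" by (rule pd_cong[OF D p real])
    finally show ?thesis .
  qed
  \<comment> \<open>the Liouville equation, in a form that rewrites products\<close>
  have R22: "R p * (pdbar 2 (pd 2 R) p * X) = (pd 2 R p * pdbar 2 R p + R p ^ 4 / 4) * X" for X
    using L[OF p] by (simp add: mult.assoc[symmetric])
  show "monge_ampere_at F p"
    unfolding monge_ampere_at_def F11[OF p] F12[OF p] F22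
    by (simp add: cR real[OF p] distrib_left R22) (simp add: field_simps power2_eq_square power4_eq_xxxx)
qed

lemma coordinate_first_derivatives_zero:
  fixes g :: "complex \<Rightarrow> complex"
  assumes "smooth_on g (ball 0 e)" "p \<in> bidisc e"
  shows "pd 1 (\<lambda>p. g (p $ 2)) p = 0 \<and> pdbar 1 (\<lambda>p. g (p $ 2)) p = 0"
  using pd_coordinate[OF smooth_on_differentiable[OF assms(1) nth_in_ball[OF assms(2), of 2]], of 1] by simp

lemma smooth_near_0_ball:
  assumes "smooth_near_0 f" shows "\<exists>e>0. smooth_on f (ball 0 e)"
  using assms unfolding smooth_near_0_def by (meson open_contains_ball_eq smooth_on_subset)

lemma smooth_near_0_bidisc:
  fixes f :: "complex^2 \<Rightarrow> 'b::real_normed_vector"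
  assumes "smooth_near_0 f" shows "\<exists>e>0. smooth_on f (bidisc e)"
proof -
  obtain U where U: "open U" "0 \<in> U" "smooth_on f U" using assms by (auto simp: smooth_near_0_def)
  then have "\<forall>\<^sub>F p in nhds 0. p \<in> U" by (simp add: eventually_nhds_in_open)
  then obtain e where "e > 0" "bidisc e \<subseteq> U" unfolding eventually_nhds_0_bidisc by blast
  with U(3) show ?thesis using smooth_on_subset by blast
qed

text \<open>
  It is a graph over a convex set.
\<close>

lemma connected_rigid_hypersurface:
  assumes "smooth_on F (bidisc e)"
  shows "connected {p \<in> rigid_hypersurface F. proj12 p \<in> bidisc e}"
proof -
  define \<Phi> :: "(complex^2) \<times> real \<Rightarrow> complex^3" where
    "\<Phi> x = axis 1 (fst x $ 1) + axis 2 (fst x $ 2) + axis 3 (Complex (F (fst x)) (snd x))" for x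
  have "{p \<in> rigid_hypersurface F. proj12 p \<in> bidisc e} = \<Phi> ` (bidisc e \<times> UNIV)"
  proof (intro set_eqI iffI)
    fix p assume p: "p \<in> {p \<in> rigid_hypersurface F. proj12 p \<in> bidisc e}"
    then have "Complex (F (proj12 p)) (Im (p $ 3)) = p $ 3"
      by (simp add: rigid_hypersurface_def complex_eq_iff)
    then have "p = \<Phi> (proj12 p, Im (p $ 3))"
      by (simp add: \<Phi>_def vec_eq_iff forall_3 axis_def)
    then show "p \<in> \<Phi> ` (bidisc e \<times> UNIV)" using p by blast
  next
    fix p assume "p \<in> \<Phi> ` (bidisc e \<times> UNIV)"
    then obtain q t where q: "q \<in> bidisc e" "p = \<Phi> (q, t)" by auto
    then have "proj12 p = q" by (simp add: \<Phi>_def vec_eq_iff forall_2 axis_def)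
    then show "p \<in> {p \<in> rigid_hypersurface F. proj12 p \<in> bidisc e}"
      using q by (simp add: rigid_hypersurface_def \<Phi>_def axis_def)
  qed
  moreover have "continuous_on (bidisc e \<times> UNIV) \<Phi>"
  proof -
    have c: "continuous_on (bidisc e \<times> UNIV) (\<lambda>x. F (fst x))"
      by (rule continuous_on_compose2[OF smooth_on_continuous[OF assms]]) (auto intro: continuous_intros)
    show ?thesis
      unfolding \<Phi>_def Complex_eq
      by (intro continuous_intros c bounded_linear.continuous_on[OF bounded_linear_axis])
  qed
  moreover have "connected (bidisc e \<times> (UNIV :: real set))"
    by (intro connected_Times convex_connected convex_bidisc convex_UNIV)
  ultimately show ?thesis by (metis connected_continuous_image)
qed

lemma normal_form_properties:
  fixes F :: "complex^2 \<Rightarrow> real"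
  assumes gg: "graphing_germ F" and nf: "normal_form F"
  shows "class_C21 F" "S_conditions F" "F11_only_z2 F" "F11_positive F"
proof -
  obtain r :: "complex \<Rightarrow> real" and t u v :: "complex \<Rightarrow> complex" where
    nf': "smooth_near_0 r \<and> smooth_near_0 t \<and> smooth_near_0 u \<and> smooth_near_0 v \<and>
        (\<forall>\<^sub>F p in nhds 0. complex_of_real (F p) = of_real (r (p $ 2)) * of_real ((cmod (p $ 1))\<^sup>2)
          + (t (p $ 2) * (p $ 1)\<^sup>2 + u (p $ 2) * p $ 1 + v (p $ 2))
          + cnj (t (p $ 2) * (p $ 1)\<^sup>2 + u (p $ 2) * p $ 1 + v (p $ 2))) \<and>
        r_condition r \<and>
        zbar_integral (\<lambda>z. of_real ((r z)\<^sup>2 / 4)) t \<and>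
        (\<forall>\<^sub>F z in nhds 0. wbar u z = of_real (r z / 2) * cnj (u z)) \<and>
        (\<exists>G. zbar_integral (\<lambda>z. of_real (r z / 8 * (cmod (u z))\<^sup>2)) G \<and>
             z_integral G (\<lambda>z. of_real (Re (v z))))"
    using nf unfolding normal_form_def Let_def by (elim exE) (erule that)
  from nf' obtain G where G: "zbar_integral (\<lambda>z. of_real (r z / 8 * (cmod (u z))\<^sup>2)) G"
    and v: "z_integral G (\<lambda>z. of_real (Re (v z)))"
    by (elim conjE exE)
  from nf' have sm: "smooth_near_0 r" "smooth_near_0 t" "smooth_near_0 u" "smooth_near_0 v"
    and F: "\<forall>\<^sub>F p in nhds 0. complex_of_real (F p) = of_real (r (p $ 2)) * of_real ((cmod (p $ 1))\<^sup>2)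
          + (t (p $ 2) * (p $ 1)\<^sup>2 + u (p $ 2) * p $ 1 + v (p $ 2))
          + cnj (t (p $ 2) * (p $ 1)\<^sup>2 + u (p $ 2) * p $ 1 + v (p $ 2))"
    and r: "r_condition r" and t: "zbar_integral (\<lambda>z. of_real ((r z)\<^sup>2 / 4)) t"
    and u: "\<forall>\<^sub>F z in nhds 0. wbar u z = of_real (r z / 2) * cnj (u z)"
    by - (elim conjE, assumption)+
  obtain \<rho> e0 where e0: "e0 > 0" "\<rho> holomorphic_on ball 0 e0"
    and \<rho>: "\<And>z. z \<in> ball 0 e0 \<Longrightarrow> deriv \<rho> z \<noteq> 0 \<and> cmod (\<rho> z) < 1 \<and>
           r z = 2 * cmod (deriv \<rho> z) / (1 - (cmod (\<rho> z))\<^sup>2)"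
    using r unfolding r_condition_def by metis
  obtain e1 e2 e3 e4 where e14: "e1 > 0" "smooth_on r (ball 0 e1)" "e2 > 0" "smooth_on t (ball 0 e2)"
      "e3 > 0" "smooth_on u (ball 0 e3)" "e4 > 0" "smooth_on v (ball 0 e4)"
    using sm[THEN smooth_near_0_ball] by metis
  obtain e5 where e5: "e5 > 0" "smooth_on F (bidisc e5)"
    using gg smooth_near_0_bidisc unfolding graphing_germ_def by metis
  obtain e6 where e6: "e6 > 0" "\<And>p. p \<in> bidisc e6 \<Longrightarrow> complex_of_real (F p) = of_real (r (p $ 2)) * of_real ((cmod (p $ 1))\<^sup>2)
          + (t (p $ 2) * (p $ 1)\<^sup>2 + u (p $ 2) * p $ 1 + v (p $ 2))
          + cnj (t (p $ 2) * (p $ 1)\<^sup>2 + u (p $ 2) * p $ 1 + v (p $ 2))"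
    using F[unfolded eventually_nhds_0_bidisc] by (elim exE conjE) (erule that, erule (1) bspec)
  obtain e7 where e7: "e7 > 0"
    "\<And>z. z \<in> ball 0 e7 \<Longrightarrow> (t differentiable (at z) \<and> wbar t z = of_real ((r z)\<^sup>2 / 4)) \<and>
       wbar u z = of_real (r z / 2) * cnj (u z) \<and>
       (G differentiable (at z) \<and> wbar G z = of_real (r z / 8 * (cmod (u z))\<^sup>2)) \<and>
       ((\<lambda>z. complex_of_real (Re (v z))) differentiable (at z) \<and> wz (\<lambda>z. complex_of_real (Re (v z))) z = G z)"
    using eventually_conj[OF zbar_integral_derivative[OF t] eventually_conj[OF u
        eventually_conj[OF zbar_integral_derivative[OF G] z_integral_derivative[OF v]]],
        unfolded eventually_nhds_0_ball]
    by (elim exE conjE) (erule that, erule (1) bspec)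
  define e where "e = Min {e0, e1, e2, e3, e4, e5, e6, e7}"
  have e: "e > 0" and ele: "e \<le> e0" "e \<le> e1" "e \<le> e2" "e \<le> e3" "e \<le> e4" "e \<le> e5" "e \<le> e6" "e \<le> e7"
    using e0 e14 e5 e6 e7 unfolding e_def by (simp_all del: Min_insert)
  have ball: "z \<in> ball 0 e'" if "z \<in> ball 0 e" "e \<le> e'" for z :: complex and e'
    using that by auto
  have bi: "p \<in> bidisc e'" if "p \<in> bidisc e" "e \<le> e'" for p e'
    using that bidisc_mono by blast
  have s1: "smooth_on (\<lambda>z. complex_of_real (r z)) (ball 0 e)"
    by (rule smooth_on_of_real[OF open_ball smooth_on_subset[OF e14(2)]]) (use ele in auto)
  have s2: "smooth_on t (ball 0 e)" by (rule smooth_on_subset[OF e14(4)]) (use ele in auto)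
  have s3: "smooth_on u (ball 0 e)" by (rule smooth_on_subset[OF e14(6)]) (use ele in auto)
  have s4: "smooth_on (\<lambda>z. complex_of_real (Re (v z))) (ball 0 e)"
    by (intro smooth_intros open_ball smooth_on_subset[OF e14(8)]) (use ele in auto)
  have sF: "smooth_on F (bidisc e)" by (rule smooth_on_subset[OF e5(2) bidisc_mono]) (rule ele)
  define R where "R = (\<lambda>p :: complex^2. complex_of_real (r (p $ 2)))"
  define T where "T = (\<lambda>p :: complex^2. t (p $ 2))"
  define V where "V = (\<lambda>p :: complex^2. u (p $ 2))"
  define W where "W = (\<lambda>p :: complex^2. complex_of_real (Re (v (p $ 2))))"
  have sm2: "smooth_on R (bidisc e)" "smooth_on T (bidisc e)" "smooth_on V (bidisc e)" "smooth_on W (bidisc e)"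
    unfolding R_def T_def V_def W_def
    by (rule smooth_on_coordinate[OF s1] smooth_on_coordinate[OF s2] smooth_on_coordinate[OF s3]
        smooth_on_coordinate[OF s4])+
  have z1: "pd 1 R p = 0 \<and> pdbar 1 R p = 0" "pd 1 T p = 0 \<and> pdbar 1 T p = 0"
      "pd 1 V p = 0 \<and> pdbar 1 V p = 0" "pd 1 W p = 0 \<and> pdbar 1 W p = 0" if "p \<in> bidisc e" for p
    unfolding R_def T_def V_def W_def
    by (rule coordinate_first_derivatives_zero[OF s1 that] coordinate_first_derivatives_zero[OF s2 that]
        coordinate_first_derivatives_zero[OF s3 that] coordinate_first_derivatives_zero[OF s4 that])+
  have real: "cnj (R p) = R p" for p by (simp add: R_def)
  have rpos: "r z > 0" if "z \<in> ball 0 e" for z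
  proof -
    have *: "deriv \<rho> z \<noteq> 0" "cmod (\<rho> z) < 1" "r z = 2 * cmod (deriv \<rho> z) / (1 - (cmod (\<rho> z))\<^sup>2)"
      using \<rho>[OF ball[OF that ele(1)]] by auto
    then have "(cmod (\<rho> z))\<^sup>2 < 1" by (simp add: power_less_one_iff abs_square_less_1)
    then show ?thesis using * by simp
  qed
  have Rpos: "r (p $ 2) > 0" if "p \<in> bidisc e" for p
    using rpos[OF nth_in_ball[OF that, of 2]] .
  have Rnz: "R p \<noteq> 0" if "p \<in> bidisc e" for p
    using Rpos[OF that] by (simp add: R_def)
  have e7': "t differentiable (at (p $ 2))" "wbar t (p $ 2) = of_real ((r (p $ 2))\<^sup>2 / 4)"
      "wbar u (p $ 2) = of_real (r (p $ 2) / 2) * cnj (u (p $ 2))"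
      "G differentiable (at (p $ 2))" "wbar G (p $ 2) = of_real (r (p $ 2) / 8 * (cmod (u (p $ 2)))\<^sup>2)"
      "(\<lambda>z. complex_of_real (Re (v z))) differentiable (at (p $ 2))"
      "wz (\<lambda>z. complex_of_real (Re (v z))) (p $ 2) = G (p $ 2)" if "p \<in> bidisc e" for p
    using e7(2)[OF ball[OF nth_in_ball[OF that, of 2] ele(8)]] by auto
  have T2: "pdbar 2 T p = (R p)\<^sup>2 / 4" if "p \<in> bidisc e" for p
    unfolding T_def pd_coordinate[OF e7'(1)[OF that]] using e7'(2)[OF that] by (simp add: R_def)
  have V2: "pdbar 2 V p = R p / 2 * cnj (V p)" if "p \<in> bidisc e" for p
    unfolding V_def pd_coordinate[OF smooth_on_differentiable[OF s3 nth_in_ball[OF that]]]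
    using e7'(3)[OF that] by (simp add: R_def)
  have W2: "pdbar 2 (pd 2 W) p = R p / 8 * (V p * cnj (V p))" if p: "p \<in> bidisc e" for p
  proof -
    have "pdbar 2 (pd 2 W) p = pdbar 2 (\<lambda>p. G (p $ 2)) p"
      by (rule pdbar_cong[OF open_bidisc p])
        (simp add: W_def pd_coordinate[OF e7'(6)] e7'(7))
    also have "\<dots> = of_real (r (p $ 2) / 8 * (cmod (u (p $ 2)))\<^sup>2)"
      unfolding pd_coordinate[OF e7'(4)[OF p]] using e7'(5)[OF p] by simp
    also have "\<dots> = R p / 8 * (V p * cnj (V p))"
      unfolding of_real_mult complex_norm_square by (simp add: R_def V_def)
    finally show ?thesis .
  qed
  have L: "R p * pdbar 2 (pd 2 R) p = pd 2 R p * pdbar 2 R p + R p ^ 4 / 4" if p: "p \<in> bidisc e" for p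
  proof (rule liouville_of_holomorphic[OF sm2(1) Rnz _ _ _ _ _ p, where \<rho> = \<rho>])
    show "\<rho> holomorphic_on ball 0 e" using e0(2) ele(1) by (auto intro: holomorphic_on_subset)
    show "deriv \<rho> z \<noteq> 0" "cmod (\<rho> z) < 1" if "z \<in> ball 0 e" for z
      using \<rho>[OF ball[OF that ele(1)]] by auto
    show "(R q)\<^sup>2 * (1 - \<rho> (q $ 2) * cnj (\<rho> (q $ 2)))\<^sup>2 = 4 * deriv \<rho> (q $ 2) * cnj (deriv \<rho> (q $ 2))"
      if "q \<in> bidisc e" for q
    proof -
      let ?z = "q $ 2"
      have *: "cmod (\<rho> ?z) < 1" "r ?z = 2 * cmod (deriv \<rho> ?z) / (1 - (cmod (\<rho> ?z))\<^sup>2)"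
        using \<rho>[OF ball[OF nth_in_ball[OF that, of 2] ele(1)]] by auto
      then have "(cmod (\<rho> ?z))\<^sup>2 < 1" by (simp add: power_less_one_iff abs_square_less_1)
      then have "r ?z * (1 - (cmod (\<rho> ?z))\<^sup>2) = 2 * cmod (deriv \<rho> ?z)" using *(2) by simp
      then have "(r ?z * (1 - (cmod (\<rho> ?z))\<^sup>2))\<^sup>2 = 4 * (cmod (deriv \<rho> ?z))\<^sup>2" by (simp add: power2_eq_square)
      then have "complex_of_real ((r ?z)\<^sup>2 * (1 - (cmod (\<rho> ?z))\<^sup>2)\<^sup>2) = of_real (4 * (cmod (deriv \<rho> ?z))\<^sup>2)"
        by (simp only: power_mult_distrib)
      then have "(R q)\<^sup>2 * (1 - of_real ((cmod (\<rho> ?z))\<^sup>2))\<^sup>2 = 4 * of_real ((cmod (deriv \<rho> ?z))\<^sup>2)"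
        by (simp add: R_def)
      then show ?thesis unfolding complex_norm_square by simp
    qed
  qed (auto simp: real)
  have Fc: "cplx F p = R p * (p $ 1 * cnj (p $ 1)) + (T p * (p $ 1)\<^sup>2 + cnj (T p) * (cnj (p $ 1))\<^sup>2)
       + (V p * p $ 1 + cnj (V p) * cnj (p $ 1)) + 2 * W p" if "p \<in> bidisc e" for p
  proof -
    have "v (p $ 2) + cnj (v (p $ 2)) = 2 * W p" by (simp add: W_def complex_add_cnj)
    then show ?thesis
      unfolding cplx_def e6(2)[OF bi[OF that ele(7)]] complex_norm_square
      by (simp add: R_def T_def V_def)
  qed
  note nfd = normal_form_derivatives[OF sm2 z1 real Rnz T2 V2 W2 L Fc]
  have F11: "F11 F p = R p" and S: "S_fun F p = R p / 2" and MA: "monge_ampere_at F p" if "p \<in> bidisc e" for p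
    using that by - (rule nfd; assumption)+
  show "class_C21 F"
    unfolding class_C21_def
  proof (intro exI[of _ "bidisc e"] conjI ballI impI)
    show "open (bidisc e)" "0 \<in> bidisc e" "smooth_on F (bidisc e)"
      using open_bidisc zero_in_bidisc[OF e] sF by auto
    show "connected {p \<in> rigid_hypersurface F. proj12 p \<in> bidisc e}"
      using sF by (rule connected_rigid_hypersurface)
    fix p assume p: "proj12 p \<in> bidisc e"
    have nz: "F11 F q \<noteq> 0" if "q \<in> bidisc e" for q using F11[OF that] Rnz[OF that] by simp
    show "levi_rank (rigid_defining F) p = 1"
      using levi_rank_rigid[OF open_bidisc sF p nz[OF p]] MA[OF p] by simp
    show "nondegenerate_at 2 (rigid_defining F) p"
      using nondegenerate_rigid[OF open_bidisc sF MA nz p] S[OF p] Rnz[OF p] by simp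
  qed
  show "S_conditions F"
    unfolding S_conditions_def eventually_nhds_0_bidisc
  proof (intro exI[of _ e] conjI e ballI)
    fix p assume p: "p \<in> bidisc e"
    have d: "R differentiable (at p)" using smooth_on_differentiable[OF sm2(1) p] .
    have "pd 1 (S_fun F) p = pd 1 (\<lambda>p. R p / 2) p" by (rule pd_cong[OF open_bidisc p S])
    then show "pd 1 (S_fun F) p = 0" using d z1(1)[OF p] by (simp add: wirtinger_simps)
    have "pdbar 1 (S_fun F) p = pdbar 1 (\<lambda>p. R p / 2) p" by (rule pdbar_cong[OF open_bidisc p S])
    then show "pdbar 1 (S_fun F) p = 0" using d z1(1)[OF p] by (simp add: wirtinger_simps)
  qed
  show "F11_only_z2 F"
    unfolding F11_only_z2_def eventually_nhds_0_bidisc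
    using F11 e by (auto simp: R_def intro!: exI[of _ "\<lambda>z. complex_of_real (r z)"] exI[of _ e])
  show "F11_positive F"
    unfolding F11_positive_def eventually_nhds_0_bidisc
    using F11 Rpos e by (auto simp: R_def intro!: exI[of _ e])
qed

section \<open>The model hypersurface\<close>

text \<open>
  Up to the factor \<open>2\<close>, the well-known rational graph that is locally equivalent to the tube over the
  future light cone.
\<close>

definition model :: "complex^2 \<Rightarrow> real" where
  "model p = Re (2 * (p $ 1 * cnj (p $ 1) + cnj (p $ 2) * (p $ 1)\<^sup>2) / (1 - p $ 2 * cnj (p $ 2)))"

lemma one_minus_norm_square_nonzero: "cmod z < 1 \<Longrightarrow> 1 - z * cnj z \<noteq> 0"
  by (metis complex_norm_square norm_one norm_of_real of_real_1 abs_square_less_1 abs_norm_cancel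
      right_minus_eq less_irrefl of_real_eq_1_iff)

lemma graphing_germ_model: "graphing_germ model"
proof -
  have "smooth_on model (bidisc 1)"
    unfolding model_def
    by (intro smooth_intros open_bidisc smooth_on_nth one_minus_norm_square_nonzero) (auto simp: bidisc_def)
  then have "smooth_near_0 model"
    unfolding smooth_near_0_def using open_bidisc zero_in_bidisc[of 1] by auto
  then show ?thesis by (simp add: graphing_germ_def model_def)
qed

lemma has_sum_diagonal:
  fixes c :: "nat \<Rightarrow> 'a::{comm_monoid_add,topological_space}"
  assumes "(c has_sum s) UNIV"
  shows "((\<lambda>(j, k). if j = k then c j else 0) has_sum s) UNIV"
proof -
  let ?f = "\<lambda>(j, k). if j = k then c j else 0" and ?d = "\<lambda>n :: nat. (n, n)"
  have "inj ?d" by (auto simp: inj_on_def)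
  moreover have "(?f \<circ> ?d) = c" by auto
  ultimately have "(?f has_sum s) (range ?d)" using has_sum_reindex[of ?d UNIV ?f s] assms by simp
  moreover have "?f x = 0" if "x \<notin> range ?d" for x
    using that by (cases x) auto
  ultimately show ?thesis
    using has_sum_cong_neutral[of UNIV "range ?d" ?f ?f s] by blast
qed

text \<open>
  Both expansions contain only terms near the diagonal: with \<open>x = |z|\<^sup>2\<close> they are
  \<open>1 / (1 - x)\<^sup>2 = \<Sum> (j + 1) x\<^sup>j\<close> and \<open>cnj z / (1 - x) = \<Sum> x\<^sup>j cnj z\<close>.
\<close>

lemma model_zbar_integral:
  "zbar_integral (\<lambda>z. of_real ((2 / (1 - (cmod z)\<^sup>2))\<^sup>2 / 4)) (\<lambda>z. cnj z / (1 - z * cnj z))"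
  unfolding zbar_integral_def eventually_nhds_0_ball
proof (intro exI[of _ "\<lambda>j k. if j = k then of_nat (Suc j) else 0"] exI[of _ 1] conjI ballI)
  fix z :: complex assume "z \<in> ball 0 1"
  then have z: "cmod z < 1" by simp
  define x where "x = z * cnj z"
  have "norm x = (cmod z)\<^sup>2" by (simp add: x_def norm_mult power2_eq_square)
  then have x: "norm x < 1" using z by (simp add: power_less_one_iff abs_square_less_1)
  have s1: "((\<lambda>n. of_nat (Suc n) * x ^ n) has_sum 1 / (1 - x)\<^sup>2) UNIV"
  proof (rule norm_summable_imp_has_sum)
    show "(\<lambda>n. of_nat (Suc n) * x ^ n) sums (1 / (1 - x)\<^sup>2)" by (rule geometric_deriv_sums[OF x])
    have "summable (\<lambda>n. of_nat (Suc n) * norm x ^ n)"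
      using geometric_deriv_sums[of "norm x"] x by (auto intro: sums_summable)
    then show "summable (\<lambda>n. norm (of_nat (Suc n) * x ^ n))"
      by (simp add: norm_mult norm_power del: of_nat_Suc)
  qed
  have s2: "((\<lambda>n. x ^ n * cnj z) has_sum 1 / (1 - x) * cnj z) UNIV"
  proof (rule norm_summable_imp_has_sum)
    show "(\<lambda>n. x ^ n * cnj z) sums (1 / (1 - x) * cnj z)" by (intro sums_mult2 geometric_sums x)
    show "summable (\<lambda>n. norm (x ^ n * cnj z))"
      using x by (auto simp: norm_mult norm_power intro!: summable_mult2 summable_geometric)
  qed
  have "complex_of_real ((2 / (1 - (cmod z)\<^sup>2))\<^sup>2 / 4) = 1 / (1 - x)\<^sup>2"
    unfolding x_def complex_norm_square[symmetric] by (simp add: power_divide)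
  moreover have "(\<lambda>(j, k). (if j = k then of_nat (Suc j) else 0) * z ^ j * cnj z ^ k)
      = (\<lambda>(j, k). if j = k then of_nat (Suc j) * x ^ j else 0)"
    by (auto simp: fun_eq_iff x_def power_mult_distrib)
  ultimately show "((\<lambda>(j, k). (if j = k then of_nat (Suc j) else 0) * z ^ j * cnj z ^ k)
      has_sum of_real ((2 / (1 - (cmod z)\<^sup>2))\<^sup>2 / 4)) UNIV"
    using has_sum_diagonal[OF s1] by simp
  have "(\<lambda>(j, k). (if j = k then of_nat (Suc j) else 0) / of_nat (k + 1) * z ^ j * cnj z ^ (k + 1))
      = (\<lambda>(j, k). if j = k then x ^ j * cnj z else 0)"
    by (auto simp: fun_eq_iff x_def power_mult_distrib simp del: of_nat_Suc)
  then show "((\<lambda>(j, k). (if j = k then of_nat (Suc j) else 0) / of_nat (k + 1) * z ^ j * cnj z ^ (k + 1))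
      has_sum cnj z / (1 - z * cnj z)) UNIV"
    using has_sum_diagonal[OF s2] by (simp add: x_def)
qed simp

lemma normal_form_model: "normal_form model"
  unfolding normal_form_def
proof (rule exI[of _ "\<lambda>z. 2 / (1 - (cmod z)\<^sup>2)"], rule exI[of _ "\<lambda>z. cnj z / (1 - z * cnj z)"],
    rule exI[of _ "\<lambda>z. 0"], rule exI[of _ "\<lambda>z. 0"], intro conjI)
  have ident: "smooth_on (\<lambda>z :: complex. z) S" for S
    by (rule smooth_on_linear) (rule bounded_linear_ident)
  have nz: "1 - z * cnj z \<noteq> 0" if "z \<in> ball 0 1" for z
    using that by (intro one_minus_norm_square_nonzero) auto
  have near: "smooth_near_0 f" if "smooth_on f (ball (0::complex) 1)" for f :: "complex \<Rightarrow> 'b::real_normed_vector"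
    unfolding smooth_near_0_def using that open_ball centre_in_ball zero_less_one by blast
  have "smooth_on (\<lambda>z. Re (2 / (1 - z * cnj z))) (ball 0 1)"
    by (intro smooth_intros open_ball ident nz)
  moreover have "Re (2 / (1 - z * cnj z)) = 2 / (1 - (cmod z)\<^sup>2)" for z
  proof -
    have "2 / (1 - z * cnj z) = of_real (2 / (1 - (cmod z)\<^sup>2))"
      unfolding complex_norm_square[symmetric] by simp
    then show ?thesis by simp
  qed
  ultimately show "smooth_near_0 (\<lambda>z::complex. 2 / (1 - (cmod z)\<^sup>2))" by (intro near) simp
  show "smooth_near_0 (\<lambda>z. cnj z / (1 - z * cnj z))"
    by (intro near smooth_intros open_ball ident nz)
  show "smooth_near_0 (\<lambda>z::complex. 0 :: complex)" "smooth_near_0 (\<lambda>z::complex. 0 :: complex)"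
    by (intro near smooth_intros)+
  show "r_condition (\<lambda>z. 2 / (1 - (cmod z)\<^sup>2))"
    unfolding r_condition_def
    by (intro exI[of _ "\<lambda>z. z"] exI[of _ 1]) (auto intro: holomorphic_intros)
  show "zbar_integral (\<lambda>z. of_real ((2 / (1 - (cmod z)\<^sup>2))\<^sup>2 / 4)) (\<lambda>z. cnj z / (1 - z * cnj z))"
    by (rule model_zbar_integral)
  show "\<forall>\<^sub>F z in nhds 0. wbar (\<lambda>z. 0) z = of_real (2 / (1 - (cmod z)\<^sup>2) / 2) * cnj 0"
    by (simp add: wbar_def frechet_derivative_const)
  show "\<exists>G. zbar_integral (\<lambda>z. of_real (2 / (1 - (cmod z)\<^sup>2) / 8 * (cmod 0)\<^sup>2)) G \<and>
             z_integral G (\<lambda>z. of_real (Re 0))"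
    unfolding zbar_integral_def z_integral_def
    by (intro exI[of _ "\<lambda>z. 0"] conjI exI[of _ "\<lambda>j k. 0"]) (simp_all add: case_prod_unfold)
  show "\<forall>\<^sub>F p in nhds 0.
           let z1 = p $ 1; z2 = p $ 2; s = cnj z2 / (1 - z2 * cnj z2) * z1\<^sup>2 + 0 * z1 + 0
           in complex_of_real (model p) = of_real (2 / (1 - (cmod z2)\<^sup>2)) * of_real ((cmod z1)\<^sup>2) + s + cnj s"
  proof (intro always_eventually allI)
    fix p :: "complex^2"
    let ?z = "p $ 1" and ?w = "p $ 2"
    have "complex_of_real (model p) = (2 * (?z * cnj ?z + cnj ?w * ?z\<^sup>2) / (1 - ?w * cnj ?w)
        + cnj (2 * (?z * cnj ?z + cnj ?w * ?z\<^sup>2) / (1 - ?w * cnj ?w))) / 2"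
      unfolding model_def by (subst complex_add_cnj) simp
    also have "cnj (2 * (?z * cnj ?z + cnj ?w * ?z\<^sup>2) / (1 - ?w * cnj ?w))
        = 2 * (?z * cnj ?z + ?w * (cnj ?z)\<^sup>2) / (1 - ?w * cnj ?w)"
      by (simp add: mult.commute)
    also have "(2 * (?z * cnj ?z + cnj ?w * ?z\<^sup>2) / (1 - ?w * cnj ?w)
        + 2 * (?z * cnj ?z + ?w * (cnj ?z)\<^sup>2) / (1 - ?w * cnj ?w)) / 2
        = 2 / (1 - ?w * cnj ?w) * (?z * cnj ?z) + cnj ?w * ?z\<^sup>2 / (1 - ?w * cnj ?w)
        + ?w * (cnj ?z)\<^sup>2 / (1 - ?w * cnj ?w)"
    proof -
      have "(2 * (a + b) / N + 2 * (a + c) / N) / 2 = 2 / N * a + b / N + c / N" for a b c N :: complex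
        by (cases "N = 0") (simp_all add: field_simps)
      then show ?thesis .
    qed
    also have "?w * (cnj ?z)\<^sup>2 / (1 - ?w * cnj ?w) = cnj (cnj ?w / (1 - ?w * cnj ?w) * ?z\<^sup>2)"
      by (simp add: mult.commute)
    also have "2 / (1 - ?w * cnj ?w) * (?z * cnj ?z) = of_real (2 / (1 - (cmod ?w)\<^sup>2)) * of_real ((cmod ?z)\<^sup>2)"
      unfolding complex_norm_square[symmetric] by simp
    finally show "let z1 = p $ 1; z2 = p $ 2; s = cnj z2 / (1 - z2 * cnj z2) * z1\<^sup>2 + 0 * z1 + 0
           in complex_of_real (model p) = of_real (2 / (1 - (cmod z2)\<^sup>2)) * of_real ((cmod z1)\<^sup>2) + s + cnj s"
      by (simp add: Let_def)
  qed
qed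

section \<open>Structure equations\<close>

text \<open>
  The equations between \<open>\<sigma>\<close>, \<open>k\<close>, \<open>\<Phi>\<close>, \<open>X\<close> described at the beginning. The functions \<open>\<sigma>\<close>, \<open>k\<close>, \<open>X\<close> depend on
  \<open>z\<^sub>2\<close> only. The equations for \<open>\<sigma>\<^sub>2\<close> and \<open>X\<^bsub>2bar\<^esub>\<close> amount to the Liouville equation
  \<open>\<sigma> \<sigma>\<^bsub>2 2bar\<^esub> - |\<sigma>\<^sub>2|\<^sup>2 = - |k|\<^sup>2\<close>, which says that \<open>|k| |dz| / \<sigma>\<close> is a metric of constant negative
  curvature.
\<close>

locale structure_equations =
  fixes e :: real and F :: "complex^2 \<Rightarrow> real" and \<sigma> k \<Phi> X :: "complex^2 \<Rightarrow> complex"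
  assumes e: "e > 0" and F: "smooth_on F (bidisc e)" "F 0 = 0"
    and sm: "smooth_on \<sigma> (bidisc e)" "smooth_on k (bidisc e)" "smooth_on \<Phi> (bidisc e)" "smooth_on X (bidisc e)"
    and \<sigma>real: "\<And>p. p \<in> bidisc e \<Longrightarrow> cnj (\<sigma> p) = \<sigma> p"
    and \<sigma>pos: "\<And>p. p \<in> bidisc e \<Longrightarrow> Re (\<sigma> p) > 0"
    and nz: "\<And>p. p \<in> bidisc e \<Longrightarrow> \<sigma> p \<noteq> 0 \<and> k p \<noteq> 0"
    and first: "\<And>p. p \<in> bidisc e \<Longrightarrow> pd 1 \<sigma> p = 0 \<and> pdbar 1 \<sigma> p = 0"
      "\<And>p. p \<in> bidisc e \<Longrightarrow> pd 1 k p = 0 \<and> pdbar 1 k p = 0"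
      "\<And>p. p \<in> bidisc e \<Longrightarrow> pd 1 X p = 0 \<and> pdbar 1 X p = 0"
    and \<sigma>2: "\<And>p. p \<in> bidisc e \<Longrightarrow> pd 2 \<sigma> p = k p * X p"
    and k2: "\<And>p. p \<in> bidisc e \<Longrightarrow> pdbar 2 k p = 0"
    and X2: "\<And>p. p \<in> bidisc e \<Longrightarrow> pdbar 2 X p = cnj (k p) * ((X p * cnj (X p) - 1) / \<sigma> p)"
    and \<Phi>1: "\<And>p. p \<in> bidisc e \<Longrightarrow> pdbar 1 \<Phi> p = 1 / \<sigma> p" "\<And>p. p \<in> bidisc e \<Longrightarrow> pd 1 \<Phi> p = - X p / \<sigma> p"
    and \<Phi>2: "\<And>p. p \<in> bidisc e \<Longrightarrow> pdbar 2 \<Phi> p = cnj (k p) * cnj (\<Phi> p) / \<sigma> p"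
    and FF: "\<And>p. p \<in> bidisc e \<Longrightarrow> pdbar 1 (pd 1 (cplx F)) p = 2 / \<sigma> p"
      "\<And>p. p \<in> bidisc e \<Longrightarrow> pdbar 2 (pd 1 (cplx F)) p = 2 * cnj (k p) * cnj (\<Phi> p) / \<sigma> p"
      "\<And>p. p \<in> bidisc e \<Longrightarrow> pdbar 1 (pd 2 (cplx F)) p = 2 * k p * \<Phi> p / \<sigma> p"
      "\<And>p. p \<in> bidisc e \<Longrightarrow> pdbar 2 (pd 2 (cplx F)) p = 2 * k p * cnj (k p) * \<Phi> p * cnj (\<Phi> p) / \<sigma> p"

lemma structure_equations_mono:
  assumes "structure_equations e F \<sigma> k \<Phi> X" and d: "0 < d" "d \<le> e"
  shows "structure_equations d F \<sigma> k \<Phi> X"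
proof -
  interpret structure_equations e F \<sigma> k \<Phi> X by fact
  note sub = subsetD[OF bidisc_mono[OF d(2)]]
  show ?thesis
    by unfold_locales
      (fact d(1) F(2) sm[THEN smooth_on_subset, OF bidisc_mono[OF d(2)]] smooth_on_subset[OF F(1) bidisc_mono[OF d(2)]]
        \<sigma>real[OF sub] \<sigma>pos[OF sub] nz[OF sub] first[OF sub] \<sigma>2[OF sub] k2[OF sub] X2[OF sub]
        \<Phi>1[OF sub] \<Phi>2[OF sub] FF[OF sub])+
qed

text \<open>
  Differentiating \<open>F\<^bsub>1 1bar\<^esub> F\<^bsub>2 2bar\<^esub> = |F\<^bsub>1 2bar\<^esub>|\<^sup>2\<close> in \<open>z\<^sub>1\<close> gives an equation for the derivative of
  \<open>F\<^bsub>1 2bar\<^esub>\<close> in \<open>z\<^sub>2\<close> (\<open>star\<close> below). Its derivative in \<open>z\<^sub>1\<close> says that \<open>k\<close> is holomorphic (\<open>e1\<close>), its derivative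
  in the conjugate of \<open>z\<^sub>1\<close> is the Liouville equation (\<open>e2\<close>); combined with \<open>e1\<close>, the equation \<open>star\<close> itself becomes the one
  for \<open>\<Phi>\<^bsub>2bar\<^esub>\<close>.
\<close>

lemma structure_equations_exist:
  fixes F :: "complex^2 \<Rightarrow> real"
  assumes e: "e > 0" and F: "smooth_on F (bidisc e)" "F 0 = 0"
    and ma: "\<And>p. p \<in> bidisc e \<Longrightarrow> monge_ampere_at F p"
    and pos: "\<And>p. p \<in> bidisc e \<Longrightarrow> Re (F11 F p) > 0"
    and Snz: "\<And>p. p \<in> bidisc e \<Longrightarrow> S_fun F p \<noteq> 0"
    and S1: "\<And>p. p \<in> bidisc e \<Longrightarrow> pd 1 (S_fun F) p = 0" "\<And>p. p \<in> bidisc e \<Longrightarrow> pdbar 1 (S_fun F) p = 0"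
    and R1: "\<And>p. p \<in> bidisc e \<Longrightarrow> pd 1 (F11 F) p = 0" "\<And>p. p \<in> bidisc e \<Longrightarrow> pdbar 1 (F11 F) p = 0"
  shows "\<exists>\<sigma> k \<Phi> X. structure_equations e F \<sigma> k \<Phi> X"
proof -
  have nz: "F11 F p \<noteq> 0" if "p \<in> bidisc e" for p using pos[OF that] by auto
  define \<sigma> where "\<sigma> = (\<lambda>p. 2 / F11 F p)"
  define k where "k = (\<lambda>p. 2 * cnj (S_fun F p) / F11 F p)"
  define \<Phi> where "\<Phi> = (\<lambda>p. cnj (F12 F p / (2 * S_fun F p)))"
  define X where "X = (\<lambda>p. pd 2 \<sigma> p / k p)"
  let ?\<Delta> = "bidisc e"
  let ?R = "F11 F" and ?S = "S_fun F" and ?C = "F12 F"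
  have D: "open ?\<Delta>" by (rule open_bidisc)
  have sc: "smooth_on (cplx F) ?\<Delta>" by (rule smooth_on_cplx[OF D F(1)])
  have sR: "smooth_on ?R ?\<Delta>" and sC: "smooth_on ?C ?\<Delta>" and sF22: "smooth_on (F22 F) ?\<Delta>"
    unfolding F11_F12_cplx F22_def by (intro smooth_on_pd smooth_on_pdbar D sc)+
  have sS: "smooth_on ?S ?\<Delta>"
    unfolding S_fun_def by (intro smooth_on_pd smooth_intros D sC sR nz)
  have s\<sigma>: "smooth_on \<sigma> ?\<Delta>" and sk: "smooth_on k ?\<Delta>" and s\<Phi>: "smooth_on \<Phi> ?\<Delta>"
    unfolding \<sigma>_def k_def \<Phi>_def using nz Snz by (intro smooth_intros D sR sS sC; simp)+
  have \<sigma>k: "\<sigma> p \<noteq> 0 \<and> k p \<noteq> 0" if "p \<in> ?\<Delta>" for p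
    using nz[OF that] Snz[OF that] by (simp add: \<sigma>_def k_def)
  have sX: "smooth_on X ?\<Delta>"
    unfolding X_def using \<sigma>k by (intro smooth_intros smooth_on_pd D s\<sigma> sk) auto
  have sm: "smooth_on (pd j f) ?\<Delta> \<and> smooth_on (pdbar j f) ?\<Delta>" if "smooth_on f ?\<Delta>" for f j
    using smooth_on_pd[OF D that] smooth_on_pdbar[OF D that] by blast
  note d = smooth_on_differentiable[OF sR] smooth_on_differentiable[OF sC] smooth_on_differentiable[OF sS]
    smooth_on_differentiable[OF s\<sigma>] smooth_on_differentiable[OF sk] smooth_on_differentiable[OF s\<Phi>]
    smooth_on_differentiable[OF sX] smooth_on_differentiable[OF sF22]
    smooth_on_differentiable[OF sm[OF sR, THEN conjunct1]] smooth_on_differentiable[OF sm[OF sR, THEN conjunct2]]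
    smooth_on_differentiable[OF sm[OF sC, THEN conjunct1]] smooth_on_differentiable[OF sm[OF sC, THEN conjunct2]]
    smooth_on_differentiable[OF sm[OF s\<sigma>, THEN conjunct1]] smooth_on_differentiable[OF sm[OF s\<sigma>, THEN conjunct2]]
  have Rreal: "cnj (?R p) = ?R p" if "p \<in> ?\<Delta>" for p
    unfolding F11_F12_cplx using cnj_second_cplx[OF D that F(1)] .
  have \<sigma>real: "cnj (\<sigma> p) = \<sigma> p" if "p \<in> ?\<Delta>" for p
    using Rreal[OF that] by (simp add: \<sigma>_def)
  have cpd: "cnj (pdbar j f p) = pd j f p" if "p \<in> ?\<Delta>" "\<And>q. q \<in> ?\<Delta> \<Longrightarrow> cnj (f q) = f q" "f differentiable (at p)"
    for f j p
  proof -
    have "cnj (pdbar j f p) = pd j (\<lambda>q. cnj (f q)) p" using that(3) by (simp add: pd_cnj)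
    also have "\<dots> = pd j f p" by (rule pd_cong[OF D that(1,2)])
    finally show ?thesis .
  qed
  have cR: "cnj (pdbar j ?R p) = pd j ?R p" if "p \<in> ?\<Delta>" for j p
    by (rule cpd[OF that Rreal d(1)[OF that]])
  have cR': "cnj (pd j ?R p) = pdbar j ?R p" if "p \<in> ?\<Delta>" for j p
    using cR[OF that, of j] by (metis complex_cnj_cnj)
  have zero: "pd j (pd i f) p = 0" "pdbar j (pd i f) p = 0" if "\<And>q. q \<in> ?\<Delta> \<Longrightarrow> pd i f q = 0" "p \<in> ?\<Delta>" for i j f p
    using pd_cong[OF D that(2), of "pd i f" "\<lambda>_. 0"] pdbar_cong[OF D that(2), of "pd i f" "\<lambda>_. 0"] that by auto
  have zero': "pd j (pdbar i f) p = 0" if "\<And>q. q \<in> ?\<Delta> \<Longrightarrow> pdbar i f q = 0" "p \<in> ?\<Delta>" for i j f p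
    using pd_cong[OF D that(2), of "pdbar i f" "\<lambda>_. 0"] that by auto
  have R12: "pd 1 (pd 2 ?R) p = 0" "pd 1 (pdbar 2 ?R) p = 0" "pdbar 1 (pdbar 2 ?R) p = 0" "pdbar 1 (pd 2 ?R) p = 0"
    if "p \<in> ?\<Delta>" for p
    using wirtinger_commute(1)[OF D that sR, of 1 2] wirtinger_commute(2)[OF D that sR, of 2 1]
      wirtinger_commute(3)[OF D that sR, of 1 2] wirtinger_commute(2)[OF D that sR, of 1 2]
      zero[of 1 ?R p 2] zero'[of 1 ?R p 2] R1 that
      pdbar_cong[OF D that, of "pdbar 1 ?R" "\<lambda>_. 0" 2] by auto
  have C1: "pd 1 ?C p = ?S p * ?R p" if p: "p \<in> ?\<Delta>" for p
  proof -
    have "?S p = pd 1 ?C p / ?R p"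
      unfolding S_fun_def using d(1,2)[OF p] nz[OF p] R1[OF p] by (simp add: wirtinger_simps power2_eq_square)
    then show ?thesis using nz[OF p] by simp
  qed
  have C1': "pdbar 1 ?C p = pdbar 2 ?R p" if p: "p \<in> ?\<Delta>" for p
    unfolding F11_F12_cplx using wirtinger_commute(3)[OF D p smooth_on_pd[OF D sc]] .
  have MA: "?R p * F22 F p = ?C p * cnj (?C p)" if "p \<in> ?\<Delta>" for p
    using ma[OF that] by (simp add: monge_ampere_at_def)
  have F221: "pd 1 (F22 F) p = pd 2 ?C p" if p: "p \<in> ?\<Delta>" for p
  proof -
    have "pd 1 (F22 F) p = pdbar 2 (pd 1 (pd 2 (cplx F))) p"
      unfolding F22_def using wirtinger_commute(2)[OF D p smooth_on_pd[OF D sc]] by simp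
    also have "\<dots> = pdbar 2 (pd 2 (pd 1 (cplx F))) p"
      by (rule pdbar_cong[OF D p]) (rule wirtinger_commute(1)[OF D _ sc])
    also have "\<dots> = pd 2 ?C p"
      unfolding F11_F12_cplx using wirtinger_commute(2)[OF D p smooth_on_pd[OF D sc]] by simp
    finally show ?thesis .
  qed
  have star: "?R p * pd 2 ?C p = ?S p * ?R p * cnj (?C p) + ?C p * pd 2 ?R p" if p: "p \<in> ?\<Delta>" for p
  proof -
    have "pd 1 (\<lambda>p. ?R p * F22 F p) p = pd 1 (\<lambda>p. ?C p * cnj (?C p)) p"
      by (rule pd_cong[OF D p MA])
    then show ?thesis
      using d[OF p] R1[OF p] by (simp add: wirtinger_simps F221[OF p] C1[OF p] C1'[OF p] cR[OF p])
  qed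
  have e1: "?R p * pd 2 ?S p = ?S p * pd 2 ?R p" if p: "p \<in> ?\<Delta>" for p
  proof -
    have c: "pd 1 (pd 2 ?C) p = ?S p * pd 2 ?R p + pd 2 ?S p * ?R p"
    proof -
      have "pd 1 (pd 2 ?C) p = pd 2 (\<lambda>p. ?S p * ?R p) p"
        unfolding wirtinger_commute(1)[OF D p sC, of 1 2] by (rule pd_cong[OF D p C1])
      then show ?thesis using d[OF p] by (simp add: wirtinger_simps)
    qed
    have "pd 1 (\<lambda>p. ?R p * pd 2 ?C p) p = pd 1 (\<lambda>p. ?S p * ?R p * cnj (?C p) + ?C p * pd 2 ?R p) p"
      by (rule pd_cong[OF D p star])
    then have "?R p * (?R p * pd 2 ?S p) = ?R p * (?S p * pd 2 ?R p)"
      using d[OF p] R1[OF p] S1[OF p] R12[OF p]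
      by (simp add: wirtinger_simps c C1[OF p] C1'[OF p] cR[OF p]) (simp add: algebra_simps)
    then show ?thesis using nz[OF p] by simp
  qed
  have e2: "?R p * pdbar 2 (pd 2 ?R) p = ?S p * cnj (?S p) * (?R p)\<^sup>2 + pd 2 ?R p * pdbar 2 ?R p" if p: "p \<in> ?\<Delta>" for p
  proof -
    have c: "pdbar 1 (pd 2 ?C) p = pdbar 2 (pd 2 ?R) p"
    proof -
      have "pdbar 1 (pd 2 ?C) p = pd 2 (pdbar 2 ?R) p"
        unfolding wirtinger_commute(2)[OF D p sC, of 1 2] by (rule pd_cong[OF D p C1'])
      then show ?thesis using wirtinger_commute(2)[OF D p sR, of 2 2] by simp
    qed
    have "pdbar 1 (\<lambda>p. ?R p * pd 2 ?C p) p = pdbar 1 (\<lambda>p. ?S p * ?R p * cnj (?C p) + ?C p * pd 2 ?R p) p"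
      by (rule pdbar_cong[OF D p star])
    then show ?thesis
      using d[OF p] R1[OF p] S1[OF p] R12[OF p]
      by (simp add: wirtinger_simps c C1[OF p] C1'[OF p] Rreal[OF p] power2_eq_square mult_ac)
  qed
  have k2: "pdbar 2 k p = 0" if p: "p \<in> ?\<Delta>" for p
  proof -
    have "cnj (?R p * pd 2 ?S p) = cnj (?S p * pd 2 ?R p)" using e1[OF p] by simp
    then have "?R p * cnj (pd 2 ?S p) = cnj (?S p) * pdbar 2 ?R p" by (simp add: Rreal[OF p] cR'[OF p])
    then show ?thesis
      unfolding k_def using d[OF p] nz[OF p] by (simp add: wirtinger_simps mult.commute)
  qed
  have k1: "pd 1 k p = 0 \<and> pdbar 1 k p = 0" if p: "p \<in> ?\<Delta>" for p
    unfolding k_def using d[OF p] nz[OF p] S1[OF p] R1[OF p] by (simp add: wirtinger_simps)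
  have \<sigma>1: "pd 1 \<sigma> p = 0 \<and> pdbar 1 \<sigma> p = 0" if p: "p \<in> ?\<Delta>" for p
    unfolding \<sigma>_def using d[OF p] nz[OF p] S1[OF p] R1[OF p] by (simp add: wirtinger_simps)
  have \<sigma>2: "pd 2 \<sigma> p = k p * X p" if "p \<in> ?\<Delta>" for p
    using \<sigma>k[OF that] by (simp add: X_def)
  have \<sigma>2': "pdbar 2 \<sigma> p = cnj (k p) * cnj (X p)" if "p \<in> ?\<Delta>" for p
    using cpd[OF that \<sigma>real d(4)[OF that], of 2] \<sigma>2[OF that] by (metis complex_cnj_cnj complex_cnj_mult)
  have Xform: "X p = - pd 2 ?R p / (?R p * cnj (?S p))" if p: "p \<in> ?\<Delta>" for p
    unfolding X_def k_def \<sigma>_def using d[OF p] nz[OF p] Snz[OF p]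
    by (simp add: wirtinger_simps power2_eq_square field_simps)
  have X1: "pd 1 X p = 0 \<and> pdbar 1 X p = 0" if p: "p \<in> ?\<Delta>" for p
  proof -
    have "pd 1 X p = pd 1 (\<lambda>p. - pd 2 ?R p / (?R p * cnj (?S p))) p"
      "pdbar 1 X p = pdbar 1 (\<lambda>p. - pd 2 ?R p / (?R p * cnj (?S p))) p"
      by (rule pd_cong[OF D p Xform] pdbar_cong[OF D p Xform]; assumption)+
    then show ?thesis
      using d[OF p] nz[OF p] Snz[OF p] R12[OF p] R1[OF p] S1[OF p] by (simp add: wirtinger_simps)
  qed
  have X2: "pdbar 2 X p = cnj (k p) * ((X p * cnj (X p) - 1) / \<sigma> p)" if p: "p \<in> ?\<Delta>" for p
  proof -
    have "pdbar 2 (\<lambda>p. ?R p * (k p * X p)) p = pdbar 2 (\<lambda>p. - \<sigma> p * pd 2 ?R p) p"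
    proof (rule pdbar_cong[OF D p])
      fix q assume q: "q \<in> ?\<Delta>"
      show "?R q * (k q * X q) = - \<sigma> q * pd 2 ?R q"
        unfolding Xform[OF q] k_def \<sigma>_def using nz[OF q] Snz[OF q] by simp
    qed
    then have "?R p * (k p * pdbar 2 X p) + pdbar 2 ?R p * (k p * X p)
        = - \<sigma> p * pdbar 2 (pd 2 ?R) p - pdbar 2 \<sigma> p * pd 2 ?R p"
      using d[OF p] by (simp add: wirtinger_simps k2[OF p])
    then have eq: "?R p * (k p * pdbar 2 X p) + pdbar 2 ?R p * (k p * X p)
        = - (\<sigma> p * pdbar 2 (pd 2 ?R) p) - pdbar 2 \<sigma> p * pd 2 ?R p" by simp
    let ?n = "?S p * cnj (?S p)" and ?x = "X p * cnj (X p)"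
    have R2: "pd 2 ?R p = - ?R p * (cnj (?S p) * X p)"
      unfolding Xform[OF p] using nz[OF p] Snz[OF p] by simp
    then have "cnj (pd 2 ?R p) = cnj (- ?R p * (cnj (?S p) * X p))" by (rule arg_cong)
    then have R2': "pdbar 2 ?R p = - ?R p * (?S p * cnj (X p))" by (simp add: cR'[OF p] Rreal[OF p])
    have "?R p * pdbar 2 (pd 2 ?R) p = ?R p * (?R p * (?n * (1 + ?x)))"
      unfolding e2[OF p] R2 R2' by (simp add: algebra_simps power2_eq_square)
    then have R22: "pdbar 2 (pd 2 ?R) p = ?R p * (?n * (1 + ?x))" using nz[OF p] by simp
    have R\<sigma>: "?R p * \<sigma> p = 2" and k: "k p = cnj (?S p) * \<sigma> p" and k': "cnj (k p) = ?S p * \<sigma> p"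
      using nz[OF p] Rreal[OF p] by (simp_all add: \<sigma>_def k_def)
    have "(?R p * \<sigma> p) * (cnj (?S p) * pdbar 2 X p) - (?R p * \<sigma> p) * (?n * ?x)
        = - ((?R p * \<sigma> p) * (?n * (1 + ?x))) + (?R p * \<sigma> p) * (?n * ?x)"
      using eq unfolding R22 R2 R2' \<sigma>2'[OF p] k' unfolding k by (simp add: mult_ac)
    then have "2 * (cnj (?S p) * pdbar 2 X p) = 2 * (cnj (?S p) * (?S p * (?x - 1)))"
      unfolding R\<sigma> by (simp add: algebra_simps)
    then have "cnj (?S p) * pdbar 2 X p = cnj (?S p) * (?S p * (?x - 1))" by simp
    then have "pdbar 2 X p = ?S p * (?x - 1)" using Snz[OF p] by simp
    then show ?thesis unfolding k' using \<sigma>k[OF p] by simp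
  qed
  have \<Phi>1: "pdbar 1 \<Phi> p = 1 / \<sigma> p" "pd 1 \<Phi> p = - X p / \<sigma> p" if p: "p \<in> ?\<Delta>" for p
  proof -
    have dq: "(\<lambda>p. ?C p / (2 * ?S p)) differentiable (at p)"
      using d[OF p] Snz[OF p] by (intro differentiable_divide) auto
    have "pdbar 1 \<Phi> p = cnj (pd 1 (\<lambda>p. ?C p / (2 * ?S p)) p)"
      unfolding \<Phi>_def by (rule pdbar_cnj[OF dq])
    then show "pdbar 1 \<Phi> p = 1 / \<sigma> p"
      using d[OF p] Snz[OF p] S1[OF p] by (simp add: wirtinger_simps C1[OF p] \<sigma>_def Rreal[OF p] power2_eq_square)
    have "pd 1 \<Phi> p = cnj (pdbar 1 (\<lambda>p. ?C p / (2 * ?S p)) p)"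
      unfolding \<Phi>_def by (rule pd_cnj[OF dq])
    then show "pd 1 \<Phi> p = - X p / \<sigma> p"
      unfolding Xform[OF p]
      using d[OF p] Snz[OF p] S1[OF p] nz[OF p] by (simp add: wirtinger_simps C1'[OF p] \<sigma>_def cR[OF p] power2_eq_square)
  qed
  have C\<Phi>: "?C p = 2 * ?S p * cnj (\<Phi> p)" if "p \<in> ?\<Delta>" for p
    using Snz[OF that] by (simp add: \<Phi>_def)
  have S\<sigma>: "?S p = cnj (k p) / \<sigma> p" if "p \<in> ?\<Delta>" for p
    using nz[OF that] Rreal[OF that] by (simp add: \<sigma>_def k_def)
  have \<Phi>2: "pdbar 2 \<Phi> p = cnj (k p) * cnj (\<Phi> p) / \<sigma> p" if p: "p \<in> ?\<Delta>" for p
  proof -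
    have "pd 2 ?C p = pd 2 (\<lambda>p. 2 * ?S p * cnj (\<Phi> p)) p" by (rule pd_cong[OF D p C\<Phi>])
    then have "pd 2 ?C p = 2 * ?S p * cnj (pdbar 2 \<Phi> p) + 2 * pd 2 ?S p * cnj (\<Phi> p)"
      using d[OF p] by (simp add: wirtinger_simps)
    then have "?R p * (2 * ?S p * cnj (pdbar 2 \<Phi> p)) + 2 * cnj (\<Phi> p) * (?R p * pd 2 ?S p)
        = ?R p * (2 * ?S p * (cnj (?S p) * \<Phi> p)) + 2 * cnj (\<Phi> p) * (?S p * pd 2 ?R p)"
      using star[OF p] unfolding C\<Phi>[OF p] by (simp add: algebra_simps)
    then have "cnj (pdbar 2 \<Phi> p) = cnj (?S p) * \<Phi> p"
      unfolding e1[OF p] using nz[OF p] Snz[OF p] by simp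
    then have "pdbar 2 \<Phi> p = ?S p * cnj (\<Phi> p)" by (metis complex_cnj_cnj complex_cnj_mult)
    then show ?thesis by (simp add: S\<sigma>[OF p])
  qed
  have F11: "pdbar 1 (pd 1 (cplx F)) p = 2 / \<sigma> p" if p: "p \<in> ?\<Delta>" for p
    unfolding F11_F12_cplx[symmetric] \<sigma>_def using nz[OF p] by simp
  have F12: "pdbar 2 (pd 1 (cplx F)) p = 2 * cnj (k p) * cnj (\<Phi> p) / \<sigma> p" if p: "p \<in> ?\<Delta>" for p
    using C\<Phi>[OF p] unfolding F11_F12_cplx(2) S\<sigma>[OF p] by simp
  have F21: "pdbar 1 (pd 2 (cplx F)) p = 2 * k p * \<Phi> p / \<sigma> p" if p: "p \<in> ?\<Delta>" for p
    using cnj_second_cplx[OF D p F(1), of 2 1] unfolding F12[OF p] by (simp add: \<sigma>real[OF p])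
  have F22: "pdbar 2 (pd 2 (cplx F)) p = 2 * k p * cnj (k p) * \<Phi> p * cnj (\<Phi> p) / \<sigma> p" if p: "p \<in> ?\<Delta>" for p
  proof -
    have "?R p * F22 F p = (2 * cnj (k p) * cnj (\<Phi> p) / \<sigma> p) * cnj (2 * cnj (k p) * cnj (\<Phi> p) / \<sigma> p)"
      using MA[OF p] unfolding F11_F12_cplx(2) F12[OF p] .
    moreover have "?R p = 2 / \<sigma> p" using nz[OF p] by (simp add: \<sigma>_def)
    ultimately show ?thesis
      using \<sigma>k[OF p] unfolding F22_def by (simp add: \<sigma>real[OF p] field_simps)
  qed
  have \<sigma>pos: "Re (\<sigma> p) > 0" if p: "p \<in> ?\<Delta>" for p
  proof -
    have "?R p = of_real (Re (?R p))" using Rreal[OF p] by (simp add: complex_eq_iff)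
    then have "\<sigma> p = of_real (2 / Re (?R p))" unfolding \<sigma>_def by (metis of_real_divide of_real_numeral)
    then show ?thesis using pos[OF p] by simp
  qed
  have "structure_equations e F \<sigma> k \<Phi> X"
    by unfold_locales
      (fact e F s\<sigma> sk s\<Phi> sX \<sigma>real \<sigma>pos \<sigma>k \<sigma>1 k1 X1 \<sigma>2 k2 X2 \<Phi>1 \<Phi>2 F11 F12 F21 F22)+
  then show ?thesis by blast
qed

section \<open>Solving the structure equations\<close>

text \<open>
  Rules for real derivatives that are written as \<open>h \<mapsto> a h + b cnj h\<close>, so that \<open>a\<close> and \<open>b\<close> are the two
  Wirtinger derivatives.
\<close>

lemma wd_add:
  assumes "(f has_derivative (\<lambda>h. a * h + b * cnj h)) (at z)" "(g has_derivative (\<lambda>h. c * h + d * cnj h)) (at z)"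
  shows "((\<lambda>z. f z + g z) has_derivative (\<lambda>h. (a + c) * h + (b + d) * cnj h)) (at z)"
  using has_derivative_add[OF assms] by (simp add: algebra_simps)

lemma wd_diff:
  assumes "(f has_derivative (\<lambda>h. a * h + b * cnj h)) (at z)" "(g has_derivative (\<lambda>h. c * h + d * cnj h)) (at z)"
  shows "((\<lambda>z. f z - g z) has_derivative (\<lambda>h. (a - c) * h + (b - d) * cnj h)) (at z)"
  using has_derivative_diff[OF assms] by (simp add: algebra_simps)

lemma wd_mult:
  fixes f g :: "complex \<Rightarrow> complex"
  assumes "(f has_derivative (\<lambda>h. a * h + b * cnj h)) (at z)" "(g has_derivative (\<lambda>h. c * h + d * cnj h)) (at z)"
  shows "((\<lambda>z. f z * g z) has_derivative (\<lambda>h. (a * g z + f z * c) * h + (b * g z + f z * d) * cnj h)) (at z)"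
  using has_derivative_mult[OF assms] by (simp add: algebra_simps)

lemma wd_divide:
  fixes f g :: "complex \<Rightarrow> complex"
  assumes "(f has_derivative (\<lambda>h. a * h + b * cnj h)) (at z)" "(g has_derivative (\<lambda>h. c * h + d * cnj h)) (at z)"
    and "g z \<noteq> 0"
  shows "((\<lambda>z. f z / g z) has_derivative (\<lambda>h. ((a - f z / g z * c) / g z) * h + ((b - f z / g z * d) / g z) * cnj h)) (at z)"
proof -
  have "((a * h + b * cnj h) * g z - f z * (c * h + d * cnj h)) / (g z * g z)
      = ((a - f z / g z * c) / g z) * h + ((b - f z / g z * d) / g z) * cnj h" for h
    using assms(3) by (simp add: field_simps)
  with has_derivative_divide'[OF assms] show ?thesis by simp
qed

lemma wd_cnj:
  assumes "(f has_derivative (\<lambda>h. a * h + b * cnj h)) (at z)"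
  shows "((\<lambda>z. cnj (f z)) has_derivative (\<lambda>h. cnj b * h + cnj a * cnj h)) (at z)"
  using has_derivative_cnj[OF assms] by (simp add: add.commute)

lemma wd_const: "((\<lambda>z. c) has_derivative (\<lambda>h. 0 * h + 0 * cnj h)) (at (z :: complex))"
  by simp

lemma wd_cong:
  "(f has_derivative (\<lambda>h. a * h + b * cnj h)) (at z) \<Longrightarrow> a = a' \<Longrightarrow> b = b' \<Longrightarrow>
   (f has_derivative (\<lambda>h. a' * h + b' * cnj h)) (at z)"
  by simp

lemma norm_wd_le: "cmod a \<le> A \<Longrightarrow> cmod b \<le> B \<Longrightarrow> cmod (a * h + b * cnj h) \<le> (A + B) * cmod h"
  using norm_triangle_ineq[of "a * h" "b * cnj h"]
    mult_right_mono[of "cmod a" A "cmod h"] mult_right_mono[of "cmod b" B "cmod h"]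
  by (simp add: norm_mult distrib_right)

lemma norm_triple_le:
  "norm (a, b, c) \<le> norm a + norm b + norm c"
  using norm_Pair_le[of a "(b, c)"] norm_Pair_le[of b c] by linarith

text \<open>
  With \<open>Y = (|X|\<^sup>2 - 1) / s\<close>, the triple \<open>(s, X, Y)\<close> solves the linear system
  \<open>ds = k X dz + cnj (k X) d(cnj z)\<close>, \<open>dX = m s dz + cnj k Y d(cnj z)\<close>, \<open>dY = m cnj X dz + cnj m X d(cnj z)\<close>. For
  solutions of \<open>y' = k x\<close>, \<open>x' = m y\<close>, so does
  \<open>(|y\<^sub>1|\<^sup>2 - |y\<^sub>2|\<^sup>2, x\<^sub>1 cnj y\<^sub>1 - x\<^sub>2 cnj y\<^sub>2, |x\<^sub>1|\<^sup>2 - |x\<^sub>2|\<^sup>2)\<close>. The initial values are chosen so that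
  both triples agree at \<open>0\<close> and \<open>y\<^sub>2\<close> vanishes there.
\<close>

lemma liouville_solution:
  fixes s X k m :: "complex \<Rightarrow> complex"
  assumes e: "e > 0" and hol: "k holomorphic_on ball 0 e" "m holomorphic_on ball 0 e"
    and s: "\<And>z. z \<in> ball 0 e \<Longrightarrow> cnj (s z) = s z" "\<And>z. z \<in> ball 0 e \<Longrightarrow> s z \<noteq> 0" and s0: "Re (s 0) > 0"
    and ds: "\<And>z. z \<in> ball 0 e \<Longrightarrow> (s has_derivative (\<lambda>h. k z * X z * h + cnj (k z) * cnj (X z) * cnj h)) (at z)"
    and dX: "\<And>z. z \<in> ball 0 e \<Longrightarrow>
      (X has_derivative (\<lambda>h. m z * s z * h + cnj (k z) * ((X z * cnj (X z) - 1) / s z) * cnj h)) (at z)"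
  obtains d y1 x1 y2 x2 where "0 < d" "d \<le> e" "y2 0 = 0"
    "\<And>z. z \<in> ball 0 d \<Longrightarrow> (y1 has_field_derivative k z * x1 z) (at z)"
    "\<And>z. z \<in> ball 0 d \<Longrightarrow> (x1 has_field_derivative m z * y1 z) (at z)"
    "\<And>z. z \<in> ball 0 d \<Longrightarrow> (y2 has_field_derivative k z * x2 z) (at z)"
    "\<And>z. z \<in> ball 0 d \<Longrightarrow> y1 z * x2 z - x1 z * y2 z = 1"
    "\<And>z. z \<in> ball 0 d \<Longrightarrow> s z = y1 z * cnj (y1 z) - y2 z * cnj (y2 z)"
    "\<And>z. z \<in> ball 0 d \<Longrightarrow> X z = x1 z * cnj (y1 z) - x2 z * cnj (y2 z)"
proof -
  define q where "q = complex_of_real (sqrt (Re (s 0)))"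
  have q: "q \<noteq> 0" "cnj q = q" "q * q = s 0"
  proof -
    have "s 0 = of_real (Re (s 0))" using s(1)[of 0] e by (simp add: complex_eq_iff)
    moreover have "q * q = of_real (Re (s 0))" using s0 unfolding q_def of_real_mult[symmetric] by simp
    ultimately show "q * q = s 0" by simp
  qed (use s0 in \<open>auto simp: q_def\<close>)
  have zero_hol: "(\<lambda>z. 0) holomorphic_on ball 0 e" by simp
  obtain d1 y1 x1 where 1: "0 < d1" "d1 \<le> e" "y1 0 = q" "x1 0 = X 0 / q"
    "\<And>z. z \<in> ball 0 d1 \<Longrightarrow> (y1 has_field_derivative k z * x1 z) (at z)"
    "\<And>z. z \<in> ball 0 d1 \<Longrightarrow> (x1 has_field_derivative m z * y1 z + 0) (at z)"
    by (rule linear_ode_solution[OF e hol zero_hol, of q "X 0 / q"]) (rule that; assumption)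
  obtain d2 y2 x2 where 2: "0 < d2" "d2 \<le> e" "y2 0 = 0" "x2 0 = 1 / q"
    "\<And>z. z \<in> ball 0 d2 \<Longrightarrow> (y2 has_field_derivative k z * x2 z) (at z)"
    "\<And>z. z \<in> ball 0 d2 \<Longrightarrow> (x2 has_field_derivative m z * y2 z + 0) (at z)"
    by (rule linear_ode_solution[OF e hol zero_hol, of 0 "1 / q"]) (rule that; assumption)
  define d where "d = min (min d1 d2) (e / 2)"
  have d: "0 < d" "d \<le> d1" "d \<le> d2" "d \<le> e / 2" "d \<le> e" using 1(1,2) 2(1) e by (auto simp: d_def)
  have hk: "continuous_on (cball 0 (e / 2)) k" "continuous_on (cball 0 (e / 2)) m"
    using hol e by (auto intro!: continuous_on_subset[OF holomorphic_on_imp_continuous_on])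
  obtain B1 B2 where B12: "\<And>z. z \<in> cball 0 (e / 2) \<Longrightarrow> cmod (k z) \<le> B1" "\<And>z. z \<in> cball 0 (e / 2) \<Longrightarrow> cmod (m z) \<le> B2"
    using compact_imp_bounded[OF compact_continuous_image[OF hk(1) compact_cball]]
      compact_imp_bounded[OF compact_continuous_image[OF hk(2) compact_cball]]
    unfolding bounded_iff by blast
  define B where "B = max B1 B2"
  have B: "cmod (k z) \<le> B" "cmod (m z) \<le> B" if "z \<in> ball 0 d" for z
    using B12[of z] that d by (auto simp: B_def)
  have D: "(y1 has_derivative (\<lambda>h. k z * x1 z * h + 0 * cnj h)) (at z)"
    "(x1 has_derivative (\<lambda>h. m z * y1 z * h + 0 * cnj h)) (at z)"
    "(y2 has_derivative (\<lambda>h. k z * x2 z * h + 0 * cnj h)) (at z)"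
    "(x2 has_derivative (\<lambda>h. m z * y2 z * h + 0 * cnj h)) (at z)" if "z \<in> ball 0 d" for z
    using that d 1(5,6)[of z] 2(5,6)[of z] by (auto simp: has_field_derivative_def)
  define Y where "Y z = (X z * cnj (X z) - 1) / s z" for z
  have Yreal: "cnj (Y z) = Y z" if "z \<in> ball 0 e" for z
    using s(1)[OF that] by (simp add: Y_def mult.commute)
  have dY: "(Y has_derivative (\<lambda>h. m z * cnj (X z) * h + cnj (m z) * X z * cnj h)) (at z)" if z: "z \<in> ball 0 e" for z
  proof -
    have YX: "cnj (k z) * ((X z * cnj (X z) - 1) / s z) = cnj (k z) * Y z" by (simp add: Y_def)
    note dX' = dX[OF z, unfolded YX]
    show ?thesis
      unfolding Y_def[abs_def]
      by (rule wd_cong[OF wd_divide[OF wd_diff[OF wd_mult[OF dX' wd_cnj[OF dX']] wd_const] ds[OF z] s(2)[OF z]]])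
        (use s[OF z] Yreal[OF z] in \<open>simp_all flip: Y_def add: field_simps\<close>)
  qed
  define Es where "Es z = s z - (y1 z * cnj (y1 z) - y2 z * cnj (y2 z))" for z
  define Eu where "Eu z = X z - (x1 z * cnj (y1 z) - x2 z * cnj (y2 z))" for z
  define EY where "EY z = Y z - (x1 z * cnj (x1 z) - x2 z * cnj (x2 z))" for z
  have dEs: "(Es has_derivative (\<lambda>h. (k z * Eu z) * h + (cnj (k z) * cnj (Eu z)) * cnj h)) (at z)" if z: "z \<in> ball 0 d" for z
  proof -
    have ze: "z \<in> ball 0 e" using z d by auto
    show ?thesis unfolding Es_def[abs_def] Eu_def
      by (rule wd_cong[OF wd_diff[OF ds[OF ze] wd_diff[OF wd_mult[OF D(1)[OF z] wd_cnj[OF D(1)[OF z]]]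
                wd_mult[OF D(3)[OF z] wd_cnj[OF D(3)[OF z]]]]]]) (simp_all add: algebra_simps)
  qed
  have dEX: "(Eu has_derivative (\<lambda>h. (m z * Es z) * h + (cnj (k z) * EY z) * cnj h)) (at z)" if z: "z \<in> ball 0 d" for z
  proof -
    have ze: "z \<in> ball 0 e" using z d by auto
    have YX: "cnj (k z) * ((X z * cnj (X z) - 1) / s z) = cnj (k z) * Y z" by (simp add: Y_def)
    show ?thesis unfolding Eu_def[abs_def] Es_def EY_def
      by (rule wd_cong[OF wd_diff[OF dX[OF ze, unfolded YX] wd_diff[OF wd_mult[OF D(2)[OF z] wd_cnj[OF D(1)[OF z]]]
                wd_mult[OF D(4)[OF z] wd_cnj[OF D(3)[OF z]]]]]]) (simp_all add: algebra_simps)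
  qed
  have dEY: "(EY has_derivative (\<lambda>h. (m z * cnj (Eu z)) * h + (cnj (m z) * Eu z) * cnj h)) (at z)" if z: "z \<in> ball 0 d" for z
  proof -
    have ze: "z \<in> ball 0 e" using z d by auto
    show ?thesis unfolding EY_def[abs_def] Eu_def
      by (rule wd_cong[OF wd_diff[OF dY[OF ze] wd_diff[OF wd_mult[OF D(2)[OF z] wd_cnj[OF D(2)[OF z]]]
                wd_mult[OF D(4)[OF z] wd_cnj[OF D(4)[OF z]]]]]]) (simp_all add: algebra_simps)
  qed
  define f where "f z = (Es z, Eu z, EY z)" for z
  have f0: "f z = 0" if z: "z \<in> ball 0 d" for z
  proof (rule derivative_bound_imp_zero[OF _ _ _ z])
    show "f 0 = 0"
      using q 1(3,4) 2(3,4) by (simp add: f_def Es_def Eu_def EY_def Y_def zero_prod_def diff_divide_distrib)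
    fix z :: complex assume z: "z \<in> ball 0 d"
    let ?f' = "\<lambda>h. ((k z * Eu z) * h + (cnj (k z) * cnj (Eu z)) * cnj h,
        (m z * Es z) * h + (cnj (k z) * EY z) * cnj h, (m z * cnj (Eu z)) * h + (cnj (m z) * Eu z) * cnj h)"
    show "(f has_derivative ?f') (at z)"
      unfolding f_def[abs_def] by (intro has_derivative_Pair dEs[OF z] dEX[OF z] dEY[OF z])
    fix h
    have n: "cmod (Es z) \<le> norm (f z)" "cmod (Eu z) \<le> norm (f z)" "cmod (EY z) \<le> norm (f z)"
      using norm_fst_le[of "Es z" "(Eu z, EY z)"] norm_snd_le[of "(Eu z, EY z)" "Es z"]
        norm_fst_le[of "Eu z" "EY z"] norm_snd_le[of "EY z" "Eu z"]
      unfolding f_def by linarith+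
    have b: "cmod (a * w) \<le> B * norm (f z)" if "cmod a \<le> B" "cmod w \<le> norm (f z)" for a w
      unfolding norm_mult using that order.trans[OF norm_ge_zero that(1)] by (intro mult_mono) auto
    have "norm (?f' h) \<le> (B * norm (f z) + B * norm (f z)) * cmod h
        + (B * norm (f z) + B * norm (f z)) * cmod h + (B * norm (f z) + B * norm (f z)) * cmod h"
      by (rule order.trans[OF norm_triple_le], intro add_mono norm_wd_le b) (use B[OF z] n in auto)
    then show "norm (?f' h) \<le> (6 * B) * norm (f z) * norm h" by (simp add: algebra_simps)
  qed
  have W: "y1 z * x2 z - x1 z * y2 z = 1" if z: "z \<in> ball 0 d" for z
  proof -
    have "((\<lambda>z. y1 z * x2 z - x1 z * y2 z) has_field_derivative 0) (at z within ball 0 d)" if "z \<in> ball 0 d" for z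
    proof -
      have z: "z \<in> ball 0 d1" "z \<in> ball 0 d2" using that d by auto
      have "((\<lambda>z. y1 z * x2 z - x1 z * y2 z) has_field_derivative 0) (at z)"
        using DERIV_diff[OF DERIV_mult[OF 1(5)[OF z(1)] 2(6)[OF z(2)]] DERIV_mult[OF 1(6)[OF z(1)] 2(5)[OF z(2)]]]
        by (simp add: mult_ac)
      then show ?thesis by (rule has_field_derivative_at_within)
    qed
    then have "\<exists>c. \<forall>z\<in>ball 0 d. y1 z * x2 z - x1 z * y2 z = c"
      by (rule has_field_derivative_zero_constant[OF convex_ball])
    then obtain c where "\<forall>z\<in>ball 0 d. y1 z * x2 z - x1 z * y2 z = c" ..
    from bspec[OF this, of 0] bspec[OF this z] show ?thesis using d(1) q 1(3) 2(3,4) by simp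
  qed
  show ?thesis
  proof (rule that[of d y2 y1 x1 x2])
    show "0 < d" "d \<le> e" "y2 0 = 0" using d 2(3) by auto
    fix z :: complex assume z: "z \<in> ball 0 d"
    then have z': "z \<in> ball 0 d1" "z \<in> ball 0 d2" using d by auto
    show "(y1 has_field_derivative k z * x1 z) (at z)" "(x1 has_field_derivative m z * y1 z) (at z)"
      "(y2 has_field_derivative k z * x2 z) (at z)"
      using 1(5,6)[OF z'(1)] 2(5)[OF z'(2)] by auto
    show "y1 z * x2 z - x1 z * y2 z = 1" by (rule W[OF z])
    show "s z = y1 z * cnj (y1 z) - y2 z * cnj (y2 z)" "X z = x1 z * cnj (y1 z) - x2 z * cnj (y2 z)"
      using f0[OF z] by (simp_all add: f_def Es_def Eu_def zero_prod_def)
  qed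
qed

text \<open>
  For a solution of \<open>b' = k c\<close>, \<open>c' = m b + n\<close>, the function \<open>c + (cnj b - X b) / s\<close> satisfies the same
  equations as \<open>\<phi>\<close>, and their difference satisfies the homogeneous ones. The initial values \<open>b(0) = 0\<close> and
  \<open>c(0) = \<phi>(0)\<close> make the two agree at \<open>0\<close>; the first of them is what lets the final change of coordinates
  fix the origin.
\<close>

lemma shift_solution:
  fixes s X k m n \<phi> :: "complex \<Rightarrow> complex"
  assumes e: "e > 0" and hol: "k holomorphic_on ball 0 e" "m holomorphic_on ball 0 e" "n holomorphic_on ball 0 e"
    and s: "\<And>z. z \<in> ball 0 e \<Longrightarrow> cnj (s z) = s z" "\<And>z. z \<in> ball 0 e \<Longrightarrow> s z \<noteq> 0"
    and ds: "\<And>z. z \<in> ball 0 e \<Longrightarrow> (s has_derivative (\<lambda>h. k z * X z * h + cnj (k z) * cnj (X z) * cnj h)) (at z)"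
    and dX: "\<And>z. z \<in> ball 0 e \<Longrightarrow>
      (X has_derivative (\<lambda>h. m z * s z * h + cnj (k z) * ((X z * cnj (X z) - 1) / s z) * cnj h)) (at z)"
    and d\<phi>: "\<And>z. z \<in> ball 0 e \<Longrightarrow>
      (\<phi> has_derivative (\<lambda>h. (n z - k z * X z * \<phi> z / s z) * h + (cnj (k z) * cnj (\<phi> z) / s z) * cnj h)) (at z)"
  obtains d b c where "0 < d" "d \<le> e" "b 0 = 0"
    "\<And>z. z \<in> ball 0 d \<Longrightarrow> (b has_field_derivative k z * c z) (at z)"
    "\<And>z. z \<in> ball 0 d \<Longrightarrow> (c has_field_derivative m z * b z + n z) (at z)"
    "\<And>z. z \<in> ball 0 d \<Longrightarrow> \<phi> z = c z + (cnj (b z) - X z * b z) / s z"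
proof -
  obtain d1 b c where 1: "0 < d1" "d1 \<le> e" "b 0 = 0" "c 0 = \<phi> 0"
    "\<And>z. z \<in> ball 0 d1 \<Longrightarrow> (b has_field_derivative k z * c z) (at z)"
    "\<And>z. z \<in> ball 0 d1 \<Longrightarrow> (c has_field_derivative m z * b z + n z) (at z)"
    by (rule linear_ode_solution[OF e hol, of 0 "\<phi> 0"]) (rule that; assumption)
  define d where "d = min d1 (e / 2)"
  have d: "0 < d" "d \<le> d1" "d \<le> e / 2" "d \<le> e" using 1(1,2) e by (auto simp: d_def)
  have sub: "cball 0 (e / 2) \<subseteq> ball (0::complex) e" using e by auto
  have conts: "isCont s z" "isCont X z" if "z \<in> ball 0 e" for z
    using ds[OF that] dX[OF that] by (auto intro: has_derivative_continuous)
  have ck: "continuous_on (cball 0 (e / 2)) k"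
    by (rule continuous_on_subset[OF holomorphic_on_imp_continuous_on[OF hol(1)] sub])
  have cs: "continuous_on (cball 0 (e / 2)) s" "continuous_on (cball 0 (e / 2)) X"
    using conts sub by (auto intro!: continuous_at_imp_continuous_on)
  have hk: "continuous_on (cball 0 (e / 2)) (\<lambda>z. k z * X z / s z)" "continuous_on (cball 0 (e / 2)) (\<lambda>z. cnj (k z) / s z)"
    using s(2) sub by (auto intro!: continuous_intros ck cs)
  obtain B1 B2 where B12: "\<And>z. z \<in> cball 0 (e / 2) \<Longrightarrow> cmod (k z * X z / s z) \<le> B1"
      "\<And>z. z \<in> cball 0 (e / 2) \<Longrightarrow> cmod (cnj (k z) / s z) \<le> B2"
    using compact_imp_bounded[OF compact_continuous_image[OF hk(1) compact_cball]]
      compact_imp_bounded[OF compact_continuous_image[OF hk(2) compact_cball]]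
    unfolding bounded_iff by blast
  have D: "(b has_derivative (\<lambda>h. k z * c z * h + 0 * cnj h)) (at z)"
    "(c has_derivative (\<lambda>h. (m z * b z + n z) * h + 0 * cnj h)) (at z)" if "z \<in> ball 0 d" for z
    using that d 1(5,6)[of z] by (auto simp: has_field_derivative_def)
  define E where "E z = \<phi> z - (c z + (cnj (b z) - X z * b z) / s z)" for z
  have dE: "(E has_derivative (\<lambda>h. - (k z * X z / s z) * E z * h + (cnj (k z) / s z) * cnj (E z) * cnj h)) (at z)"
    if z: "z \<in> ball 0 d" for z
  proof -
    have ze: "z \<in> ball 0 e" using z d by auto
    show ?thesis unfolding E_def[abs_def]
      by (rule wd_cong[OF wd_diff[OF d\<phi>[OF ze] wd_add[OF D(2)[OF z] wd_divide[OF wd_diff[OF wd_cnj[OF D(1)[OF z]]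
                wd_mult[OF dX[OF ze] D(1)[OF z]]] ds[OF ze] s(2)[OF ze]]]]])
        (use s[OF ze] in \<open>simp_all add: field_simps\<close>)
  qed
  have E0: "E z = 0" if z: "z \<in> ball 0 d" for z
  proof (rule derivative_bound_imp_zero[OF dE _ _ z])
    show "E 0 = 0" using 1(3,4) by (simp add: E_def)
    fix z h :: complex assume z: "z \<in> ball 0 d"
    have "cmod (- (k z * X z / s z) * E z) \<le> B1 * cmod (E z)" "cmod ((cnj (k z) / s z) * cnj (E z)) \<le> B2 * cmod (E z)"
      unfolding norm_mult[of _ "E z"] norm_mult[of _ "cnj (E z)"] norm_minus_cancel complex_mod_cnj
      using B12[of z] z d by (auto intro!: mult_right_mono)
    from norm_wd_le[OF this, of h]
    show "cmod (- (k z * X z / s z) * E z * h + (cnj (k z) / s z) * cnj (E z) * cnj h) \<le> (B1 + B2) * cmod (E z) * cmod h"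
      by (simp add: distrib_right)
  qed
  show ?thesis
  proof (rule that[of d b c])
    show "0 < d" "d \<le> e" "b 0 = 0" using d 1(3) by auto
    fix z :: complex assume z: "z \<in> ball 0 d"
    then have z': "z \<in> ball 0 d1" using d by auto
    show "(b has_field_derivative k z * c z) (at z)" "(c has_field_derivative m z * b z + n z) (at z)"
      using 1(5,6)[OF z'] by auto
    show "\<phi> z = c z + (cnj (b z) - X z * b z) / s z" using E0[OF z] by (simp add: E_def)
  qed
qed

section \<open>Reduction to the model\<close>

lemma slice_holomorphic:
  assumes "smooth_on f (bidisc e)" "\<And>p. p \<in> bidisc e \<Longrightarrow> pdbar 2 f p = 0"
  shows "(\<lambda>z. f (axis 2 z)) holomorphic_on ball 0 e"
proof (rule holomorphic_onI_wbar[OF open_ball])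
  fix z :: complex assume "z \<in> ball 0 e"
  then have z: "axis 2 z \<in> bidisc e" using axis_in_bidisc by auto
  note h = has_derivative_slice[OF smooth_on_differentiable[OF assms(1) z]]
  show "(\<lambda>z. f (axis 2 z)) differentiable (at z)" using h by (rule differentiableI)
  show "wbar (\<lambda>z. f (axis 2 z)) z = 0" using wbar_eqI[OF h] assms(2)[OF z] by simp
qed

text \<open>
  The coefficients \<open>m\<close> and \<open>n\<close> are holomorphic because the derivatives of the equations for
  \<open>X\<^bsub>2bar\<^esub>\<close> and \<open>\<Phi>\<^bsub>2bar\<^esub>\<close> in \<open>z\<^sub>2\<close> say that \<open>X\<^sub>2 / \<sigma>\<close> and \<open>(\<sigma> \<Phi>)\<^sub>2 / \<sigma>\<close> are annihilated by
  \<open>\<partial>\<^bsub>2bar\<^esub>\<close>. The dependence of \<open>\<Phi>\<close> on \<open>z\<^sub>1\<close> is known from its first-order derivatives, which are functions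
  of \<open>z\<^sub>2\<close>.
\<close>

lemma (in structure_equations) solution:
  obtains d m n y1 x1 y2 x2 b c where "0 < d" "d \<le> e" "y2 0 = 0" "b 0 = 0"
    "\<And>z. z \<in> ball 0 d \<Longrightarrow> (y1 has_field_derivative k (axis 2 z) * x1 z) (at z)"
    "\<And>z. z \<in> ball 0 d \<Longrightarrow> (x1 has_field_derivative m z * y1 z) (at z)"
    "\<And>z. z \<in> ball 0 d \<Longrightarrow> (y2 has_field_derivative k (axis 2 z) * x2 z) (at z)"
    "\<And>z. z \<in> ball 0 d \<Longrightarrow> (b has_field_derivative k (axis 2 z) * c z) (at z)"
    "\<And>z. z \<in> ball 0 d \<Longrightarrow> (c has_field_derivative m z * b z + n z) (at z)"
    "\<And>z. z \<in> ball 0 d \<Longrightarrow> y1 z * x2 z - x1 z * y2 z = 1"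
    "\<And>z. z \<in> ball 0 d \<Longrightarrow> \<sigma> (axis 2 z) = y1 z * cnj (y1 z) - y2 z * cnj (y2 z)"
    "\<And>z. z \<in> ball 0 d \<Longrightarrow> X (axis 2 z) = x1 z * cnj (y1 z) - x2 z * cnj (y2 z)"
    "\<And>p. p \<in> bidisc d \<Longrightarrow> pd 2 X p = m (p $ 2) * \<sigma> p"
    "\<And>p. p \<in> bidisc d \<Longrightarrow> \<Phi> p = c (p $ 2) + (cnj (p $ 1 + b (p $ 2)) - X p * (p $ 1 + b (p $ 2))) / \<sigma> p"
proof -
  let ?\<Delta> = "bidisc e"
  have D: "open ?\<Delta>" by (rule open_bidisc)
  have sm2: "smooth_on (pd 2 X) ?\<Delta>" "smooth_on (pd 2 \<Phi>) ?\<Delta>" "smooth_on (pdbar 2 X) ?\<Delta>" "smooth_on (pdbar 2 \<sigma>) ?\<Delta>"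
    by (intro smooth_on_pd smooth_on_pdbar D sm)+
  note d = sm[THEN smooth_on_differentiable] sm2[THEN smooth_on_differentiable]
  have \<sigma>2': "pdbar 2 \<sigma> p = cnj (k p) * cnj (X p)" if p: "p \<in> ?\<Delta>" for p
  proof -
    have "pdbar 2 \<sigma> p = pdbar 2 (\<lambda>q. cnj (\<sigma> q)) p" by (rule pdbar_cong[OF D p]) (simp add: \<sigma>real)
    then show ?thesis using d(1)[OF p] \<sigma>2[OF p] by (simp add: pdbar_cnj)
  qed
  define \<mu> where "\<mu> p = pd 2 X p / \<sigma> p" for p
  define \<nu> where "\<nu> p = pd 2 \<Phi> p + k p * X p * \<Phi> p / \<sigma> p" for p
  have s\<mu>: "smooth_on \<mu> ?\<Delta>" and s\<nu>: "smooth_on \<nu> ?\<Delta>"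
    unfolding \<mu>_def[abs_def] \<nu>_def[abs_def] using nz by (intro smooth_intros D sm sm2; simp)+
  have ck: "pd 2 (\<lambda>p. cnj (k p)) p = 0" if p: "p \<in> ?\<Delta>" for p
    using d(2)[OF p] k2[OF p] by (simp add: pd_cnj)
  have \<mu>2: "pdbar 2 \<mu> p = 0" if p: "p \<in> ?\<Delta>" for p
  proof -
    have "pd 2 (\<lambda>p. \<sigma> p * pdbar 2 X p) p = pd 2 (\<lambda>p. cnj (k p) * (X p * cnj (X p) - 1)) p"
      by (rule pd_cong[OF D p]) (use nz in \<open>simp add: X2\<close>)
    then have "\<sigma> p * pd 2 (pdbar 2 X) p + X p * (k p * pdbar 2 X p)
        = X p * (cnj (k p) * cnj (pdbar 2 X p)) + pd 2 X p * (cnj (k p) * cnj (X p))"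
      using d[OF p] k2[OF p] by (simp add: wirtinger_simps \<sigma>2[OF p]) (simp add: algebra_simps)
    moreover have "cnj (k p) * cnj (pdbar 2 X p) = k p * pdbar 2 X p"
      unfolding X2[OF p] using \<sigma>real[OF p] by (simp add: mult_ac)
    ultimately have "\<sigma> p * pdbar 2 (pd 2 X) p = pd 2 X p * (cnj (k p) * cnj (X p))"
      using wirtinger_commute(2)[OF D p sm(4), of 2 2] by simp
    then show ?thesis
      unfolding \<mu>_def[abs_def] using d[OF p] nz[OF p] by (simp add: wirtinger_simps \<sigma>2'[OF p] mult.commute)
  qed
  have \<nu>2: "pdbar 2 \<nu> p = 0" if p: "p \<in> ?\<Delta>" for p
  proof -
    have "pdbar 2 (pd 2 \<Phi>) p = pd 2 (\<lambda>p. cnj (k p) * cnj (\<Phi> p) / \<sigma> p) p"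
      unfolding wirtinger_commute(2)[OF D p sm(3)] by (rule pd_cong[OF D p \<Phi>2])
    also have "\<dots> = (cnj (k p) * (k p * \<Phi> p / \<sigma> p) * \<sigma> p - cnj (k p) * cnj (\<Phi> p) * (k p * X p)) / (\<sigma> p)\<^sup>2"
      using d[OF p] nz[OF p] k2[OF p] \<sigma>real[OF p] by (simp add: wirtinger_simps \<sigma>2[OF p] \<Phi>2[OF p])
    finally have 1: "pdbar 2 (pd 2 \<Phi>) p = (cnj (k p) * (k p * \<Phi> p / \<sigma> p) * \<sigma> p - cnj (k p) * cnj (\<Phi> p) * (k p * X p)) / (\<sigma> p)\<^sup>2" .
    show ?thesis
      unfolding \<nu>_def[abs_def] using d[OF p] nz[OF p] k2[OF p] \<sigma>real[OF p]
      by (simp add: wirtinger_simps 1 \<sigma>2'[OF p] \<Phi>2[OF p] X2[OF p] differentiable_divide)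
        (simp add: field_simps power2_eq_square)
  qed
  define K where "K z = k (axis 2 z)" for z
  define s where "s z = \<sigma> (axis 2 z)" for z
  define x where "x z = X (axis 2 z)" for z
  define \<phi> where "\<phi> z = \<Phi> (axis 2 z)" for z
  define m where "m z = \<mu> (axis 2 z)" for z
  define n where "n z = \<nu> (axis 2 z)" for z
  have ax: "axis 2 z \<in> ?\<Delta>" if "z \<in> ball 0 e" for z using that axis_in_bidisc by auto
  have hol: "K holomorphic_on ball 0 e" "m holomorphic_on ball 0 e" "n holomorphic_on ball 0 e"
    unfolding K_def[abs_def] m_def[abs_def] n_def[abs_def]
    by (intro slice_holomorphic sm s\<mu> s\<nu> k2 \<mu>2 \<nu>2; assumption)+
  have s: "cnj (s z) = s z" "s z \<noteq> 0" if "z \<in> ball 0 e" for z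
    using \<sigma>real[OF ax[OF that]] nz[OF ax[OF that]] by (auto simp: s_def)
  have "(axis 2 0 :: complex^2) = 0" by (simp add: vec_eq_iff axis_def)
  with \<sigma>pos[OF zero_in_bidisc[OF e]] have s0: "Re (s 0) > 0" unfolding s_def by (simp only:)
  have ds: "(s has_derivative (\<lambda>h. K z * x z * h + cnj (K z) * cnj (x z) * cnj h)) (at z)" if "z \<in> ball 0 e" for z
    using has_derivative_slice[OF d(1)[OF ax[OF that]]]
    unfolding \<sigma>2[OF ax[OF that]] \<sigma>2'[OF ax[OF that]] s_def[abs_def] K_def x_def .
  have dx: "(x has_derivative (\<lambda>h. m z * s z * h + cnj (K z) * ((x z * cnj (x z) - 1) / s z) * cnj h)) (at z)"
    if "z \<in> ball 0 e" for z
    using has_derivative_slice[OF d(4)[OF ax[OF that]]] nz[OF ax[OF that]]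
    unfolding X2[OF ax[OF that]] s_def K_def x_def[abs_def] m_def \<mu>_def by simp
  have d\<phi>: "(\<phi> has_derivative (\<lambda>h. (n z - K z * x z * \<phi> z / s z) * h + (cnj (K z) * cnj (\<phi> z) / s z) * cnj h)) (at z)"
    if "z \<in> ball 0 e" for z
    using has_derivative_slice[OF d(3)[OF ax[OF that]]]
    unfolding \<Phi>2[OF ax[OF that]] s_def K_def x_def n_def \<nu>_def \<phi>_def[abs_def] by simp
  obtain d1 y1 x1 y2 x2 where 1: "0 < d1" "d1 \<le> e" "y2 0 = 0"
    "\<And>z. z \<in> ball 0 d1 \<Longrightarrow> (y1 has_field_derivative K z * x1 z) (at z)"
    "\<And>z. z \<in> ball 0 d1 \<Longrightarrow> (x1 has_field_derivative m z * y1 z) (at z)"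
    "\<And>z. z \<in> ball 0 d1 \<Longrightarrow> (y2 has_field_derivative K z * x2 z) (at z)"
    "\<And>z. z \<in> ball 0 d1 \<Longrightarrow> y1 z * x2 z - x1 z * y2 z = 1"
    "\<And>z. z \<in> ball 0 d1 \<Longrightarrow> s z = y1 z * cnj (y1 z) - y2 z * cnj (y2 z)"
    "\<And>z. z \<in> ball 0 d1 \<Longrightarrow> x z = x1 z * cnj (y1 z) - x2 z * cnj (y2 z)"
    by (rule liouville_solution[OF e hol(1,2) s s0 ds dx]; (assumption | rule that; assumption)?)
  obtain d2 b c where 2: "0 < d2" "d2 \<le> e" "b 0 = 0"
    "\<And>z. z \<in> ball 0 d2 \<Longrightarrow> (b has_field_derivative K z * c z) (at z)"
    "\<And>z. z \<in> ball 0 d2 \<Longrightarrow> (c has_field_derivative m z * b z + n z) (at z)"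
    "\<And>z. z \<in> ball 0 d2 \<Longrightarrow> \<phi> z = c z + (cnj (b z) - x z * b z) / s z"
    by (rule shift_solution[OF e hol s ds dx d\<phi>]; (assumption | rule that; assumption)?)
  define d0 where "d0 = min d1 d2"
  have d0: "0 < d0" "d0 \<le> e" "d0 \<le> d1" "d0 \<le> d2" using 1(1,2) 2(1) by (auto simp: d0_def)
  have along: "\<psi> p = \<psi> (axis 2 (p $ 2))" if "smooth_on \<psi> ?\<Delta>" "\<And>p. p \<in> ?\<Delta> \<Longrightarrow> pd 1 \<psi> p = 0 \<and> pdbar 1 \<psi> p = 0" "p \<in> ?\<Delta>"
    for \<psi> :: "complex^2 \<Rightarrow> complex" and p
    using constant_along_first[of e \<psi> p] smooth_on_differentiable[OF that(1)] that(2,3) by blast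
  have \<sigma>s: "\<sigma> p = s (p $ 2)" and Xx: "X p = x (p $ 2)" if "p \<in> ?\<Delta>" for p
    using along[OF sm(1) first(1) that] along[OF sm(4) first(3) that] by (auto simp: s_def x_def)
  have s\<sigma>: "\<sigma> p = \<sigma> (axis 2 (p $ 2))" if "p \<in> ?\<Delta>" for p using \<sigma>s[OF that] by (simp add: s_def)
  have \<Phi>form: "\<Phi> p = \<phi> (p $ 2) + (cnj (p $ 1) - X p * p $ 1) / \<sigma> p" if p: "p \<in> ?\<Delta>" for p
  proof -
    define \<psi> where "\<psi> p = \<Phi> p - (cnj (p $ 1) - X p * p $ 1) / \<sigma> p" for p
    have "smooth_on \<psi> ?\<Delta>"
      unfolding \<psi>_def[abs_def] using nz by (intro smooth_intros D sm smooth_on_nth) auto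
    moreover have "pd 1 \<psi> q = 0 \<and> pdbar 1 \<psi> q = 0" if q: "q \<in> ?\<Delta>" for q
      unfolding \<psi>_def[abs_def] using d[OF q] nz[OF q] first[OF q] \<Phi>1[OF q]
      by (simp add: wirtinger_simps differentiable_divide power2_eq_square)
    ultimately have "\<psi> p = \<psi> (axis 2 (p $ 2))" using p by (rule along)
    then show ?thesis by (simp add: \<psi>_def \<phi>_def diff_eq_eq)
  qed
  have Xm: "pd 2 X p = m (p $ 2) * \<sigma> p" if p: "p \<in> ?\<Delta>" for p
  proof -
    have "pd 2 X p = pd 2 (\<lambda>p. x (p $ 2)) p" by (rule pd_cong[OF D p Xx])
    also have "\<dots> = m (p $ 2) * s (p $ 2)"
      using pd_coordinate(1)[OF differentiableI[OF dx[OF nth_in_ball[OF p, of 2]]], of 2]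
        wz_eqI[OF dx[OF nth_in_ball[OF p, of 2]]] by simp
    finally show ?thesis by (simp add: \<sigma>s[OF p])
  qed
  show ?thesis
  proof (rule that[of d0 y2 b y1 x1 m x2 c n])
    show "0 < d0" "d0 \<le> e" "y2 0 = 0" "b 0 = 0" using d0 1(3) 2(3) by auto
    show "pd 2 X p = m (p $ 2) * \<sigma> p" if "p \<in> bidisc d0" for p
      using Xm bidisc_mono[OF d0(2)] that by blast
    show "\<Phi> p = c (p $ 2) + (cnj (p $ 1 + b (p $ 2)) - X p * (p $ 1 + b (p $ 2))) / \<sigma> p" if "p \<in> bidisc d0" for p
    proof -
      have p: "p \<in> ?\<Delta>" using that bidisc_mono[OF d0(2)] by blast
      have z: "p $ 2 \<in> ball 0 d2" using nth_in_ball[OF that, of 2] d0(4) by auto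
      show ?thesis
        unfolding \<Phi>form[OF p] 2(6)[OF z] \<sigma>s[OF p] Xx[OF p]
        by (simp add: add_divide_distrib diff_divide_distrib distrib_left)
    qed
    fix z :: complex assume "z \<in> ball 0 d0"
    then have z: "z \<in> ball 0 d1" "z \<in> ball 0 d2" using d0 by auto
    show "(y1 has_field_derivative k (axis 2 z) * x1 z) (at z)" "(x1 has_field_derivative m z * y1 z) (at z)"
      "(y2 has_field_derivative k (axis 2 z) * x2 z) (at z)" "y1 z * x2 z - x1 z * y2 z = 1"
      "\<sigma> (axis 2 z) = y1 z * cnj (y1 z) - y2 z * cnj (y2 z)"
      "X (axis 2 z) = x1 z * cnj (y1 z) - x2 z * cnj (y2 z)"
      using 1(4-9)[OF z(1)] by (simp_all add: K_def s_def x_def)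
    show "(b has_field_derivative k (axis 2 z) * c z) (at z)" "(c has_field_derivative m z * b z + n z) (at z)"
      using 2(4,5)[OF z(2)] by (simp_all add: K_def)
  qed
qed

text \<open>
  A triangular map: the second component depends on \<open>z\<^sub>2\<close> only, and the first is injective in \<open>z\<^sub>1\<close>. So
  injectivity and nondegeneracy reduce to one variable; that the image is open is invariance of domain.
\<close>

lemma rigidly_equivalentI:
  assumes d: "d > 0" and hol: "holomorphic_vec_on f1 (bidisc d)" "holomorphic_vec_on f3 (bidisc d)"
      "f2 holomorphic_on ball 0 d"
    and zero: "f1 0 = 0" "f2 0 = 0" "f3 0 = 0"
    and nondeg: "pd 1 f1 0 \<noteq> 0" "deriv f2 0 \<noteq> 0"
    and inj: "\<And>p q. p \<in> bidisc d \<Longrightarrow> q \<in> bidisc d \<Longrightarrow> p $ 2 = q $ 2 \<Longrightarrow> f1 p = f1 q \<Longrightarrow> p $ 1 = q $ 1"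
    and FG: "\<And>p. p \<in> bidisc d \<Longrightarrow> F p = G (vector [f1 p, f2 (p $ 2)]) + Re (f3 p)"
  shows "rigidly_equivalent (rigid_hypersurface F) (rigid_hypersurface G)"
proof -
  define g2 where "g2 p = f2 (p $ 2)" for p :: "complex^2"
  define g3 where "g3 p = - f3 p" for p
  have df2: "(f2 has_field_derivative deriv f2 z) (at z)" if "z \<in> ball 0 d" for z
    using holomorphic_derivI[OF hol(3) open_ball that] .
  have dg2: "pd 1 g2 p = 0" "pd 2 g2 p = deriv f2 (p $ 2)" "pdbar j g2 p = 0" "g2 differentiable (at p)"
    if "p \<in> bidisc d" for p j
    unfolding g2_def[abs_def] using pd_coordinate_holomorphic[OF df2[OF nth_in_ball[OF that]]] by auto
  have h2: "holomorphic_vec_on g2 (bidisc d)" by (rule holomorphic_vec_onI) (use dg2 in auto)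
  have diff: "f differentiable (at p)" if "holomorphic_vec_on f (bidisc d)" "p \<in> bidisc d" for f p
    using that unfolding holomorphic_vec_on_def by (meson differentiableI)
  have h3: "holomorphic_vec_on g3 (bidisc d)"
    unfolding holomorphic_vec_on_def g3_def
  proof
    fix p assume "p \<in> bidisc d"
    then obtain c where "(f3 has_derivative (\<lambda>h. \<Sum>j\<in>UNIV. c j * h $ j)) (at p)"
      using hol(2) unfolding holomorphic_vec_on_def by blast
    from has_derivative_minus[OF this]
    show "\<exists>c. ((\<lambda>p. - f3 p) has_derivative (\<lambda>h. \<Sum>j\<in>UNIV. c j * h $ j)) (at p)"
      by (intro exI[of _ "\<lambda>j. - c j"]) (simp add: sum_negf)
  qed
  obtain r where r: "r > 0" "ball (0::complex) r \<subseteq> ball 0 d" "inj_on f2 (ball 0 r)"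
    by (rule has_complex_derivative_locally_injective[OF hol(3) centre_in_ball[THEN iffD2, OF d] open_ball nondeg(2)])
      (rule that; assumption)
  have rd: "r \<le> d"
    using r by (simp add: ball_subset_ball_iff)
  define \<Psi> where "\<Psi> = rigid_map f1 g2 g3 1"
  define W where "W = proj12 -` bidisc r"
  have W: "proj12 p \<in> bidisc d" if "p \<in> W" for p
    using that bidisc_mono[OF rd] by (auto simp: W_def)
  have oW: "open W" unfolding W_def by (rule open_vimage_proj12[OF open_bidisc])
  have \<Psi>: "\<Psi> p $ 1 = f1 (proj12 p)" "\<Psi> p $ 2 = f2 (p $ 2)" "\<Psi> p $ 3 = p $ 3 - f3 (proj12 p)" for p
    by (simp_all add: \<Psi>_def rigid_map_def g2_def g3_def)
  have inj\<Psi>: "inj_on \<Psi> W"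
  proof (rule inj_onI)
    fix p q assume p: "p \<in> W" and q: "q \<in> W" and eq: "\<Psi> p = \<Psi> q"
    have "f2 (p $ 2) = f2 (q $ 2)" using eq \<Psi>(2)[of p] \<Psi>(2)[of q] by simp
    moreover have "p $ 2 \<in> ball 0 r" "q $ 2 \<in> ball 0 r"
      using p q nth_in_ball[of "proj12 p" r 2] nth_in_ball[of "proj12 q" r 2] by (auto simp: W_def)
    ultimately have 2: "p $ 2 = q $ 2" using inj_onD[OF r(3)] by blast
    have "f1 (proj12 p) = f1 (proj12 q)" using eq \<Psi>(1)[of p] \<Psi>(1)[of q] by simp
    then have 1: "p $ 1 = q $ 1" using inj[OF W[OF p] W[OF q]] 2 by simp
    have "proj12 p = proj12 q" using 1 2 by (simp add: vec_eq_iff forall_2)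
    moreover have "p $ 3 - f3 (proj12 p) = q $ 3 - f3 (proj12 q)" using eq \<Psi>(3)[of p] \<Psi>(3)[of q] by simp
    ultimately have "p $ 3 = q $ 3" by (simp only: diff_eq_eq diff_add_cancel)
    then show "p = q" using 1 2 by (simp add: vec_eq_iff forall_3)
  qed
  have comp: "(\<lambda>p. f (proj12 p)) differentiable (at p)" if "holomorphic_vec_on f (bidisc d)" "p \<in> W" for f p
    using pd_proj12(7)[OF diff[OF that(1) W[OF that(2)]]] .
  have c3: "(\<lambda>p. \<Psi> p $ i) differentiable (at p)" if "p \<in> W" for i p
    using exhaust_3[of i] comp[OF hol(1) that] comp[OF h2 that] comp[OF hol(2) that]
    by (auto simp: \<Psi> g2_def[abs_def] intro!: differentiable_diff differentiable_nth)
  have cont: "continuous_on W \<Psi>"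
  proof -
    have "continuous_on W (\<lambda>p. \<chi> i. \<Psi> p $ i)"
      by (intro continuous_on_vec_lambda continuous_at_imp_continuous_on ballI differentiable_imp_continuous_within c3)
    then show ?thesis by simp
  qed
  have zW: "0 \<in> W" using zero_in_bidisc[OF r(1)] by (simp add: W_def) (metis proj12_axis(3) axis_eq_0_iff)
  have image: "\<Psi> ` (rigid_hypersurface F \<inter> W) = rigid_hypersurface G \<inter> \<Psi> ` W"
  proof -
    have "p \<in> rigid_hypersurface F \<longleftrightarrow> \<Psi> p \<in> rigid_hypersurface G" if p: "p \<in> W" for p
    proof -
      have "proj12 (\<Psi> p) = vector [f1 (proj12 p), f2 (p $ 2)]"
        by (simp add: \<Psi> vec_eq_iff forall_2)
      then show ?thesis
        using FG[OF W[OF p]] by (auto simp: rigid_hypersurface_def \<Psi>)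
    qed
    then show ?thesis by auto
  qed
  have p0: "proj12 0 = 0" by (simp add: vec_eq_iff forall_2)
  have det: "det (\<chi> i j. pd j (\<lambda>p. rigid_map f1 g2 g3 1 p $ i) 0) \<noteq> 0"
  proof -
    have z: "proj12 0 \<in> bidisc d" using W[OF zW] .
    note c = pd_proj12[OF diff[OF hol(1) z]] pd_proj12[OF dg2(4)[OF z]]
    have e: "(\<lambda>p. \<Psi> p $ 1) = (\<lambda>p. f1 (proj12 p))" "(\<lambda>p. \<Psi> p $ 2) = (\<lambda>p. g2 (proj12 p))"
        "(\<lambda>p. \<Psi> p $ 3) = (\<lambda>p. p $ 3 - f3 (proj12 p))"
      by (simp_all add: \<Psi> g2_def fun_eq_iff)
    have "pd 3 (\<lambda>p. p $ 3 - f3 (proj12 p)) 0 = 1"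
      using pd_proj12[OF diff[OF hol(2) z]] by (simp add: wirtinger_simps)
    then have "det (\<chi> i j. pd j (\<lambda>p. \<Psi> p $ i) 0) = pd 1 f1 0 * deriv f2 0"
      unfolding det_3 by (simp add: e c p0 dg2[OF z[unfolded p0]])
    then show ?thesis using nondeg by (simp add: \<Psi>_def)
  qed
  show ?thesis
    unfolding rigidly_equivalent_def
    by (rule exI[of _ f1], rule exI[of _ g2], rule exI[of _ g3], rule exI[of _ 1], rule exI[of _ "bidisc d"], rule exI[of _ W])
      (use open_bidisc zero_in_bidisc[OF d] hol(1) h2 h3 zero det oW zW W inj\<Psi> image
         invariance_of_domain[OF cont oW inj\<Psi>] in \<open>auto simp: g2_def g3_def \<Psi>_def\<close>)
qed

text \<open>
  Under the substitution, the model becomes \<open>G = 2 Re (\<zeta> (\<Phi> - \<theta>))\<close> with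
  \<open>\<theta> = c - \<zeta> x\<^sub>1 / y\<^sub>1\<close>. Its gradient \<open>(2 (\<Phi> - \<theta>), k (\<Phi>\<^sup>2 - \<theta>\<^sup>2))\<close> differs from that of \<open>F\<close> by
  holomorphic functions.
\<close>

lemma (in structure_equations) equivalent_to_model_of_solution:
  assumes y: "y2 0 = 0" "b 0 = 0"
    and ode: "\<And>z. z \<in> ball 0 e \<Longrightarrow> (y1 has_field_derivative k (axis 2 z) * x1 z) (at z)"
      "\<And>z. z \<in> ball 0 e \<Longrightarrow> (x1 has_field_derivative m z * y1 z) (at z)"
      "\<And>z. z \<in> ball 0 e \<Longrightarrow> (y2 has_field_derivative k (axis 2 z) * x2 z) (at z)"
      "\<And>z. z \<in> ball 0 e \<Longrightarrow> (b has_field_derivative k (axis 2 z) * c z) (at z)"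
      "\<And>z. z \<in> ball 0 e \<Longrightarrow> (c has_field_derivative m z * b z + n z) (at z)"
    and W: "\<And>z. z \<in> ball 0 e \<Longrightarrow> y1 z * x2 z - x1 z * y2 z = 1"
    and \<sigma>y: "\<And>z. z \<in> ball 0 e \<Longrightarrow> \<sigma> (axis 2 z) = y1 z * cnj (y1 z) - y2 z * cnj (y2 z)"
    and Xy: "\<And>z. z \<in> ball 0 e \<Longrightarrow> X (axis 2 z) = x1 z * cnj (y1 z) - x2 z * cnj (y2 z)"
    and X2m: "\<And>p. p \<in> bidisc e \<Longrightarrow> pd 2 X p = m (p $ 2) * \<sigma> p"
    and \<Phi>form: "\<And>p. p \<in> bidisc e \<Longrightarrow>
      \<Phi> p = c (p $ 2) + (cnj (p $ 1 + b (p $ 2)) - X p * (p $ 1 + b (p $ 2))) / \<sigma> p"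
  shows "rigidly_equivalent (rigid_hypersurface F) (rigid_hypersurface model)"
proof -
  let ?\<Delta> = "bidisc e"
  have D: "open ?\<Delta>" by (rule open_bidisc)
  have along: "\<psi> p = \<psi> (axis 2 (p $ 2))" if "smooth_on \<psi> ?\<Delta>" "\<And>p. p \<in> ?\<Delta> \<Longrightarrow> pd 1 \<psi> p = 0 \<and> pdbar 1 \<psi> p = 0" "p \<in> ?\<Delta>"
    for \<psi> :: "complex^2 \<Rightarrow> complex" and p
    using constant_along_first[of e \<psi> p] smooth_on_differentiable[OF that(1)] that(2,3) by blast
  define Y1 where "Y1 p = y1 (p $ 2)" for p :: "complex^2"
  define X1 where "X1 p = x1 (p $ 2)" for p :: "complex^2"
  define Y2 where "Y2 p = y2 (p $ 2)" for p :: "complex^2"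
  define B where "B p = b (p $ 2)" for p :: "complex^2"
  define C where "C p = c (p $ 2)" for p :: "complex^2"
  define M where "M p = m (p $ 2)" for p :: "complex^2"
  define N where "N p = n (p $ 2)" for p :: "complex^2"
  have kk: "k (axis 2 (p $ 2)) = k p" if "p \<in> ?\<Delta>" for p
    using along[OF sm(2) first(2) that] by simp
  have y1nz: "y1 z \<noteq> 0" if z: "z \<in> ball 0 e" for z
  proof
    assume "y1 z = 0"
    moreover have "Re (\<sigma> (axis 2 z)) > 0" using \<sigma>pos[OF axis_in_bidisc] z by simp
    ultimately have "Re (- (y2 z * cnj (y2 z))) > 0" using \<sigma>y[OF z] by simp
    then show False unfolding complex_norm_square[symmetric] by simp
  qed
  have Y1nz: "Y1 p \<noteq> 0" if "p \<in> ?\<Delta>" for p using y1nz[OF nth_in_ball[OF that]] by (simp add: Y1_def)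
  have ders: "pd 1 Y1 p = 0" "pd 2 Y1 p = k p * X1 p" "pdbar j Y1 p = 0" "Y1 differentiable (at p)"
    "pd 1 X1 p = 0" "pd 2 X1 p = M p * Y1 p" "pdbar j X1 p = 0" "X1 differentiable (at p)"
    "pd 1 B p = 0" "pd 2 B p = k p * C p" "pdbar j B p = 0" "B differentiable (at p)"
    "pd 1 C p = 0" "pd 2 C p = M p * B p + N p" "pdbar j C p = 0" "C differentiable (at p)"
    if p: "p \<in> ?\<Delta>" for p j
    using pd_coordinate_holomorphic[OF ode(1)[OF nth_in_ball[OF p, of 2]]]
      pd_coordinate_holomorphic[OF ode(2)[OF nth_in_ball[OF p, of 2]]]
      pd_coordinate_holomorphic[OF ode(4)[OF nth_in_ball[OF p, of 2]]]
      pd_coordinate_holomorphic[OF ode(5)[OF nth_in_ball[OF p, of 2]]] kk[OF p]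
    unfolding Y1_def[abs_def] X1_def[abs_def] B_def[abs_def] C_def[abs_def] M_def N_def by simp_all
  have hol: "y1 holomorphic_on ball 0 e" "x1 holomorphic_on ball 0 e" "y2 holomorphic_on ball 0 e"
    "b holomorphic_on ball 0 e" "c holomorphic_on ball 0 e"
    using ode by (meson holomorphic_on_open open_ball)+
  have sY: "smooth_on Y1 ?\<Delta>" "smooth_on X1 ?\<Delta>" "smooth_on B ?\<Delta>" "smooth_on C ?\<Delta>"
    unfolding Y1_def[abs_def] X1_def[abs_def] B_def[abs_def] C_def[abs_def]
    by (intro smooth_on_coordinate holomorphic_imp_smooth_on hol open_ball)+
  define U where "U p = X1 p / Y1 p" for p
  have U: "pd 1 U p = 0" "pd 2 U p = M p - k p * (U p)\<^sup>2" "pdbar j U p = 0" "U differentiable (at p)" if p: "p \<in> ?\<Delta>" for p j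
    unfolding U_def[abs_def] using ders[OF p] Y1nz[OF p]
    by (simp_all add: wirtinger_simps differentiable_divide field_simps power2_eq_square)
  define \<zeta> where "\<zeta> p = p $ 1 + B p" for p
  have \<zeta>: "pd 1 \<zeta> p = 1" "pd 2 \<zeta> p = k p * C p" "pdbar j \<zeta> p = 0" "\<zeta> differentiable (at p)" if p: "p \<in> ?\<Delta>" for p j
    unfolding \<zeta>_def[abs_def] using ders[OF p] by (simp_all add: wirtinger_simps)
  define \<theta> where "\<theta> p = C p - \<zeta> p * U p" for p
  have \<theta>: "pd 1 \<theta> p = - U p" "pd 2 \<theta> p = M p * B p + N p - k p * C p * U p - \<zeta> p * (M p - k p * (U p)\<^sup>2)"
      "pdbar j \<theta> p = 0" "\<theta> differentiable (at p)" if p: "p \<in> ?\<Delta>" for p j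
    unfolding \<theta>_def[abs_def] using ders[OF p] \<zeta>[OF p] U[OF p] by (simp_all add: wirtinger_simps)
  have s\<zeta>: "smooth_on \<zeta> ?\<Delta>" and s\<theta>: "smooth_on \<theta> ?\<Delta>"
    unfolding \<theta>_def[abs_def] \<zeta>_def[abs_def] U_def[abs_def] using Y1nz
    by (intro smooth_intros D sY smooth_on_nth; simp)+
  note e\<Phi> = smooth_on_differentiable[OF sm(3)]
  note dX = smooth_on_differentiable[OF sm(4)]
  note e\<sigma> = smooth_on_differentiable[OF sm(1)]
  have \<Phi>\<zeta>: "\<Phi> p = C p + (cnj (\<zeta> p) - X p * \<zeta> p) / \<sigma> p" if "p \<in> ?\<Delta>" for p
    using \<Phi>form[OF that] by (simp add: C_def \<zeta>_def B_def)
  have \<Phi>\<zeta>': "(cnj (\<zeta> p) - X p * \<zeta> p) / \<sigma> p = \<Phi> p - C p" if "p \<in> ?\<Delta>" for p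
    using \<Phi>\<zeta>[OF that] by simp
  have \<Phi>2': "pd 2 \<Phi> p = M p * B p + N p - M p * \<zeta> p - k p * X p * \<Phi> p / \<sigma> p" if p: "p \<in> ?\<Delta>" for p
  proof -
    have "pd 2 \<Phi> p = pd 2 (\<lambda>p. C p + (cnj (\<zeta> p) - X p * \<zeta> p) / \<sigma> p) p" by (rule pd_cong[OF D p \<Phi>\<zeta>])
    also have "\<dots> = M p * B p + N p - M p * \<zeta> p - X p * k p * C p / \<sigma> p
        - (cnj (\<zeta> p) - X p * \<zeta> p) / \<sigma> p * (k p * X p) / \<sigma> p"
      using ders[OF p] \<zeta>[OF p] dX[OF p] e\<sigma>[OF p] nz[OF p] X2m[OF p] \<sigma>2[OF p]
      by (simp add: wirtinger_simps differentiable_divide M_def) (simp add: field_simps power2_eq_square)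
    also have "\<dots> = M p * B p + N p - M p * \<zeta> p - k p * X p * \<Phi> p / \<sigma> p"
      unfolding \<Phi>\<zeta>'[OF p] using nz[OF p] by (simp add: field_simps)
    finally show ?thesis .
  qed
  define E where "E p = \<zeta> p * (\<Phi> p - \<theta> p)" for p
  define G where "G p = Re (2 * E p)" for p
  have sE: "smooth_on E ?\<Delta>" unfolding E_def[abs_def] by (intro smooth_intros D s\<zeta> s\<theta> sm)
  have sG: "smooth_on G ?\<Delta>" unfolding G_def[abs_def] by (intro smooth_intros D sE)
  have cG: "cplx G = (\<lambda>p. E p + cnj (E p))"
    by (simp add: cplx_def G_def complex_add_cnj fun_eq_iff)
  note dE = smooth_on_differentiable[OF sE]
  have G1: "pd 1 (cplx G) p = 2 * (\<Phi> p - \<theta> p)" if p: "p \<in> ?\<Delta>" for p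
  proof -
    have "pd 1 E p = \<zeta> p * (- X p / \<sigma> p + U p) + (\<Phi> p - \<theta> p)"
      unfolding E_def[abs_def] using \<zeta>[OF p] \<theta>[OF p] e\<Phi>[OF p] \<Phi>1[OF p] by (simp add: wirtinger_simps)
    moreover have "pdbar 1 E p = \<zeta> p * (1 / \<sigma> p)"
      unfolding E_def[abs_def] using \<zeta>[OF p] \<theta>[OF p] e\<Phi>[OF p] \<Phi>1[OF p] by (simp add: wirtinger_simps)
    ultimately have "pd 1 (cplx G) p = (\<Phi> p - \<theta> p) + (cnj (\<zeta> p) - X p * \<zeta> p) / \<sigma> p + \<zeta> p * U p"
      unfolding cG using dE[OF p] \<sigma>real[OF p]
      by (simp add: wirtinger_simps) (simp add: algebra_simps diff_divide_distrib)
    then show ?thesis unfolding \<Phi>\<zeta>'[OF p] by (simp add: \<theta>_def)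
  qed
  have G2: "pd 2 (cplx G) p = k p * ((\<Phi> p)\<^sup>2 - (\<theta> p)\<^sup>2)" if p: "p \<in> ?\<Delta>" for p
  proof -
    have "pd 2 E p = \<zeta> p * (M p * B p + N p - M p * \<zeta> p - k p * X p * \<Phi> p / \<sigma> p
        - (M p * B p + N p - k p * C p * U p - \<zeta> p * (M p - k p * (U p)\<^sup>2))) + k p * C p * (\<Phi> p - \<theta> p)"
      unfolding E_def[abs_def] using \<zeta>[OF p] \<theta>[OF p] e\<Phi>[OF p] \<Phi>2'[OF p] by (simp add: wirtinger_simps)
    moreover have "pdbar 2 E p = \<zeta> p * (cnj (k p) * cnj (\<Phi> p) / \<sigma> p)"
      unfolding E_def[abs_def] using \<zeta>[OF p] \<theta>[OF p] e\<Phi>[OF p] \<Phi>2[OF p] by (simp add: wirtinger_simps)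
    ultimately have "pd 2 (cplx G) p = k p * (\<Phi> p * ((cnj (\<zeta> p) - X p * \<zeta> p) / \<sigma> p)
        + C p * (\<zeta> p * U p) - (\<zeta> p * U p)\<^sup>2 + C p * (\<Phi> p - \<theta> p))"
      unfolding cG using dE[OF p] \<sigma>real[OF p]
      by (simp add: wirtinger_simps) (simp add: algebra_simps diff_divide_distrib power2_eq_square)
    moreover have "\<zeta> p * U p = C p - \<theta> p" by (simp add: \<theta>_def)
    ultimately have "pd 2 (cplx G) p = k p * (\<Phi> p * (\<Phi> p - C p)
        + C p * (C p - \<theta> p) - (C p - \<theta> p)\<^sup>2 + C p * (\<Phi> p - \<theta> p))"
      unfolding \<Phi>\<zeta>'[OF p] by (simp only:)
    then show ?thesis by (simp add: algebra_simps power2_eq_square)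
  qed
  define H where "H p = F p - G p" for p
  have sH: "smooth_on H ?\<Delta>" unfolding H_def[abs_def] by (intro smooth_intros D F sG)
  have dF: "cplx F differentiable (at p)" and dG: "cplx G differentiable (at p)"
    and dF1: "pd j (cplx F) differentiable (at p)" if "p \<in> ?\<Delta>" for p j
    using smooth_on_differentiable[OF _ that] smooth_on_cplx[OF D] F(1) sG smooth_on_pd[OF D] by blast+
  have cH: "(\<lambda>p. complex_of_real (H p)) = (\<lambda>p. cplx F p - cplx G p)"
    by (simp add: H_def cplx_def fun_eq_iff)
  have H1: "pd 1 (\<lambda>p. complex_of_real (H p)) p = pd 1 (cplx F) p - 2 * (\<Phi> p - \<theta> p)"
    and H2: "pd 2 (\<lambda>p. complex_of_real (H p)) p = pd 2 (cplx F) p - k p * ((\<Phi> p)\<^sup>2 - (\<theta> p)\<^sup>2)" if p: "p \<in> ?\<Delta>" for p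
    unfolding cH pd_diff[OF dF[OF p] dG[OF p]] using G1[OF p] G2[OF p] by auto
  have ph: "pdbar i (pd j (\<lambda>p. complex_of_real (H p))) p = 0" if p: "p \<in> ?\<Delta>" for i j p
  proof -
    have dk: "k differentiable (at p)" using smooth_on_differentiable[OF sm(2) p] .
    have "pdbar i (pd 1 (\<lambda>p. complex_of_real (H p))) p = pdbar i (\<lambda>p. pd 1 (cplx F) p - 2 * (\<Phi> p - \<theta> p)) p"
      by (rule pdbar_cong[OF D p H1])
    also have "\<dots> = 0"
      using exhaust_2[of i] dF1[OF p] e\<Phi>[OF p] \<theta>[OF p] FF[OF p] \<Phi>1[OF p] \<Phi>2[OF p]
      by (auto simp: wirtinger_simps)
    finally have 1: "pdbar i (pd 1 (\<lambda>p. complex_of_real (H p))) p = 0" .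
    have "pdbar i (pd 2 (\<lambda>p. complex_of_real (H p))) p = pdbar i (\<lambda>p. pd 2 (cplx F) p - k p * ((\<Phi> p)\<^sup>2 - (\<theta> p)\<^sup>2)) p"
      by (rule pdbar_cong[OF D p H2])
    also have "\<dots> = 0"
      using exhaust_2[of i] dF1[OF p] e\<Phi>[OF p] \<theta>[OF p] FF[OF p] \<Phi>1[OF p] \<Phi>2[OF p] dk k2[OF p] first(2)[OF p]
      by (auto simp: wirtinger_simps)
    finally show ?thesis using 1 exhaust_2[of j] by auto
  qed
  obtain f3 where f3: "holomorphic_vec_on f3 ?\<Delta>" "f3 0 = of_real (H 0)" "\<And>p. p \<in> ?\<Delta> \<Longrightarrow> Re (f3 p) = H p"
    using pluriharmonic_imp_Re_holomorphic[OF D convex_bidisc zero_in_bidisc[OF e] sH ph] by blast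
  define f1 where "f1 p = \<zeta> p / Y1 p" for p
  define f2 where "f2 z = y2 z / y1 z" for z
  have f1: "pd 1 f1 p = 1 / Y1 p" "pdbar j f1 p = 0" "f1 differentiable (at p)" if p: "p \<in> ?\<Delta>" for p j
    unfolding f1_def[abs_def] using ders[OF p] \<zeta>[OF p] Y1nz[OF p]
    by (simp_all add: wirtinger_simps differentiable_divide power2_eq_square)
  have f2: "(f2 has_field_derivative k (axis 2 z) / (y1 z)\<^sup>2) (at z)" if z: "z \<in> ball 0 e" for z
  proof -
    have "k (axis 2 z) * x2 z * y1 z - y2 z * (k (axis 2 z) * x1 z) = k (axis 2 z) * (y1 z * x2 z - x1 z * y2 z)"
      by (simp add: algebra_simps)
    then show ?thesis
      unfolding f2_def[abs_def] using DERIV_divide[OF ode(3)[OF z] ode(1)[OF z] y1nz[OF z]] W[OF z]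
      by (simp add: power2_eq_square)
  qed
  have modelG: "model (vector [f1 p, f2 (p $ 2)]) = G p" if p: "p \<in> ?\<Delta>" for p
  proof -
    have z: "p $ 2 \<in> ball 0 e" using nth_in_ball[OF p] .
    let ?y = "Y1 p" and ?w = "Y2 p"
    have s: "\<sigma> p = ?y * cnj ?y - ?w * cnj ?w" and x: "X p = X1 p * cnj ?y - x2 (p $ 2) * cnj ?w"
      and w: "?y * x2 (p $ 2) - X1 p * ?w = 1"
      using \<sigma>y[OF z] Xy[OF z] W[OF z] along[OF sm(1) first(1) p] along[OF sm(4) first(3) p]
      by (simp_all add: Y1_def Y2_def X1_def)
    \<comment> \<open>the normalisation \<open>y\<^sub>1 x\<^sub>2 - x\<^sub>1 y\<^sub>2 = 1\<close> expresses the conjugate of \<open>y\<^sub>2\<close> through \<open>X\<close> and \<open>\<sigma>\<close>\<close>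
    have "X1 p * \<sigma> p - X p * ?y = cnj ?w * (?y * x2 (p $ 2) - X1 p * ?w)"
      unfolding s x by (simp add: algebra_simps)
    then have cw: "cnj ?w = X1 p * \<sigma> p - X p * ?y" using w by simp
    have ynz: "?y \<noteq> 0" "\<sigma> p \<noteq> 0" using Y1nz[OF p] nz[OF p] by auto
    have den: "1 - f2 (p $ 2) * cnj (f2 (p $ 2)) = \<sigma> p / (?y * cnj ?y)"
      unfolding s f2_def using ynz by (simp add: Y1_def Y2_def field_simps)
    have "2 * (f1 p * cnj (f1 p) + cnj (f2 (p $ 2)) * (f1 p)\<^sup>2) / (1 - f2 (p $ 2) * cnj (f2 (p $ 2)))
        = 2 * \<zeta> p * ((cnj (\<zeta> p) + cnj ?w / ?y * \<zeta> p) / \<sigma> p)"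
      unfolding den using ynz by (simp add: f1_def f2_def Y1_def Y2_def field_simps power2_eq_square)
    also have "\<dots> = 2 * \<zeta> p * ((cnj (\<zeta> p) - X p * \<zeta> p) / \<sigma> p + \<zeta> p * U p)"
      unfolding cw U_def using ynz by (simp add: field_simps)
    also have "\<dots> = 2 * E p" unfolding \<Phi>\<zeta>'[OF p] by (simp add: E_def \<theta>_def)
    finally show ?thesis by (simp add: model_def G_def)
  qed
  have z0: "0 \<in> ?\<Delta>" by (rule zero_in_bidisc[OF e])
  have zb: "(0::complex) \<in> ball 0 e" using e by simp
  have f10: "f1 0 = 0" by (simp add: f1_def \<zeta>_def B_def y)
  have f20: "f2 0 = 0" by (simp add: f2_def y)
  have G0: "G 0 = 0" by (simp add: G_def E_def \<zeta>_def B_def y)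
  show ?thesis
  proof (rule rigidly_equivalentI[OF e])
    show "holomorphic_vec_on f1 ?\<Delta>" by (rule holomorphic_vec_onI) (use f1 in auto)
    show "holomorphic_vec_on f3 ?\<Delta>" by (rule f3)
    show "f2 holomorphic_on ball 0 e" using f2 by (meson holomorphic_on_open open_ball)
    show "f1 0 = 0" "f2 0 = 0" by (fact f10 f20)+
    show "f3 0 = 0" using f3(2) G0 F(2) by (simp add: H_def)
    show "pd 1 f1 0 \<noteq> 0" using f1[OF z0] Y1nz[OF z0] by simp
    show "deriv f2 0 \<noteq> 0"
      using DERIV_imp_deriv[OF f2[OF zb]] y1nz[OF zb] nz[OF axis_in_bidisc[of 0 e]] e by simp
    show "p $ 1 = q $ 1" if "p \<in> ?\<Delta>" "q \<in> ?\<Delta>" "p $ 2 = q $ 2" "f1 p = f1 q" for p q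
      using that Y1nz[OF that(1)] by (simp add: f1_def \<zeta>_def B_def Y1_def)
    show "F p = model (vector [f1 p, f2 (p $ 2)]) + Re (f3 p)" if "p \<in> ?\<Delta>" for p
      using modelG[OF that] f3(3)[OF that] by (simp add: H_def)
  qed
qed

lemma rigidly_equivalent_model:
  fixes F :: "complex^2 \<Rightarrow> real"
  assumes gg: "graphing_germ F" and C21: "class_C21 F" and pos: "F11_positive F"
    and S: "S_conditions F" and z2: "F11_only_z2 F"
  shows "rigidly_equivalent (rigid_hypersurface F) (rigid_hypersurface model)"
proof -
  obtain U where U: "open U" "0 \<in> U" "smooth_on F U"
    and CR: "\<And>p. p \<in> rigid_hypersurface F \<Longrightarrow> proj12 p \<in> U \<Longrightarrow>
           levi_rank (rigid_defining F) p = 1 \<and> nondegenerate_at 2 (rigid_defining F) p"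
    using C21 unfolding class_C21_def by blast
  have "\<forall>\<^sub>F p in nhds 0. p \<in> U" using U by (simp add: eventually_nhds_in_open)
  moreover obtain g :: "complex \<Rightarrow> complex" where "\<forall>\<^sub>F p in nhds 0. F11 F p = g (p $ 2)"
    using z2 unfolding F11_only_z2_def by (elim exE)
  ultimately have "\<forall>\<^sub>F p in nhds 0. p \<in> U \<and> F11 F p = g (p $ 2) \<and> (F11 F p \<in> \<real> \<and> Re (F11 F p) > 0) \<and>
      pd 1 (S_fun F) p = 0 \<and> pdbar 1 (S_fun F) p = 0"
    using pos S unfolding F11_positive_def S_conditions_def by (simp add: eventually_conj_iff)
  then obtain e where e: "e > 0" and all: "\<forall>p\<in>bidisc e. p \<in> U \<and> F11 F p = g (p $ 2) \<and>
      (F11 F p \<in> \<real> \<and> Re (F11 F p) > 0) \<and> pd 1 (S_fun F) p = 0 \<and> pdbar 1 (S_fun F) p = 0"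
    unfolding eventually_nhds_0_bidisc by (elim exE conjE)
  have sF: "smooth_on F (bidisc e)" by (rule smooth_on_subset[OF U(3)]) (use all in blast)
  have lift: "\<exists>P. P \<in> rigid_hypersurface F \<and> proj12 P = p" for p
  proof -
    let ?P = "vector [p $ 1, p $ 2, of_real (F p)] :: complex^3"
    have "proj12 ?P = p" by (simp add: vec_eq_iff forall_2)
    then show ?thesis by (intro exI[of _ ?P]) (simp add: rigid_hypersurface_def)
  qed
  have nz: "F11 F p \<noteq> 0" and Rpos: "Re (F11 F p) > 0" and pU: "p \<in> U"
    and Fg: "F11 F p = g (p $ 2)" and S1: "pd 1 (S_fun F) p = 0" "pdbar 1 (S_fun F) p = 0"
    if "p \<in> bidisc e" for p
    using all that by auto
  have ma: "monge_ampere_at F p" if p: "p \<in> bidisc e" for p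
  proof -
    obtain P where P: "P \<in> rigid_hypersurface F" "proj12 P = p" using lift by blast
    then show ?thesis
      using levi_rank_rigid[OF open_bidisc sF, of P] CR[OF P(1)] nz[OF p] pU[OF p] p by simp
  qed
  have Snz: "S_fun F p \<noteq> 0" if p: "p \<in> bidisc e" for p
  proof -
    obtain P where P: "P \<in> rigid_hypersurface F" "proj12 P = p" using lift by blast
    then show ?thesis
      using nondegenerate_rigid[OF open_bidisc sF ma nz, of P] CR[OF P(1)] pU[OF p] p by simp
  qed
  have sR: "smooth_on (F11 F) (bidisc e)"
    unfolding F11_F12_cplx by (intro smooth_on_pd smooth_on_pdbar open_bidisc smooth_on_cplx sF)
  have R1: "pd 1 (F11 F) p = 0" "pdbar 1 (F11 F) p = 0" if p: "p \<in> bidisc e" for p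
  proof -
    have ax: "axis 2 (q $ 2) \<in> bidisc e" if "q \<in> bidisc e" for q :: "complex^2"
      using axis_in_bidisc nth_in_ball[OF that, of 2] by simp
    have eq: "F11 F q = F11 F (axis 2 (q $ 2))" if "q \<in> bidisc e" for q
      using Fg[OF that] Fg[OF ax[OF that]] by simp
    have d: "(\<lambda>z. F11 F (axis 2 z)) differentiable (at (p $ 2))"
      using has_derivative_slice[OF smooth_on_differentiable[OF sR ax[OF p]]] by (rule differentiableI)
    have "pd 1 (F11 F) p = pd 1 (\<lambda>q. F11 F (axis 2 (q $ 2))) p"
      by (rule pd_cong[OF open_bidisc p eq])
    then show "pd 1 (F11 F) p = 0" unfolding pd_coordinate[OF d] by simp
    have "pdbar 1 (F11 F) p = pdbar 1 (\<lambda>q. F11 F (axis 2 (q $ 2))) p"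
      by (rule pdbar_cong[OF open_bidisc p eq])
    then show "pdbar 1 (F11 F) p = 0" unfolding pd_coordinate[OF d] by simp
  qed
  obtain \<sigma> k \<Phi> X where st: "structure_equations e F \<sigma> k \<Phi> X"
    using structure_equations_exist[OF e sF _ ma Rpos Snz S1 R1] gg by (auto simp: graphing_germ_def)
  obtain d m n y1 x1 y2 x2 b c where d: "0 < d" "d \<le> e" and y: "y2 0 = 0" "b 0 = 0"
    and ode: "\<And>z. z \<in> ball 0 d \<Longrightarrow> (y1 has_field_derivative k (axis 2 z) * x1 z) (at z)"
      "\<And>z. z \<in> ball 0 d \<Longrightarrow> (x1 has_field_derivative m z * y1 z) (at z)"
      "\<And>z. z \<in> ball 0 d \<Longrightarrow> (y2 has_field_derivative k (axis 2 z) * x2 z) (at z)"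
      "\<And>z. z \<in> ball 0 d \<Longrightarrow> (b has_field_derivative k (axis 2 z) * c z) (at z)"
      "\<And>z. z \<in> ball 0 d \<Longrightarrow> (c has_field_derivative m z * b z + n z) (at z)"
    and sol: "\<And>z. z \<in> ball 0 d \<Longrightarrow> y1 z * x2 z - x1 z * y2 z = 1"
      "\<And>z. z \<in> ball 0 d \<Longrightarrow> \<sigma> (axis 2 z) = y1 z * cnj (y1 z) - y2 z * cnj (y2 z)"
      "\<And>z. z \<in> ball 0 d \<Longrightarrow> X (axis 2 z) = x1 z * cnj (y1 z) - x2 z * cnj (y2 z)"
      "\<And>p. p \<in> bidisc d \<Longrightarrow> pd 2 X p = m (p $ 2) * \<sigma> p"
      "\<And>p. p \<in> bidisc d \<Longrightarrow> \<Phi> p = c (p $ 2) + (cnj (p $ 1 + b (p $ 2)) - X p * (p $ 1 + b (p $ 2))) / \<sigma> p"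
    by (rule structure_equations.solution[OF st]) (rule that; assumption)
  show ?thesis
    by (rule structure_equations.equivalent_to_model_of_solution[OF structure_equations_mono[OF st d] y ode sol])
qed

theorem theorem2p5:
  shows "(\<forall>F :: complex^2 \<Rightarrow> real.
            graphing_germ F \<and> class_C21 F \<and> F11_positive F \<and> S_conditions F \<and> F11_only_z2 F \<longrightarrow>
            (\<exists>G :: complex^2 \<Rightarrow> real.
               graphing_germ G \<and> normal_form G \<and>
               rigidly_equivalent (rigid_hypersurface F) (rigid_hypersurface G))) \<and>
         (\<forall>F :: complex^2 \<Rightarrow> real.
            graphing_germ F \<and> normal_form F \<longrightarrow>
            class_C21 F \<and> S_conditions F \<and> F11_only_z2 F \<and> F11_positive F)"
  using rigidly_equivalent_model graphing_germ_model normal_form_model normal_form_properties by blast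

end
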